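(* For every $p\in(1,2)$, $$\beta_p^*(\mathbb Z\wr\mathbb Z)=\frac{2p-1}{p^2}.$$
   Context: The (restricted) wreath product $\Gamma=\mathbb Z\wr\mathbb Z$ is the group of all pairs $(f,x)$ where $x\in\mathbb Z$ and $f:\mathbb Z\to\mathbb Z$ has finite support, with product $(f,x)(g,y)=\left(z\mapsto f(z)+g(z-x),\,x+y\right)$. Let $\rho=d_{\Gamma}$ be the left-invariant word metric on $\Gamma$ induced by a finite symmetric generating set (e.g. $(\mathbf 0,\pm1)$, $(\pm\mathbf 1_{\{0\}},0)$); the quantity below does not depend on this choice. A probability measure $\mu$ on $\Gamma$ is symmetric if $\mu(\{g\})=\mu(\{g^{-1}\})$ for all $g$. For such $\mu$ let $g_1,g_2,\dots$ be i.i.d. elements of $\Gamma$ with law $\mu$, and set $W_0^\mu=e_\Gamma$, $W_t^\mu=g_1g_2\cdots g_t$. For a sequence $\{\mu_t\}_{t=1}^\infty$ of symmetric probability measures on $\Gamma$ put $$\beta_p^*\left(\{\mu_t\}_{t=1}^\infty,\rho\right)=\limsup_{t\to\infty}\frac{\log\left(\mathbb E_{\mu_t}\left[\rho(W_t^{\mu_t},e_\Gamma)\right]\right)}{\log\left(t\,\mathbb E_{\mu_t}\left[\rho(W_1^{\mu_t},e_\Gamma)^p\right]\right)}.$$ $\beta_p^*(\Gamma)=\beta_p^*(\Gamma,\rho)$ is the supremum of $\beta_p^*(\{\mu_t\}_{t=1}^\infty,\rho)$ over all sequences of symmetric probability measures on $\Gamma$ with $\int_\Gamma\rho(x,e_\Gamma)^p\,d\mu_t(x)<\infty$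 for all $t\in\mathbb N$ and $\lim_{t\to\infty}t\,\mu_t(\Gamma\setminus\{e_\Gamma\})=\infty$. *)

theory Defs
  imports "HOL-Probability.Probability" "HOL-Algebra.Generated_Groups"
begin

section \<open>The group \<open>\<int> \<wr> \<int>\<close>\<close>

definition wreath_ZZ :: "((int \<Rightarrow> int) \<times> int) monoid" where
  "wreath_ZZ =
     \<lparr>carrier = {(f, x). finite {z. f z \<noteq> 0}},
      mult = (\<lambda>(f, x) (g, y). (\<lambda>z. f z + g (z - x), x + y)),
      one = (\<lambda>_. 0, 0)\<rparr>"

lemma group_wreath_ZZ: "group wreath_ZZ"
proof (rule groupI)
  fix a b assume "a \<in> carrier wreath_ZZ" "b \<in> carrier wreath_ZZ"
  then obtain f x g y where ab: "a = (f, x)" "b = (g, y)"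
    and fin: "finite {z. f z \<noteq> 0}" "finite {z. g z \<noteq> 0}"
    by (auto simp: wreath_ZZ_def)
  have "{z. f z + g (z - x) \<noteq> 0} \<subseteq> {z. f z \<noteq> 0} \<union> (\<lambda>z. z + x) ` {z. g z \<noteq> 0}"
    by (force simp: image_iff intro: exI[of _ "_ - x"])
  then have "finite {z. f z + g (z - x) \<noteq> 0}"
    using fin by (meson finite_UnI finite_imageI finite_subset)
  then show "a \<otimes>\<^bsub>wreath_ZZ\<^esub> b \<in> carrier wreath_ZZ"
    by (simp add: ab wreath_ZZ_def)
next
  fix a assume "a \<in> carrier wreath_ZZ"
  then obtain f x where a: "a = (f, x)" and fin: "finite {z. f z \<noteq> 0}"
    by (auto simp: wreath_ZZ_def)
  have "{z. f (z + x) \<noteq> 0} \<subseteq> (\<lambda>z. z - x) ` {z. f z \<noteq> 0}"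
    by (force simp: image_iff intro: exI[of _ "_ + x"])
  then have "finite {z. f (z + x) \<noteq> 0}"
    using fin by (meson finite_imageI finite_subset)
  then show "\<exists>b\<in>carrier wreath_ZZ. b \<otimes>\<^bsub>wreath_ZZ\<^esub> a = \<one>\<^bsub>wreath_ZZ\<^esub>"
    by (intro bexI[of _ "(\<lambda>z. - f (z + x), - x)"]) (auto simp: a wreath_ZZ_def)
qed (auto simp: wreath_ZZ_def algebra_simps)


section \<open>Word metrics\<close>

definition list_mult :: "('a, 'b) monoid_scheme \<Rightarrow> 'a list \<Rightarrow> 'a" where
  "list_mult G gs = foldr (mult G) gs \<one>\<^bsub>G\<^esub>"

definition finite_symmetric_generating_set :: "('a, 'b) monoid_scheme \<Rightarrow> 'a set \<Rightarrow> bool" where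
  "finite_symmetric_generating_set G S \<longleftrightarrow>
     finite S \<and> S \<subseteq> carrier G \<and> (\<forall>s\<in>S. inv\<^bsub>G\<^esub> s \<in> S) \<and> generate G S = carrier G"

text \<open>Words use letters of \<open>S\<close> only, without inverses, so this is the word length only for
  symmetric \<open>S\<close>; for such generating \<open>S\<close> the minimum is over a nonempty set.\<close>

definition word_length :: "('a, 'b) monoid_scheme \<Rightarrow> 'a set \<Rightarrow> 'a \<Rightarrow> nat" where
  "word_length G S g = (LEAST n. \<exists>gs. length gs = n \<and> set gs \<subseteq> S \<and> list_mult G gs = g)"

definition word_metric :: "('a, 'b) monoid_scheme \<Rightarrow> 'a set \<Rightarrow> 'a \<Rightarrow> 'a \<Rightarrow> real" where
  "word_metric G S x y = real (word_length G S (inv\<^bsub>G\<^esub> x \<otimes>\<^bsub>G\<^esub> y))"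


section \<open>Random walks and the exponent \<open>\<beta>\<^sub>p\<^sup>*\<close>\<close>

text \<open>For a countable group \<open>G\<close>, such as a finitely generated one, the probability measures on \<open>G\<close>
  are exactly the probability mass functions supported on its carrier.\<close>

definition symmetric_pmf_on :: "('a, 'b) monoid_scheme \<Rightarrow> 'a pmf \<Rightarrow> bool" where
  "symmetric_pmf_on G \<mu> \<longleftrightarrow>
     set_pmf \<mu> \<subseteq> carrier G \<and> (\<forall>g\<in>carrier G. pmf \<mu> g = pmf \<mu> (inv\<^bsub>G\<^esub> g))"

text \<open>The law of \<open>W\<^sub>t = g\<^sub>1 \<cdots> g\<^sub>t\<close>, where \<open>g\<^sub>1, \<dots>, g\<^sub>t\<close> are i.i.d. with law \<open>\<mu>\<close>.\<close>

definition walk_pmf :: "('a, 'b) monoid_scheme \<Rightarrow> 'a pmf \<Rightarrow> nat \<Rightarrow> 'a pmf" where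
  "walk_pmf G \<mu> t = map_pmf (list_mult G) (replicate_pmf t \<mu>)"

definition beta_star_seq ::
    "('a, 'b) monoid_scheme \<Rightarrow> ('a \<Rightarrow> 'a \<Rightarrow> real) \<Rightarrow> real \<Rightarrow> (nat \<Rightarrow> 'a pmf) \<Rightarrow> ereal" where
  "beta_star_seq G \<rho> p \<mu> =
     limsup (\<lambda>t. ereal (
       ln (measure_pmf.expectation (walk_pmf G (\<mu> t) t) (\<lambda>w. \<rho> w \<one>\<^bsub>G\<^esub>)) /
       ln (real t * measure_pmf.expectation (walk_pmf G (\<mu> t) 1) (\<lambda>w. \<rho> w \<one>\<^bsub>G\<^esub> powr p))))"

text \<open>Sequences are indexed by \<open>t \<ge> 1\<close>; the value \<open>\<mu> 0\<close> is unconstrained, and the limsup above and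
  the limit below do not depend on it.\<close>

definition admissible_seqs ::
    "('a, 'b) monoid_scheme \<Rightarrow> ('a \<Rightarrow> 'a \<Rightarrow> real) \<Rightarrow> real \<Rightarrow> (nat \<Rightarrow> 'a pmf) set" where
  "admissible_seqs G \<rho> p = {\<mu>.
     (\<forall>t\<ge>1. symmetric_pmf_on G (\<mu> t)) \<and>
     (\<forall>t\<ge>1. integrable (measure_pmf (\<mu> t)) (\<lambda>x. \<rho> x \<one>\<^bsub>G\<^esub> powr p)) \<and>
     filterlim (\<lambda>t. real t * measure_pmf.prob (\<mu> t) (carrier G - {\<one>\<^bsub>G\<^esub>})) at_top sequentially}"

definition beta_star ::
    "('a, 'b) monoid_scheme \<Rightarrow> ('a \<Rightarrow> 'a \<Rightarrow> real) \<Rightarrow> real \<Rightarrow> ereal" where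
  "beta_star G \<rho> p = (SUP \<mu>\<in>admissible_seqs G \<rho> p. beta_star_seq G \<rho> p \<mu>)"

end

theory Submission
  imports Defs "HOL-Real_Asymp.Real_Asymp"
begin

text \<open>
  Write \<open>\<theta> = (2p - 1)/p\<^sup>2\<close>. An element \<open>(f, x)\<close> has word length comparable to its size, which is
  \<open>\<Sum>\<^sub>z \<bar>f z\<bar>\<close> plus the length of the smallest interval containing \<open>0\<close>, \<open>x\<close> and the support of \<open>f\<close>:
  a lamplighter must sweep this interval and operate the lamps one unit at a time
  (\<open>size_le_word_length\<close>, \<open>word_length_le_size\<close>).

  \<^bold>\<open>Upper bound.\<close> Let \<open>M = t E[\<rho>\<^sup>p]\<close>. The energy \<open>\<bar>x\<bar>\<^sup>p + \<Sum>\<^sub>z \<bar>f z\<bar>\<^sup>p\<close> plays the role of the \<open>p\<close>-th power of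
  the norm of a cocycle with values in \<open>\<ell>\<^sub>p\<close>. Since the inverse of the first half of the walk has the
  same law as the second half and is independent of it, the coordinates of the walk at time \<open>2s\<close> are,
  after a translation, differences of independent copies of the coordinates at time \<open>s\<close>. For i.i.d.
  real \<open>U, V\<close> and \<open>p < 2\<close> one has \<open>E\<bar>U - V\<bar>\<^sup>p \<le> 2 E\<bar>U\<bar>\<^sup>p\<close> (\<open>iid_difference_moment\<close>), so doubling the time at
  most doubles the expected energy, and the expected energy at time \<open>t\<close> is \<open>O(M)\<close> (\<open>energy_growth\<close>).
  With a maximal inequality for symmetric walks, the walk stays within an interval of expected length
  \<open>O(M\<^bsup>1/p\<^esup>)\<close> (\<open>walk_reach_upper\<close>). By Hoelder, \<open>R\<close> lamps with energy \<open>M\<close> have total intensity at most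
  \<open>R\<^bsup>1-1/p\<^esup> M\<^bsup>1/p\<^esup>\<close>, and for \<open>R = M\<^bsup>1/p\<^esup>\<close> this is \<open>M\<^bsup>\<theta>\<^esup>\<close> (\<open>walk_size_upper\<close>).

  \<^bold>\<open>Lower bound.\<close> The estimates above are nearly sharp for a walk which, at each step, either jumps with
  a fixed symmetric law of tail index \<open>a > p\<close> close to \<open>p\<close>, or with small probability \<open>q = H\<^bsup>-p\<^esup>\<close> changes
  the current lamp by \<open>\<plusminus>H\<close>. Both kinds of step have bounded \<open>p\<close>-th moment, so \<open>t E[\<rho>\<^sup>p]\<close> is of order \<open>t\<close>.
  By a multi-scale argument the walker is at a given site at time \<open>k\<close> with probability
  \<open>O(k\<^bsup>-\<eta>\<^esup>)\<close> for any \<open>\<eta> < 1/a\<close> (\<open>at_prob_decay\<close>), so during \<open>t\<close> steps a site is visited \<open>O(t\<^bsup>1-\<eta>\<^esup>)\<close> times on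
  average. Taking \<open>q\<close> to be a small multiple of \<open>t\<^bsup>-(1-\<eta>)\<^esup>\<close>, most switches act on an unlit lamp, and the total
  intensity is of order \<open>t H q = t H\<^bsup>1-p\<^esup>\<close> (\<open>walk_lamps_lower\<close>), which is of order
  \<open>t\<close> to the power \<open>1 - (1-\<eta>)(1-1/p)\<close>. This exponent tends to \<open>\<theta>\<close> as \<open>\<eta>\<close> tends to \<open>1/p\<close>.
\<close>

section \<open>The group law\<close>

type_synonym lamplighter = "(int \<Rightarrow> int) \<times> int"

lemma mult_wreath [simp]:
  "(f, x) \<otimes>\<^bsub>wreath_ZZ\<^esub> (g, y) = (\<lambda>z. f z + g (z - x), x + y)"
  by (simp add: wreath_ZZ_def)

lemma mult_wreath_eq:
  "g \<otimes>\<^bsub>wreath_ZZ\<^esub> h = (\<lambda>z. fst g z + fst h (z - snd g), snd g + snd h)"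
  by (cases g; cases h) simp

lemma one_wreath: "\<one>\<^bsub>wreath_ZZ\<^esub> = (\<lambda>_. 0, 0)"
  by (simp add: wreath_ZZ_def)

lemma carrier_wreath: "g \<in> carrier wreath_ZZ \<longleftrightarrow> finite {z. fst g z \<noteq> 0}"
  by (cases g) (simp add: wreath_ZZ_def)

lemma mult_closed_wreath [simp]:
  "g \<in> carrier wreath_ZZ \<Longrightarrow> h \<in> carrier wreath_ZZ \<Longrightarrow> g \<otimes>\<^bsub>wreath_ZZ\<^esub> h \<in> carrier wreath_ZZ"
  using group.is_monoid[OF group_wreath_ZZ] by (rule monoid.m_closed)

lemma mult_assoc_wreath:
  "(g \<otimes>\<^bsub>wreath_ZZ\<^esub> h) \<otimes>\<^bsub>wreath_ZZ\<^esub> k = g \<otimes>\<^bsub>wreath_ZZ\<^esub> (h \<otimes>\<^bsub>wreath_ZZ\<^esub> k)"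
  by (simp add: mult_wreath_eq fun_eq_iff algebra_simps)

lemma one_mult_wreath [simp]:
  "\<one>\<^bsub>wreath_ZZ\<^esub> \<otimes>\<^bsub>wreath_ZZ\<^esub> g = g" "g \<otimes>\<^bsub>wreath_ZZ\<^esub> \<one>\<^bsub>wreath_ZZ\<^esub> = g"
  by (simp_all add: mult_wreath_eq one_wreath)

lemma inv_wreath:
  assumes "g \<in> carrier wreath_ZZ"
  shows "inv\<^bsub>wreath_ZZ\<^esub> g = (\<lambda>z. - fst g (z + snd g), - snd g)"
proof (rule group.inv_equality[OF group_wreath_ZZ _ assms])
  have "{z. fst g (z + snd g) \<noteq> 0} \<subseteq> (\<lambda>z. z - snd g) ` {z. fst g z \<noteq> 0}"
    by (force simp: image_iff intro: exI[of _ "_ + snd g"])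
  then show "(\<lambda>z. - fst g (z + snd g), - snd g) \<in> carrier wreath_ZZ"
    using assms by (auto simp: carrier_wreath intro: finite_subset)
qed (simp add: mult_wreath_eq one_wreath)

section \<open>Size of a lamp configuration\<close>

text \<open>For \<open>\<sigma> = 1\<close> and \<open>\<sigma> = -1\<close> this is the distance from \<open>0\<close> to the right and to the left end of the
  interval that the lamplighter has to sweep.\<close>
definition reach :: "int \<Rightarrow> lamplighter \<Rightarrow> int" where
  "reach \<sigma> g = Max ((\<lambda>z. \<sigma> * z) ` ({0, snd g} \<union> {z. fst g z \<noteq> 0}))"

definition lamps :: "lamplighter \<Rightarrow> int" where
  "lamps g = (\<Sum>z | fst g z \<noteq> 0. \<bar>fst g z\<bar>)"

definition size_ZZ :: "lamplighter \<Rightarrow> int" where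
  "size_ZZ g = lamps g + reach 1 g + reach (-1) g"

lemma reach_ge:
  assumes "g \<in> carrier wreath_ZZ"
  shows "0 \<le> reach \<sigma> g" "\<sigma> * snd g \<le> reach \<sigma> g" "fst g z \<noteq> 0 \<Longrightarrow> \<sigma> * z \<le> reach \<sigma> g"
proof -
  have "finite ((\<lambda>z. \<sigma> * z) ` ({0, snd g} \<union> {z. fst g z \<noteq> 0}))"
    using assms by (simp add: carrier_wreath)
  then have *: "\<sigma> * s \<le> reach \<sigma> g" if "s \<in> {0, snd g} \<union> {z. fst g z \<noteq> 0}" for s
    unfolding reach_def using that by (rule Max_ge[OF _ imageI])
  show "0 \<le> reach \<sigma> g" "\<sigma> * snd g \<le> reach \<sigma> g" "fst g z \<noteq> 0 \<Longrightarrow> \<sigma> * z \<le> reach \<sigma> g"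
    using *[of 0] *[of "snd g"] *[of z] by simp_all
qed

lemma reach_le:
  assumes "g \<in> carrier wreath_ZZ" "0 \<le> b" "\<sigma> * snd g \<le> b" "\<And>z. fst g z \<noteq> 0 \<Longrightarrow> \<sigma> * z \<le> b"
  shows "reach \<sigma> g \<le> b"
proof -
  have "finite ((\<lambda>z. \<sigma> * z) ` ({0, snd g} \<union> {z. fst g z \<noteq> 0}))"
    using assms(1) by (simp add: carrier_wreath)
  then show ?thesis unfolding reach_def by (rule Max.boundedI) (use assms(2-4) in auto)
qed

text \<open>The support of a product is the union of the first support and of a translate of the second.
  The maximum, rather than a sum, is what later makes the range of a long walk comparable to the
  range of its positions.\<close>
lemma reach_mult:
  assumes "g \<in> carrier wreath_ZZ" "h \<in> carrier wreath_ZZ"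
  shows "reach \<sigma> (g \<otimes>\<^bsub>wreath_ZZ\<^esub> h) \<le> max (reach \<sigma> g) (\<sigma> * snd g + reach \<sigma> h)"
proof (rule reach_le)
  fix z assume "fst (g \<otimes>\<^bsub>wreath_ZZ\<^esub> h) z \<noteq> 0"
  then have "fst g z + fst h (z - snd g) \<noteq> 0" by (simp add: mult_wreath_eq)
  then consider "fst g z \<noteq> 0" | "fst h (z - snd g) \<noteq> 0" by linarith
  then show "\<sigma> * z \<le> max (reach \<sigma> g) (\<sigma> * snd g + reach \<sigma> h)"
  proof cases
    case 2
    then show ?thesis using reach_ge(3)[OF assms(2) 2, of \<sigma>] by (simp add: algebra_simps)
  next
    case 1
    then show ?thesis using reach_ge(3)[OF assms(1) 1, of \<sigma>] by simp
  qed
next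
  show "0 \<le> max (reach \<sigma> g) (\<sigma> * snd g + reach \<sigma> h)" 
    using reach_ge(1)[OF assms(1), of \<sigma>] by linarith
  show "\<sigma> * snd (g \<otimes>\<^bsub>wreath_ZZ\<^esub> h) \<le> max (reach \<sigma> g) (\<sigma> * snd g + reach \<sigma> h)"
    using reach_ge(2)[OF assms(2), of \<sigma>] by (simp add: mult_wreath_eq distrib_left le_max_iff_disj)
qed (use assms in simp)

lemma lamps_eq_sum:
  assumes "finite A" "{z. fst g z \<noteq> 0} \<subseteq> A"
  shows "lamps g = (\<Sum>z\<in>A. \<bar>fst g z\<bar>)"
  unfolding lamps_def using assms by (intro sum.mono_neutral_left) auto

lemma lamps_nonneg: "0 \<le> lamps g"
  unfolding lamps_def by (rule sum_nonneg) simp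

lemma lamps_shift:
  assumes "f' = (\<lambda>z. fst g (z - a))"
  shows "lamps (f', x) = lamps g"
proof -
  have "{z. f' z \<noteq> 0} = (\<lambda>z. z + a) ` {z. fst g z \<noteq> 0}"
    by (force simp: assms image_iff intro: exI[of _ "_ - a"])
  then show ?thesis
    unfolding lamps_def by (simp add: sum.reindex inj_on_def assms)
qed

lemma lamps_mult:
  assumes "g \<in> carrier wreath_ZZ" "h \<in> carrier wreath_ZZ"
  shows "lamps (g \<otimes>\<^bsub>wreath_ZZ\<^esub> h) \<le> lamps g + lamps h"
proof -
  define h' where "h' = (\<lambda>z. fst h (z - snd g), 0::int)"
  define A where "A = {z. fst g z \<noteq> 0} \<union> {z. fst h' z \<noteq> 0}"
  have "{z. fst h' z \<noteq> 0} \<subseteq> (\<lambda>z. z + snd g) ` {z. fst h z \<noteq> 0}"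
    by (force simp: h'_def image_iff intro: exI[of _ "_ - snd g"])
  then have fin: "finite A"
    using assms by (auto simp: A_def carrier_wreath intro: finite_subset)
  have "lamps (g \<otimes>\<^bsub>wreath_ZZ\<^esub> h) = (\<Sum>z\<in>A. \<bar>fst g z + fst h' z\<bar>)"
    using fin by (subst lamps_eq_sum[of A]) (auto simp: A_def mult_wreath_eq h'_def)
  also have "\<dots> \<le> (\<Sum>z\<in>A. \<bar>fst g z\<bar>) + (\<Sum>z\<in>A. \<bar>fst h' z\<bar>)"
    unfolding sum.distrib[symmetric] by (rule sum_mono) simp
  also have "\<dots> = lamps g + lamps h'"
    using fin by (subst (1 2) lamps_eq_sum[of A]) (auto simp: A_def)
  also have "lamps h' = lamps h" unfolding h'_def by (rule lamps_shift) simp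
  finally show ?thesis .
qed

lemma size_mult:
  assumes "g \<in> carrier wreath_ZZ" "h \<in> carrier wreath_ZZ"
  shows "size_ZZ (g \<otimes>\<^bsub>wreath_ZZ\<^esub> h) \<le> size_ZZ g + size_ZZ h"
proof -
  have "reach \<sigma> (g \<otimes>\<^bsub>wreath_ZZ\<^esub> h) \<le> reach \<sigma> g + reach \<sigma> h" for \<sigma>
    using reach_mult[OF assms, of \<sigma>] reach_ge(1,2)[OF assms(1), of \<sigma>] reach_ge(1)[OF assms(2), of \<sigma>]
    by linarith
  from this[of 1] this[of "-1"] lamps_mult[OF assms] show ?thesis
    by (simp add: size_ZZ_def)
qed

lemma size_nonneg: "g \<in> carrier wreath_ZZ \<Longrightarrow> 0 \<le> size_ZZ g"
  by (simp add: size_ZZ_def reach_ge lamps_nonneg)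

lemma size_one: "size_ZZ \<one>\<^bsub>wreath_ZZ\<^esub> = 0"
  by (simp add: size_ZZ_def one_wreath reach_def lamps_def)

lemma size_eq_0:
  assumes "g \<in> carrier wreath_ZZ" "size_ZZ g = 0"
  shows "g = \<one>\<^bsub>wreath_ZZ\<^esub>"
proof -
  note r = reach_ge[OF assms(1), of 1] reach_ge[OF assms(1), of "-1"]
  have 0: "lamps g = 0" "reach 1 g = 0" "reach (-1) g = 0"
    using assms(2) r lamps_nonneg[of g] by (auto simp: size_ZZ_def)
  have "snd g = 0" using 0 r by linarith
  moreover have "fst g z = 0" for z
    using 0(1) assms(1) unfolding lamps_def carrier_wreath by (subst (asm) sum_nonneg_eq_0_iff) auto
  ultimately show ?thesis by (cases g) (auto simp: one_wreath)
qed

section \<open>Word length is comparable to size\<close>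

lemma list_mult_simps [simp]:
  "list_mult G [] = \<one>\<^bsub>G\<^esub>" "list_mult G (g # gs) = g \<otimes>\<^bsub>G\<^esub> list_mult G gs"
  by (simp_all add: list_mult_def)

lemma (in group) list_mult_closed:
  "set gs \<subseteq> carrier G \<Longrightarrow> list_mult G gs \<in> carrier G"
  by (induction gs) auto

lemma (in group) list_mult_append:
  "set gs \<subseteq> carrier G \<Longrightarrow> set hs \<subseteq> carrier G \<Longrightarrow>
     list_mult G (gs @ hs) = list_mult G gs \<otimes> list_mult G hs"
  by (induction gs) (auto simp: m_assoc list_mult_closed)

context group
begin

text \<open>As \<open>S\<close> is closed under inverses, the subgroup generated by \<open>S\<close> is already the submonoid of all
  products of words over \<open>S\<close>.\<close>
lemma word_exists:
  assumes S: "finite_symmetric_generating_set G S" and "g \<in> carrier G"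
  shows "\<exists>gs. set gs \<subseteq> S \<and> list_mult G gs = g"
proof -
  have SG: "S \<subseteq> carrier G" "\<And>s. s \<in> S \<Longrightarrow> inv s \<in> S" "generate G S = carrier G"
    using S by (auto simp: finite_symmetric_generating_set_def)
  have "g \<in> generate G S" using assms(2) SG by simp
  then show ?thesis
  proof induction
    case one
    show ?case by (rule exI[of _ "[]"]) simp
  next
    case (incl h)
    then show ?case using SG by (intro exI[of _ "[h]"]) auto
  next
    case (inv h)
    then show ?case using SG by (intro exI[of _ "[inv h]"]) auto
  next
    case (eng h1 h2)
    then obtain gs hs where "set gs \<subseteq> S" "list_mult G gs = h1" "set hs \<subseteq> S" "list_mult G hs = h2"
      by blast
    then show ?case using SG by (intro exI[of _ "gs @ hs"]) (auto simp: list_mult_append)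
  qed
qed

lemma word_length_attained:
  assumes S: "finite_symmetric_generating_set G S" and "g \<in> carrier G"
  obtains gs where "length gs = word_length G S g" "set gs \<subseteq> S" "list_mult G gs = g"
proof -
  obtain gs where "set gs \<subseteq> S \<and> list_mult G gs = g" using word_exists[OF assms] by blast
  then have "\<exists>n gs. length gs = n \<and> set gs \<subseteq> S \<and> list_mult G gs = g" by blast
  from LeastI_ex[OF this] show ?thesis using that unfolding word_length_def by blast
qed

lemma word_length_le:
  "set gs \<subseteq> S \<Longrightarrow> list_mult G gs = g \<Longrightarrow> word_length G S g \<le> length gs"
  unfolding word_length_def by (rule Least_le) blast

lemma word_length_one: "word_length G S \<one> = 0"
  using word_length_le[of "[]" S \<one>] by simp

lemma word_length_mult:
  assumes S: "finite_symmetric_generating_set G S" and "g \<in> carrier G" "h \<in> carrier G"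
  shows "word_length G S (g \<otimes> h) \<le> word_length G S g + word_length G S h"
proof -
  obtain gs hs where "length gs = word_length G S g" "set gs \<subseteq> S" "list_mult G gs = g"
    "length hs = word_length G S h" "set hs \<subseteq> S" "list_mult G hs = h"
    using word_length_attained[OF S] assms(2,3) by metis
  moreover have "S \<subseteq> carrier G" using S by (simp add: finite_symmetric_generating_set_def)
  ultimately show ?thesis
    using word_length_le[of "gs @ hs" S "g \<otimes> h"] by (auto simp: list_mult_append)
qed

lemma word_length_eq_0:
  assumes S: "finite_symmetric_generating_set G S" and "g \<in> carrier G" "word_length G S g = 0"
  shows "g = \<one>"
  using word_length_attained[OF assms(1,2)] assms(3) by (metis length_0_conv list_mult_simps(1))

lemma word_length_inv:
  assumes S: "finite_symmetric_generating_set G S" and "g \<in> carrier G"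
  shows "word_length G S (inv g) = word_length G S g"
proof -
  have *: "word_length G S (inv g) \<le> word_length G S g" if g: "g \<in> carrier G" for g
  proof -
    obtain gs where gs: "length gs = word_length G S g" "set gs \<subseteq> S" "list_mult G gs = g"
      using word_length_attained[OF S g] .
    have SG: "S \<subseteq> carrier G" "\<And>s. s \<in> S \<Longrightarrow> inv s \<in> S"
      using S by (auto simp: finite_symmetric_generating_set_def)
    have "list_mult G (rev (map (\<lambda>s. inv s) gs)) = inv (list_mult G gs)"
      using gs(2)
    proof (induction gs)
      case (Cons a gs)
      have "set (rev (map (\<lambda>s. inv s) gs)) \<subseteq> carrier G" "set gs \<subseteq> carrier G" using Cons.prems SG by auto
      then show ?case using Cons SG list_mult_closed[of gs]
        by (auto simp: list_mult_append inv_mult_group)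
    qed simp
    then show ?thesis
      using word_length_le[of "rev (map (\<lambda>s. inv s) gs)" S "inv g"] gs SG by auto
  qed
  from *[OF assms(2)] *[of "inv g"] assms(2) show ?thesis by (simp add: inv_inv)
qed

end

abbreviation wl :: "lamplighter set \<Rightarrow> lamplighter \<Rightarrow> nat" where
  "wl \<equiv> word_length wreath_ZZ"

text \<open>Size is subadditive and bounded on the finite set \<open>S\<close>.\<close>
lemma size_le_word_length:
  assumes S: "finite_symmetric_generating_set wreath_ZZ S"
  obtains K :: int where "K > 0" "\<And>g. g \<in> carrier wreath_ZZ \<Longrightarrow> size_ZZ g \<le> K * int (wl S g)"
proof
  define K where "K = (\<Sum>s\<in>S. size_ZZ s) + 1"
  have SG: "S \<subseteq> carrier wreath_ZZ" "finite S"
    using S by (auto simp: finite_symmetric_generating_set_def)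
  have "(\<Sum>s\<in>S. size_ZZ s) \<ge> 0" using SG by (intro sum_nonneg size_nonneg) auto
  then show K: "K > 0" by (simp add: K_def)
  have s: "size_ZZ s \<le> K" if "s \<in> S" for s
    using member_le_sum[of s S size_ZZ] that SG size_nonneg by (fastforce simp: K_def)
  have "set gs \<subseteq> S \<Longrightarrow> size_ZZ (list_mult wreath_ZZ gs) \<le> K * int (length gs)" for gs
  proof (induction gs)
    case (Cons g gs)
    then have "size_ZZ (list_mult wreath_ZZ (g # gs)) \<le> size_ZZ g + size_ZZ (list_mult wreath_ZZ gs)"
      using SG by (auto intro!: size_mult group.list_mult_closed[OF group_wreath_ZZ])
    then show ?case using Cons s[of g] by (simp add: algebra_simps)
  qed (simp add: size_one)
  then show "size_ZZ g \<le> K * int (wl S g)" if "g \<in> carrier wreath_ZZ" for g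
    using group.word_length_attained[OF group_wreath_ZZ S that] by metis
qed

abbreviation move :: "int \<Rightarrow> lamplighter" where "move n \<equiv> (\<lambda>_. 0, n)"
abbreviation lamp :: "int \<Rightarrow> lamplighter" where "lamp n \<equiv> (\<lambda>z. if z = 0 then n else 0, 0)"

lemma move_lamp_carrier [simp]: "move n \<in> carrier wreath_ZZ" "lamp n \<in> carrier wreath_ZZ"
  by (simp_all add: carrier_wreath)

text \<open>For a one-parameter subgroup \<open>\<gamma>\<close>: the length grows at most linearly in the parameter. It is applied
  to the translations and to the values of the lamp at \<open>0\<close>.\<close>
lemma word_length_additive:
  assumes S: "finite_symmetric_generating_set wreath_ZZ S"
    and add: "\<And>m n. \<gamma> m \<otimes>\<^bsub>wreath_ZZ\<^esub> \<gamma> n = \<gamma> (m + n :: int)"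
    and car: "\<And>n. \<gamma> n \<in> carrier wreath_ZZ"
  shows "int (wl S (\<gamma> n)) \<le> (int (wl S (\<gamma> 1)) + int (wl S (\<gamma> (-1)))) * \<bar>n\<bar>"
proof -
  have "\<gamma> 0 \<otimes>\<^bsub>wreath_ZZ\<^esub> \<gamma> 0 = \<gamma> 0" using add[of 0 0] by simp
  then have "\<gamma> 0 = \<one>\<^bsub>wreath_ZZ\<^esub>"
    by (rule iffD1[OF group.l_cancel_one[OF group_wreath_ZZ car car]])
  then have 0: "wl S (\<gamma> 0) = 0"
    by (simp add: group.word_length_one[OF group_wreath_ZZ])
  have *: "wl S (\<gamma> (s * int k)) \<le> wl S (\<gamma> s) * k" for s k
  proof (induction k)
    case (Suc k)
    have "\<gamma> (s * int (Suc k)) = \<gamma> s \<otimes>\<^bsub>wreath_ZZ\<^esub> \<gamma> (s * int k)"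
      by (simp add: add algebra_simps)
    then have "wl S (\<gamma> (s * int (Suc k))) \<le> wl S (\<gamma> s) + wl S (\<gamma> (s * int k))"
      using group.word_length_mult[OF group_wreath_ZZ S car car] by metis
    then show ?case using Suc by simp
  qed (simp add: 0)
  show ?thesis
  proof (cases "n \<ge> 0")
    case True
    then have "int (wl S (\<gamma> n)) \<le> int (wl S (\<gamma> 1)) * n"
      using *[of 1 "nat n"] by (simp flip: of_nat_le_iff[where ?'a = int])
    then show ?thesis using True by (simp add: distrib_right add_increasing2)
  next
    case False
    then have "int (wl S (\<gamma> n)) \<le> int (wl S (\<gamma> (-1))) * - n"
      using *[of "-1" "nat (-n)"] by (simp flip: of_nat_le_iff[where ?'a = int])
    moreover have "0 \<le> int (wl S (\<gamma> 1)) * - n" using False by (intro mult_nonneg_nonneg) auto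
    ultimately show ?thesis using False by (simp add: distrib_right abs_if algebra_simps)
  qed
qed

text \<open>The explicit strategy: walk to the left end of the interval, sweep it from left to right setting
  each lamp on the way, then walk to the final position.\<close>
lemma word_length_le_size:
  assumes S: "finite_symmetric_generating_set wreath_ZZ S"
  obtains K :: int where "K > 0" "\<And>g. g \<in> carrier wreath_ZZ \<Longrightarrow> int (wl S g) \<le> K * size_ZZ g"
proof -
  define K where "K = int (wl S (move 1)) + int (wl S (move (-1))) + int (wl S (lamp 1)) + int (wl S (lamp (-1))) + 1"
  note wm = group.word_length_mult[OF group_wreath_ZZ S]
  have K: "K > 0" by (simp add: K_def)
  have move: "int (wl S (move n)) \<le> K * \<bar>n\<bar>" for n
    by (rule order.trans[OF word_length_additive[OF S]]) (auto simp: K_def intro!: mult_right_mono)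
  have lamp: "int (wl S (lamp n)) \<le> K * \<bar>n\<bar>" for n
    by (rule order.trans[OF word_length_additive[OF S, where \<gamma> = lamp]])
       (auto simp: K_def fun_eq_iff intro!: mult_right_mono)
  have sweep: "int (wl S (f, int n)) \<le> K * (int n + lamps (f, int n))"
    if "{z. f z \<noteq> 0} \<subseteq> {0..<int n}" for f n
    using that
  proof (induction n arbitrary: f)
    case 0
    then have "f = (\<lambda>_. 0)" by auto
    then show ?case using group.word_length_one[OF group_wreath_ZZ] by (simp add: one_wreath lamps_def)
  next
    case (Suc n)
    define f' where "f' = f(int n := 0)"
    have f': "{z. f' z \<noteq> 0} \<subseteq> {0..<int n}"
      using Suc.prems by (auto simp: f'_def split: if_splits)
    have car: "(f', int n) \<in> carrier wreath_ZZ" using f' by (auto simp: carrier_wreath intro: finite_subset)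
    have "(f, int (Suc n)) = ((f', int n) \<otimes>\<^bsub>wreath_ZZ\<^esub> lamp (f (int n))) \<otimes>\<^bsub>wreath_ZZ\<^esub> move 1"
      by (auto simp: f'_def fun_eq_iff)
    then have "wl S (f, int (Suc n)) \<le> wl S (f', int n) + wl S (lamp (f (int n))) + wl S (move 1)"
      using wm[of "(f', int n) \<otimes>\<^bsub>wreath_ZZ\<^esub> lamp (f (int n))" "move 1"] wm[of "(f', int n)" "lamp (f (int n))"] car
      by (simp del: mult_wreath)
    then have "int (wl S (f, int (Suc n))) \<le> K * (int n + lamps (f', int n)) + K * \<bar>f (int n)\<bar> + K * 1"
      using Suc.IH[OF f'] lamp[of "f (int n)"] move[of 1] by linarith
    moreover have "lamps (f, int (Suc n)) = lamps (f', int n) + \<bar>f (int n)\<bar>"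
    proof -
      have "{0..<int (Suc n)} = insert (int n) {0..<int n}" by auto
      moreover have "lamps (f, int (Suc n)) = (\<Sum>z\<in>{0..<int (Suc n)}. \<bar>f z\<bar>)"
        using Suc.prems by (subst lamps_eq_sum) auto
      moreover have "lamps (f', int n) = (\<Sum>z\<in>{0..<int n}. \<bar>f' z\<bar>)"
        using f' by (subst lamps_eq_sum) auto
      ultimately show ?thesis by (simp add: f'_def)
    qed
    ultimately show ?case by (simp add: algebra_simps)
  qed
  \<comment> \<open>With \<open>R\<close> the length of the interval, walking to its left end takes at most \<open>R\<close> moves, the sweep,
     which ends one site beyond the interval, \<open>R + 1\<close>, and the way back at most \<open>R + 1\<close>. For a
     nontrivial element the size is at least \<open>1\<close>, so \<open>3 R + 2\<close> is at most \<open>5\<close> times the size.\<close>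
  have "int (wl S g) \<le> (5 * K) * size_ZZ g" if g: "g \<in> carrier wreath_ZZ" for g
  proof (cases "size_ZZ g = 0")
    case True
    then show ?thesis using size_eq_0[OF g True] group.word_length_one[OF group_wreath_ZZ] by simp
  next
    case False
    define a where "a = reach 1 g"
    define b where "b = reach (-1) g"
    note r1 = reach_ge[OF g, where \<sigma> = 1, folded a_def] and r2 = reach_ge[OF g, where \<sigma> = "-1", folded b_def]
    have s1: "size_ZZ g \<ge> 1" using False size_nonneg[OF g] by linarith
    define n where "n = nat (a + b + 1)"
    have n: "int n = a + b + 1" using r1 r2 by (simp add: n_def)
    define f where "f = (\<lambda>z. fst g (z - b))"
    have f: "{z. f z \<noteq> 0} \<subseteq> {0..<int n}"
      using r1(3) r2(3) by (force simp: f_def n)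
    have car: "(f, int n) \<in> carrier wreath_ZZ" using f by (auto simp: carrier_wreath intro: finite_subset)
    have "g = (move (-b) \<otimes>\<^bsub>wreath_ZZ\<^esub> (f, int n)) \<otimes>\<^bsub>wreath_ZZ\<^esub> move (snd g + b - int n)"
      by (cases g) (simp add: f_def)
    then have "wl S g \<le> wl S (move (-b)) + wl S (f, int n) + wl S (move (snd g + b - int n))"
      using wm[of "move (-b) \<otimes>\<^bsub>wreath_ZZ\<^esub> (f, int n)" "move (snd g + b - int n)"] wm[of "move (-b)" "(f, int n)"] car
      by (simp del: mult_wreath)
    then have "int (wl S g) \<le> K * \<bar>-b\<bar> + K * (int n + lamps (f, int n)) + K * \<bar>snd g + b - int n\<bar>"
      using sweep[OF f] move[of "-b"] move[of "snd g + b - int n"] by linarith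
    also have "\<dots> = K * (b + (int n + lamps g) + \<bar>snd g + b - int n\<bar>)"
      using r2(1) lamps_shift[of f g b "int n"] by (simp add: f_def algebra_simps)
    also have "\<dots> \<le> K * (5 * size_ZZ g)"
    proof (rule mult_left_mono)
      have "\<bar>snd g + b - int n\<bar> \<le> a + b + 1" using r1(1,2) r2(1,2) unfolding n by linarith
      then show "b + (int n + lamps g) + \<bar>snd g + b - int n\<bar> \<le> 5 * size_ZZ g"
        using s1 r1(1) r2(1) lamps_nonneg[of g] n unfolding size_ZZ_def a_def[symmetric] b_def[symmetric]
        by (smt (verit))
    qed (use K in simp)
    finally show ?thesis by (simp add: mult_ac)
  qed
  with K show ?thesis by (intro that[of "5 * K"]) auto
qed

section \<open>A moment inequality for differences of i.i.d. variables\<close>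

text \<open>For \<open>0 < p < 2\<close> this is \<open>\<bar>a\<bar>\<^sup>p\<close> up to a positive constant, by scaling: the Levy-Khintchine representation of the exponent of the
  symmetric \<open>p\<close>-stable law. It reduces inequalities for \<open>p\<close>-th moments to inequalities for \<open>1 - cos\<close>.\<close>
definition levy_integral :: "real \<Rightarrow> real \<Rightarrow> ennreal" where
  "levy_integral p a =
     (\<integral>\<^sup>+x. ennreal ((1 - cos (a * x)) * x powr (- 1 - p)) * indicator {0<..} x \<partial>lborel)"

lemma levy_integral_scale:
  assumes "p > 0"
  shows "levy_integral p a = ennreal (\<bar>a\<bar> powr p) * levy_integral p 1"
proof (cases "a = 0")
  case True
  then show ?thesis by (simp add: levy_integral_def)
next
  case False
  define c where "c = \<bar>a\<bar>"
  have c: "c > 0" using False by (simp add: c_def)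
  have "levy_integral p 1 = c * (\<integral>\<^sup>+x. ennreal ((1 - cos (c * x)) * (c * x) powr (- 1 - p)) * indicator {0<..} (c * x) \<partial>lborel)"
    unfolding levy_integral_def using c
    by (subst nn_integral_real_affine[where c = c and t = 0]) auto
  also have "(\<integral>\<^sup>+x. ennreal ((1 - cos (c * x)) * (c * x) powr (- 1 - p)) * indicator {0<..} (c * x) \<partial>lborel)
      = (\<integral>\<^sup>+x. ennreal (c powr (- 1 - p)) * (ennreal ((1 - cos (a * x)) * x powr (- 1 - p)) * indicator {0<..} x) \<partial>lborel)"
  proof (intro nn_integral_cong)
    fix x :: real
    have "cos (c * x) = cos (a * x)" by (simp add: c_def abs_if)
    then show "ennreal ((1 - cos (c * x)) * (c * x) powr (- 1 - p)) * indicator {0<..} (c * x) =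
       ennreal (c powr (- 1 - p)) * (ennreal ((1 - cos (a * x)) * x powr (- 1 - p)) * indicator {0<..} x)"
      using c by (auto simp: indicator_def zero_less_mult_iff powr_mult ennreal_mult' [symmetric] mult_ac)
  qed
  also have "\<dots> = ennreal (c powr (- 1 - p)) * levy_integral p a"
    unfolding levy_integral_def by (rule nn_integral_cmult) auto
  finally have *: "levy_integral p 1 = ennreal (c * c powr (- 1 - p)) * levy_integral p a"
    using c by (simp add: ennreal_mult mult_ac)
  have "c powr p * (c * c powr (- 1 - p)) = 1"
    using c powr_add[of c p "- 1 - p"] powr_minus[of c 1] by (simp add: mult_ac)
  then show ?thesis unfolding * c_def[symmetric]
    using c by (simp add: mult.assoc[symmetric] ennreal_mult''[symmetric] del: ennreal_mult'')
qed

text \<open>The integrand is at most \<open>x\<^bsup>1-p\<^esup>\<close> near \<open>0\<close>, integrable as \<open>p < 2\<close>, and at most \<open>2 x\<^bsup>-1-p\<^esup>\<close> at infinity.\<close>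
lemma levy_integral_finite:
  assumes "1 < p" "p < 2"
  shows "levy_integral p 1 < \<infinity>"
proof -
  have "levy_integral p 1 \<le> (\<integral>\<^sup>+x. ennreal (x powr (1 - p)) * indicator {0..1} x
        + ennreal (2 * x powr (- 1 - p)) * indicator {1..} x \<partial>lborel)"
    unfolding levy_integral_def
  proof (intro nn_integral_mono)
    fix x :: real
    have 1: "(1 - cos x) * x powr (- 1 - p) \<le> x powr (1 - p)" if "0 < x"
    proof -
      have "1 - cos x \<le> x\<^sup>2 / 2" using cos_double_sin[of "x/2"] power_mono[OF abs_sin_x_le_abs_x[of "x/2"], of 2]
        by (simp add: power2_eq_square)
      also have "\<dots> \<le> x\<^sup>2" by simp
      finally have "(1 - cos x) * x powr (- 1 - p) \<le> x powr 2 * x powr (- 1 - p)"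
        using that by (intro mult_right_mono) auto
      also have "\<dots> = x powr (1 - p)" using powr_add[of x 2 "- 1 - p"] by simp
      finally show ?thesis .
    qed
    have 2: "(1 - cos x) * x powr (- 1 - p) \<le> 2 * x powr (- 1 - p)"
      by (intro mult_right_mono) (use cos_ge_minus_one[of x] in auto)
    show "ennreal ((1 - cos (1 * x)) * x powr (- 1 - p)) * indicator {0<..} x \<le>
       ennreal (x powr (1 - p)) * indicator {0..1} x + ennreal (2 * x powr (- 1 - p)) * indicator {1..} x"
    proof (cases "x > 0")
      case True
      show ?thesis
      proof (cases "x < 1")
        case le: True
        show ?thesis using ennreal_leI[OF 1[OF True]] True le by (auto simp del: ennreal_le_iff simp: indicator_def intro: add_increasing2)
      next
        case False
        show ?thesis using ennreal_leI[OF 2] True False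
          by (intro order.trans[OF _ add_increasing[OF zero_le order.refl]]) (simp add: indicator_def)
      qed
    qed simp
  qed
  also have "\<dots> = (\<integral>\<^sup>+x. ennreal (x powr (1 - p)) * indicator {0..1} x \<partial>lborel)
        + (\<integral>\<^sup>+x. ennreal (2 * x powr (- 1 - p)) * indicator {1..} x \<partial>lborel)"
    by (rule nn_integral_add) auto
  also have "(\<integral>\<^sup>+x. ennreal (x powr (1 - p)) * indicator {0..1} x \<partial>lborel) = ennreal (1 powr (1 - p + 1) / (1 - p + 1))"
    using assms by (intro nn_integral_has_integral_lebesgue' has_integral_powr_from_0) auto
  also have "(\<integral>\<^sup>+x. ennreal (2 * x powr (- 1 - p)) * indicator {1..} x \<partial>lborel) = ennreal (2 * (- (1 powr (- 1 - p + 1)) / (- 1 - p + 1)))"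
    using assms by (intro nn_integral_has_integral_lebesgue' has_integral_mult_right has_integral_powr_to_inf) auto
  finally show ?thesis by (simp add: le_less_trans)
qed

lemma levy_integral_nonzero: "levy_integral p 1 \<noteq> 0"
proof
  assume "levy_integral p 1 = 0"
  then have "AE x in lborel. ennreal ((1 - cos (1 * x)) * x powr (- 1 - p)) * indicator {0<..} x = 0"
    unfolding levy_integral_def by (subst (asm) nn_integral_0_iff_AE) auto
  moreover have "ennreal ((1 - cos (1 * x)) * x powr (- 1 - p)) * indicator {0<..} x \<noteq> 0" if "x \<in> {0<..<1}" for x :: real
  proof -
    have "cos x < cos 0" using that pi_gt3 by (intro cos_monotone_0_pi) auto
    then have "(1 - cos x) * x powr (- 1 - p) > 0" using that by simp
    then show ?thesis using that by (simp add: ennreal_eq_0_iff not_le)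
  qed
  ultimately have "AE x in lborel. (x::real) \<notin> {0<..<1}" by (auto elim!: eventually_mono)
  then have "emeasure lborel {0<..<1::real} = 0" 
    by (subst (asm) AE_iff_measurable[of "{0<..<1}"]) auto
  then show False by simp
qed

text \<open>With \<open>c\<close> and \<open>s\<close> the expectations of \<open>cos (u x)\<close> and \<open>sin (u x)\<close>, the left-hand side is
  \<open>1 - c\<^sup>2 - s\<^sup>2\<close>, because the characteristic function of a difference of i.i.d. variables is the squared
  modulus; the right-hand side is \<open>2 (1 - c)\<close>.\<close>
lemma iid_cos:
  fixes \<pi> :: "int pmf" and x :: real
  shows "(\<integral>\<^sup>+u. \<integral>\<^sup>+v. ennreal (1 - cos (real_of_int (v - u) * x)) \<partial>\<pi> \<partial>\<pi>)
     \<le> 2 * (\<integral>\<^sup>+u. ennreal (1 - cos (real_of_int u * x)) \<partial>\<pi>)"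
proof -
  define c where "c = measure_pmf.expectation \<pi> (\<lambda>u. cos (real_of_int u * x))"
  define s where "s = measure_pmf.expectation \<pi> (\<lambda>u. sin (real_of_int u * x))"
  have ic: "integrable \<pi> (\<lambda>u. cos (real_of_int u * x))"
    by (rule measure_pmf.integrable_const_bound[where B = 1]) auto
  have isn: "integrable \<pi> (\<lambda>u. sin (real_of_int u * x))"
    by (rule measure_pmf.integrable_const_bound[where B = 1]) auto
  have "c \<le> 1"
    unfolding c_def using ic by (intro measure_pmf.integral_le_const) auto
  have inner: "(\<integral>\<^sup>+v. ennreal (1 - cos (real_of_int (v - u) * x)) \<partial>\<pi>)
      = ennreal (1 - cos (real_of_int u * x) * c - sin (real_of_int u * x) * s)" for u
  proof -
    have "(\<integral>\<^sup>+v. ennreal (1 - cos (real_of_int (v - u) * x)) \<partial>\<pi>)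
      = (\<integral>\<^sup>+v. ennreal (1 - cos (real_of_int u * x) * cos (real_of_int v * x) - sin (real_of_int u * x) * sin (real_of_int v * x)) \<partial>\<pi>)"
      by (intro nn_integral_cong arg_cong[of _ _ ennreal]) (simp add: left_diff_distrib cos_diff)
    also have "\<dots> = ennreal (measure_pmf.expectation \<pi> (\<lambda>v. 1 - cos (real_of_int u * x) * cos (real_of_int v * x) - sin (real_of_int u * x) * sin (real_of_int v * x)))"
    proof (rule nn_integral_eq_integral)
      show "integrable \<pi> (\<lambda>v. 1 - cos (real_of_int u * x) * cos (real_of_int v * x) - sin (real_of_int u * x) * sin (real_of_int v * x))"
        using ic isn by auto
      have "1 - cos (real_of_int u * x) * cos (real_of_int v * x) - sin (real_of_int u * x) * sin (real_of_int v * x) \<ge> 0" for v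
        using cos_le_one[of "real_of_int u * x - real_of_int v * x"] unfolding cos_diff by linarith
      then show "AE v in \<pi>. 0 \<le> 1 - cos (real_of_int u * x) * cos (real_of_int v * x) - sin (real_of_int u * x) * sin (real_of_int v * x)"
        by auto
    qed
    also have "\<dots> = ennreal (1 - cos (real_of_int u * x) * c - sin (real_of_int u * x) * s)"
      using ic isn by (simp add: c_def s_def)
    finally show ?thesis .
  qed
  have nonneg: "0 \<le> 1 - cos (real_of_int u * x) * c - sin (real_of_int u * x) * s" for u
  proof -
    have "0 \<le> measure_pmf.expectation \<pi> (\<lambda>v. 1 - cos (real_of_int u * x) * cos (real_of_int v * x) - sin (real_of_int u * x) * sin (real_of_int v * x))"
    proof (rule Bochner_Integration.integral_nonneg)
      fix v show "0 \<le> 1 - cos (real_of_int u * x) * cos (real_of_int v * x) - sin (real_of_int u * x) * sin (real_of_int v * x)"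
        using cos_le_one[of "real_of_int u * x - real_of_int v * x"] unfolding cos_diff by linarith
    qed
    then show ?thesis using ic isn by (simp add: c_def s_def)
  qed
  have "(\<integral>\<^sup>+u. \<integral>\<^sup>+v. ennreal (1 - cos (real_of_int (v - u) * x)) \<partial>\<pi> \<partial>\<pi>)
      = ennreal (measure_pmf.expectation \<pi> (\<lambda>u. 1 - cos (real_of_int u * x) * c - sin (real_of_int u * x) * s))"
    unfolding inner using ic isn nonneg by (intro nn_integral_eq_integral) auto
  also have "\<dots> = ennreal (1 - c\<^sup>2 - s\<^sup>2)"
    using ic isn by (simp add: c_def s_def power2_eq_square)
  also have "\<dots> \<le> ennreal (2 * (1 - c))"
  proof (rule ennreal_leI)
    have "0 \<le> (1 - c)\<^sup>2 + s\<^sup>2" by simp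
    then show "1 - c\<^sup>2 - s\<^sup>2 \<le> 2 * (1 - c)" by (simp add: power2_diff)
  qed
  also have "\<dots> = 2 * ennreal (measure_pmf.expectation \<pi> (\<lambda>u. 1 - cos (real_of_int u * x)))"
    using ic \<open>c \<le> 1\<close> ennreal_mult[of 2 "1 - c"] by (simp add: c_def)
  also have "ennreal (measure_pmf.expectation \<pi> (\<lambda>u. 1 - cos (real_of_int u * x)))
      = (\<integral>\<^sup>+u. ennreal (1 - cos (real_of_int u * x)) \<partial>\<pi>)"
    using ic by (intro nn_integral_eq_integral[symmetric]) auto
  finally show ?thesis .
qed

lemma nn_integral_pmf_lborel_swap:
  fixes \<pi> :: "int pmf" and f :: "int \<Rightarrow> real \<Rightarrow> ennreal"
  assumes [measurable]: "\<And>u. f u \<in> borel_measurable borel"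
  shows "(\<integral>\<^sup>+u. \<integral>\<^sup>+x. f u x \<partial>lborel \<partial>\<pi>) = (\<integral>\<^sup>+x. \<integral>\<^sup>+u. f u x \<partial>\<pi> \<partial>lborel)"
    and "(\<lambda>x. \<integral>\<^sup>+u. f u x \<partial>\<pi>) \<in> borel_measurable borel"
proof -
  interpret pair_sigma_finite "measure_pmf \<pi>" "lborel :: real measure"
    by standard
  have "(\<lambda>(u, x). f u x) \<in> borel_measurable (count_space UNIV \<Otimes>\<^sub>M lborel)"
    by (rule measurable_pair_measure_countable1) auto
  then have m: "(\<lambda>(u, x). f u x) \<in> borel_measurable (measure_pmf \<pi> \<Otimes>\<^sub>M lborel)"
    by (subst measurable_cong_sets[OF sets_pair_measure_cong[OF sets_measure_pmf_count_space refl] refl])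
  from Fubini'[OF m] show "(\<integral>\<^sup>+u. \<integral>\<^sup>+x. f u x \<partial>lborel \<partial>\<pi>) = (\<integral>\<^sup>+x. \<integral>\<^sup>+u. f u x \<partial>\<pi> \<partial>lborel)"
    by simp
  have "(\<lambda>(x, u). f u x) \<in> borel_measurable (lborel \<Otimes>\<^sub>M measure_pmf \<pi>)"
    using measurable_pair_swap[OF m] by (simp add: case_prod_unfold)
  then have "(\<lambda>x. \<integral>\<^sup>+u. f u x \<partial>\<pi>) \<in> borel_measurable lborel"
    by (rule measure_pmf.borel_measurable_nn_integral)
  then show "(\<lambda>x. \<integral>\<^sup>+u. f u x \<partial>\<pi>) \<in> borel_measurable borel" by simp
qed

text \<open>The constant \<open>2\<close> is what matters: the triangle inequality alone gives \<open>2\<^sup>p\<close>, which would not lead to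
  linear growth of the energy. It is obtained by integrating \<open>iid_cos\<close> against the Levy measure.\<close>
lemma iid_difference_moment:
  fixes \<pi> :: "int pmf" and p :: real
  assumes p: "1 < p" "p < 2"
  shows "(\<integral>\<^sup>+u. \<integral>\<^sup>+v. ennreal (\<bar>real_of_int (v - u)\<bar> powr p) \<partial>\<pi> \<partial>\<pi>)
     \<le> 2 * (\<integral>\<^sup>+u. ennreal (\<bar>real_of_int u\<bar> powr p) \<partial>\<pi>)" (is "?L \<le> 2 * ?R")
proof -
  define w where "w x = ennreal (x powr (- 1 - p)) * indicator {0<..} x" for x :: real
  have [measurable]: "w \<in> borel_measurable borel" unfolding w_def by auto
  have levy: "ennreal (\<bar>a\<bar> powr p) * levy_integral p 1 = (\<integral>\<^sup>+x. w x * ennreal (1 - cos (a * x)) \<partial>lborel)" for a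
    apply (subst levy_integral_scale[symmetric]) using p apply simp
    unfolding levy_integral_def w_def
    by (intro nn_integral_cong) (auto simp: indicator_def ennreal_mult[symmetric] mult_ac)
  have "?L * levy_integral p 1 =
      (\<integral>\<^sup>+u. \<integral>\<^sup>+v. \<integral>\<^sup>+x. w x * ennreal (1 - cos (real_of_int (v - u) * x)) \<partial>lborel \<partial>\<pi> \<partial>\<pi>)"
    by (subst nn_integral_multc[symmetric], simp, intro nn_integral_cong,
        subst nn_integral_multc[symmetric], simp, intro nn_integral_cong levy)
  also have "\<dots> = (\<integral>\<^sup>+x. \<integral>\<^sup>+u. \<integral>\<^sup>+v. w x * ennreal (1 - cos (real_of_int (v - u) * x)) \<partial>\<pi> \<partial>\<pi> \<partial>lborel)"
    by (subst nn_integral_pmf_lborel_swap(1), measurable,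
        subst nn_integral_pmf_lborel_swap(1), rule nn_integral_pmf_lborel_swap(2), measurable)
  also have "\<dots> = (\<integral>\<^sup>+x. w x * (\<integral>\<^sup>+u. \<integral>\<^sup>+v. ennreal (1 - cos (real_of_int (v - u) * x)) \<partial>\<pi> \<partial>\<pi>) \<partial>lborel)"
    by (simp add: nn_integral_cmult)
  also have "\<dots> \<le> (\<integral>\<^sup>+x. w x * (2 * (\<integral>\<^sup>+u. ennreal (1 - cos (real_of_int u * x)) \<partial>\<pi>)) \<partial>lborel)"
    by (intro nn_integral_mono mult_left_mono iid_cos) auto
  also have "\<dots> = (\<integral>\<^sup>+x. \<integral>\<^sup>+u. 2 * (w x * ennreal (1 - cos (real_of_int u * x))) \<partial>\<pi> \<partial>lborel)"
    by (simp add: nn_integral_cmult[symmetric] mult_ac)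
  also have "\<dots> = (\<integral>\<^sup>+u. \<integral>\<^sup>+x. 2 * (w x * ennreal (1 - cos (real_of_int u * x))) \<partial>lborel \<partial>\<pi>)"
    by (rule nn_integral_pmf_lborel_swap(1)[symmetric]) measurable
  also have "\<dots> = 2 * ?R * levy_integral p 1"
    by (simp add: nn_integral_cmult nn_integral_multc[symmetric] levy[symmetric] mult.assoc)
  finally have "?L * levy_integral p 1 \<le> 2 * ?R * levy_integral p 1" .
  then show ?thesis
    using levy_integral_nonzero[of p] levy_integral_finite[OF p]
    by (simp add: ennreal_mult_le_mult_iff mult.commute)
qed

section \<open>Random walks on the wreath product\<close>

abbreviation walk :: "lamplighter pmf \<Rightarrow> nat \<Rightarrow> lamplighter pmf" where
  "walk \<equiv> walk_pmf wreath_ZZ"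

lemma walk_0: "walk \<mu> 0 = return_pmf \<one>\<^bsub>wreath_ZZ\<^esub>"
  by (simp add: walk_pmf_def)

lemma walk_Suc: "walk \<mu> (Suc t) = bind_pmf \<mu> (\<lambda>g. map_pmf (\<lambda>w. g \<otimes>\<^bsub>wreath_ZZ\<^esub> w) (walk \<mu> t))"
  by (simp add: walk_pmf_def map_bind_pmf map_pmf_comp bind_map_pmf map_pmf_def[symmetric] bind_return_pmf
      flip: map_pmf_def)

lemma walk_1: "walk \<mu> (Suc 0) = \<mu>"
  by (simp add: walk_Suc walk_0 bind_return_pmf')

lemma walk_add: "walk \<mu> (s + t) = bind_pmf (walk \<mu> s) (\<lambda>u. map_pmf (\<lambda>v. u \<otimes>\<^bsub>wreath_ZZ\<^esub> v) (walk \<mu> t))"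
proof (induction s)
  case 0
  have "map_pmf (\<lambda>v. \<one>\<^bsub>wreath_ZZ\<^esub> \<otimes>\<^bsub>wreath_ZZ\<^esub> v) (walk \<mu> t) = walk \<mu> t"
    by (rule map_pmf_idI) simp
  then show ?case unfolding walk_0 bind_return_pmf add_0_left by (rule sym)
next
  case (Suc s)
  show ?case
    by (simp add: walk_Suc Suc map_bind_pmf bind_map_pmf bind_assoc_pmf map_pmf_comp mult_assoc_wreath[abs_def])
qed

lemma set_walk: "set_pmf \<mu> \<subseteq> carrier wreath_ZZ \<Longrightarrow> set_pmf (walk \<mu> t) \<subseteq> carrier wreath_ZZ"
proof (induction t)
  case 0
  then show ?case by (simp add: walk_0 one_wreath carrier_wreath)
next
  case (Suc t)
  then have "g \<otimes>\<^bsub>wreath_ZZ\<^esub> w \<in> carrier wreath_ZZ" if "g \<in> set_pmf \<mu>" "w \<in> set_pmf (walk \<mu> t)" for g w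
    using that by (intro mult_closed_wreath) auto
  then show ?case by (auto simp: walk_Suc)
qed

text \<open>The inverse, extended by the same formula to all pairs, so that it is an involution of the whole
  type and identities for it hold without carrier conditions.\<close>
definition winv :: "lamplighter \<Rightarrow> lamplighter" where
  "winv g = (\<lambda>z. - fst g (z + snd g), - snd g)"

lemma winv_winv [simp]: "winv (winv g) = g"
  by (simp add: winv_def)

lemma winv_one: "winv \<one>\<^bsub>wreath_ZZ\<^esub> = \<one>\<^bsub>wreath_ZZ\<^esub>"
  by (simp add: winv_def one_wreath)

lemma winv_mult: "winv (g \<otimes>\<^bsub>wreath_ZZ\<^esub> h) = winv h \<otimes>\<^bsub>wreath_ZZ\<^esub> winv g"
  by (simp add: winv_def mult_wreath_eq fun_eq_iff algebra_simps)

lemma inv_eq_winv: "g \<in> carrier wreath_ZZ \<Longrightarrow> inv\<^bsub>wreath_ZZ\<^esub> g = winv g"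
  by (simp add: inv_wreath winv_def)

lemma winv_carrier: "winv g \<in> carrier wreath_ZZ \<longleftrightarrow> g \<in> carrier wreath_ZZ"
  using inv_eq_winv group.inv_closed[OF group_wreath_ZZ] winv_winv by metis

lemma symmetric_winv:
  assumes "symmetric_pmf_on wreath_ZZ \<mu>"
  shows "map_pmf winv \<mu> = \<mu>"
proof (rule pmf_eqI)
  fix g
  have "inj winv" by (metis injI winv_winv)
  then have "pmf (map_pmf winv \<mu>) (winv (winv g)) = pmf \<mu> (winv g)"
    by (rule pmf_map_inj')
  moreover have "pmf \<mu> (winv g) = pmf \<mu> g"
  proof (cases "g \<in> carrier wreath_ZZ")
    case True
    then show ?thesis using assms by (simp add: symmetric_pmf_on_def inv_eq_winv[symmetric])
  next
    case False
    then have "g \<notin> set_pmf \<mu>" "winv g \<notin> set_pmf \<mu>"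
      using assms winv_carrier[of g] by (auto simp: symmetric_pmf_on_def)
    then show ?thesis by (simp add: set_pmf_iff)
  qed
  ultimately show "pmf (map_pmf winv \<mu>) g = pmf \<mu> g" by simp
qed

text \<open>Inversion reverses the order of the i.i.d. factors and inverts each of them.\<close>
lemma walk_symmetric:
  assumes "map_pmf winv \<mu> = \<mu>"
  shows "map_pmf winv (walk \<mu> t) = walk \<mu> t"
proof (induction t)
  case 0
  show ?case by (simp add: walk_0 winv_one)
next
  case (Suc t)
  have "map_pmf winv (walk \<mu> (Suc t)) =
      bind_pmf \<mu> (\<lambda>g. bind_pmf (walk \<mu> t) (\<lambda>w. return_pmf (winv w \<otimes>\<^bsub>wreath_ZZ\<^esub> winv g)))"
    by (simp add: walk_Suc map_bind_pmf map_pmf_comp winv_mult) (simp add: map_pmf_def)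
  also have "\<dots> = bind_pmf (walk \<mu> t) (\<lambda>w. bind_pmf \<mu> (\<lambda>g. return_pmf (winv w \<otimes>\<^bsub>wreath_ZZ\<^esub> winv g)))"
    by (rule bind_commute_pmf)
  also have "\<dots> = bind_pmf (map_pmf winv (walk \<mu> t)) (\<lambda>w. bind_pmf (map_pmf winv \<mu>) (\<lambda>g. return_pmf (w \<otimes>\<^bsub>wreath_ZZ\<^esub> g)))"
    by (simp add: bind_map_pmf)
  also have "\<dots> = walk \<mu> (t + 1)"
    unfolding walk_add assms Suc by (simp add: walk_1) (simp add: map_pmf_def)
  finally show ?case by simp
qed

lemma nn_integral_walk_winv:
  assumes "map_pmf winv \<mu> = \<mu>"
  shows "(\<integral>\<^sup>+w. f (winv w) \<partial>walk \<mu> t) = (\<integral>\<^sup>+w. f w \<partial>walk \<mu> t)"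
  by (subst (2) walk_symmetric[OF assms, symmetric]) simp

section \<open>Energy of the walk\<close>

text \<open>Position and lamps are treated uniformly as coordinates of one vector, the position having index
  \<open>None\<close>; the energy is then the \<open>p\<close>-th power of the \<open>\<ell>\<^sub>p\<close> norm.\<close>
definition coord :: "lamplighter \<Rightarrow> int option \<Rightarrow> int" where
  "coord g c = (case c of None \<Rightarrow> snd g | Some z \<Rightarrow> fst g z)"

definition energy :: "real \<Rightarrow> lamplighter \<Rightarrow> ennreal" where
  "energy p g = (\<integral>\<^sup>+c. ennreal (\<bar>real_of_int (coord g c)\<bar> powr p) \<partial>count_space UNIV)"

text \<open>The cocycle property: translating by the position of \<open>u\<close>, which permutes the coordinates, turns
  the coordinates of \<open>u\<inverse> v\<close> into the differences of those of \<open>v\<close> and \<open>u\<close>.\<close>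
lemma energy_mult:
  "energy p (winv u \<otimes>\<^bsub>wreath_ZZ\<^esub> v) =
     (\<integral>\<^sup>+c. ennreal (\<bar>real_of_int (coord v c - coord u c)\<bar> powr p) \<partial>count_space UNIV)"
proof -
  define \<tau> where "\<tau> = map_option (\<lambda>z. z - snd u)"
  have "bij \<tau>"
    by (rule o_bij[of "map_option (\<lambda>z. z + snd u)"]) (auto simp: \<tau>_def fun_eq_iff option.map_comp comp_def option.map_ident)
  then have "energy p (winv u \<otimes>\<^bsub>wreath_ZZ\<^esub> v) =
     (\<integral>\<^sup>+c. ennreal (\<bar>real_of_int (coord (winv u \<otimes>\<^bsub>wreath_ZZ\<^esub> v) (\<tau> c))\<bar> powr p) \<partial>count_space UNIV)"
    unfolding energy_def by (subst nn_integral_bij_count_space[of \<tau> UNIV UNIV]) auto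
  moreover have "coord (winv u \<otimes>\<^bsub>wreath_ZZ\<^esub> v) (\<tau> c) = coord v c - coord u c" for c
    by (cases c) (auto simp: coord_def \<tau>_def mult_wreath_eq winv_def)
  ultimately show ?thesis by simp
qed

lemma nn_integral_pmf_count_space_swap:
  fixes f :: "'a \<Rightarrow> 'b::countable \<Rightarrow> ennreal"
  shows "(\<integral>\<^sup>+u. \<integral>\<^sup>+c. f u c \<partial>count_space UNIV \<partial>measure_pmf \<pi>) =
         (\<integral>\<^sup>+c. \<integral>\<^sup>+u. f u c \<partial>measure_pmf \<pi> \<partial>count_space UNIV)"
proof -
  interpret count: sigma_finite_measure "count_space (UNIV :: 'b set)"
    by (rule sigma_finite_measure_count_space_countable) simp
  interpret pair_sigma_finite "count_space (UNIV :: 'b set)" "measure_pmf \<pi>"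
    by standard
  have "(\<lambda>(c, u). f u c) \<in> borel_measurable (count_space UNIV \<Otimes>\<^sub>M measure_pmf \<pi>)"
    by (rule measurable_pair_measure_countable1) auto
  from Fubini'[OF this] show ?thesis by simp
qed

lemma energy_winv_mult:
  assumes "map_pmf winv \<mu> = \<mu>"
  shows "(\<integral>\<^sup>+w. energy p w \<partial>walk \<mu> (s + t)) = 
    (\<integral>\<^sup>+u. \<integral>\<^sup>+v. energy p (winv u \<otimes>\<^bsub>wreath_ZZ\<^esub> v) \<partial>walk \<mu> t \<partial>walk \<mu> s)"
  unfolding walk_add using nn_integral_walk_winv[OF assms, where f = "\<lambda>u. \<integral>\<^sup>+v. energy p (u \<otimes>\<^bsub>wreath_ZZ\<^esub> v) \<partial>walk \<mu> t" and t = s]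
  by simp

text \<open>By symmetry the walk at time \<open>2t\<close> is distributed as \<open>u\<inverse> v\<close> with \<open>u, v\<close> independent copies of the
  walk at time \<open>t\<close>, so each coordinate is a difference of i.i.d. variables.\<close>
lemma energy_double:
  assumes sym: "map_pmf winv \<mu> = \<mu>" and p: "1 < p" "p < 2"
  shows "(\<integral>\<^sup>+w. energy p w \<partial>walk \<mu> (t + t)) \<le> 2 * (\<integral>\<^sup>+w. energy p w \<partial>walk \<mu> t)"
proof -
  have "(\<integral>\<^sup>+w. energy p w \<partial>walk \<mu> (t + t)) =
     (\<integral>\<^sup>+c. \<integral>\<^sup>+u. \<integral>\<^sup>+v. ennreal (\<bar>real_of_int (coord v c - coord u c)\<bar> powr p) \<partial>walk \<mu> t \<partial>walk \<mu> t \<partial>count_space UNIV)"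
    unfolding energy_winv_mult[OF sym] energy_mult by (simp add: nn_integral_pmf_count_space_swap)
  also have "\<dots> \<le> (\<integral>\<^sup>+c. 2 * (\<integral>\<^sup>+u. ennreal (\<bar>real_of_int (coord u c)\<bar> powr p) \<partial>walk \<mu> t) \<partial>count_space UNIV)"
  proof (rule nn_integral_mono)
    fix c
    show "(\<integral>\<^sup>+u. \<integral>\<^sup>+v. ennreal (\<bar>real_of_int (coord v c - coord u c)\<bar> powr p) \<partial>walk \<mu> t \<partial>walk \<mu> t)
       \<le> 2 * (\<integral>\<^sup>+u. ennreal (\<bar>real_of_int (coord u c)\<bar> powr p) \<partial>walk \<mu> t)"
      using iid_difference_moment[OF p, of "map_pmf (\<lambda>g. coord g c) (walk \<mu> t)"] by simp
  qed
  also have "\<dots> = 2 * (\<integral>\<^sup>+w. energy p w \<partial>walk \<mu> t)"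
    unfolding energy_def by (simp add: nn_integral_cmult nn_integral_pmf_count_space_swap)
  finally show ?thesis .
qed

text \<open>Convexity of \<open>x\<^sup>p\<close> at the points \<open>\<bar>u\<bar>/\<alpha>\<close> and \<open>\<bar>v\<bar>/\<beta>\<close> with weights proportional to \<open>\<alpha>\<close> and \<open>\<beta>\<close>.
  Integrated, with \<open>\<alpha>\<close> and \<open>\<beta>\<close> the two norms, it is Minkowski's inequality.\<close>
lemma powr_abs_diff_le:
  fixes u v \<alpha> \<beta> p :: real
  assumes "\<alpha> > 0" "\<beta> > 0" "p \<ge> 1"
  shows "\<bar>v - u\<bar> powr p \<le> (\<alpha> + \<beta>) powr (p - 1) * (\<alpha> powr (1 - p) * \<bar>u\<bar> powr p + \<beta> powr (1 - p) * \<bar>v\<bar> powr p)"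
proof -
  have one: "x powr p \<le> (\<alpha> + \<beta>) powr (p - 1) * (\<gamma> powr (1 - p) * x powr p)"
    if "\<gamma> > 0" "\<gamma> \<le> \<alpha> + \<beta>" for x \<gamma>
  proof -
    have "1 = \<gamma> powr (p - 1) * \<gamma> powr (1 - p)" using that by (simp flip: powr_add)
    also have "\<dots> \<le> (\<alpha> + \<beta>) powr (p - 1) * \<gamma> powr (1 - p)"
      using that assms by (intro mult_right_mono powr_mono2) auto
    finally show ?thesis using mult_right_mono[of 1 _ "x powr p"] by (fastforce simp: mult.assoc)
  qed
  have "\<bar>v - u\<bar> powr p \<le> (\<bar>u\<bar> + \<bar>v\<bar>) powr p" using assms by (intro powr_mono2) auto
  also have "\<dots> \<le> (\<alpha> + \<beta>) powr (p - 1) * (\<alpha> powr (1 - p) * \<bar>u\<bar> powr p + \<beta> powr (1 - p) * \<bar>v\<bar> powr p)"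
  proof (cases "u = 0 \<or> v = 0")
    case True
    then show ?thesis using one[of \<alpha> "\<bar>u\<bar>"] one[of \<beta> "\<bar>v\<bar>"] assms by auto
  next
    case False
    define s where "s = \<alpha> + \<beta>"
    have s: "s > 0" using assms by (simp add: s_def)
    have t: "1 - \<beta> / s = \<alpha> / s" using s by (simp add: s_def field_simps)
    have "((1 - \<beta> / s) *\<^sub>R (s * \<bar>u\<bar> / \<alpha>) + (\<beta> / s) *\<^sub>R (s * \<bar>v\<bar> / \<beta>)) powr p
      \<le> (1 - \<beta> / s) * (s * \<bar>u\<bar> / \<alpha>) powr p + (\<beta> / s) * (s * \<bar>v\<bar> / \<beta>) powr p"
      using assms s False by (intro convex_onD[OF powr_convex]) (auto simp: s_def)
    also have "(1 - \<beta> / s) *\<^sub>R (s * \<bar>u\<bar> / \<alpha>) + (\<beta> / s) *\<^sub>R (s * \<bar>v\<bar> / \<beta>) = \<bar>u\<bar> + \<bar>v\<bar>"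
      unfolding t using assms s by simp
    also have "(1 - \<beta> / s) * (s * \<bar>u\<bar> / \<alpha>) powr p = s powr (p - 1) * (\<alpha> powr (1 - p) * \<bar>u\<bar> powr p)"
      unfolding t using assms s by (simp add: powr_mult powr_divide powr_diff)
    also have "(\<beta> / s) * (s * \<bar>v\<bar> / \<beta>) powr p = s powr (p - 1) * (\<beta> powr (1 - p) * \<bar>v\<bar> powr p)"
      using assms s by (simp add: powr_mult powr_divide powr_diff)
    finally show ?thesis by (simp add: s_def distrib_left)
  qed
  finally show ?thesis .
qed

text \<open>Minkowski's inequality for the \<open>p\<close>-norms of the walk at times \<open>s\<close> and \<open>t\<close>, used for odd times.\<close>
lemma energy_step:
  assumes sym: "map_pmf winv \<mu> = \<mu>" and p: "1 < p" and pos: "\<alpha> > 0" "\<beta> > 0"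
    and s: "(\<integral>\<^sup>+w. energy p w \<partial>walk \<mu> s) \<le> ennreal (\<alpha> powr p) * A"
    and t: "(\<integral>\<^sup>+w. energy p w \<partial>walk \<mu> t) \<le> ennreal (\<beta> powr p) * A"
  shows "(\<integral>\<^sup>+w. energy p w \<partial>walk \<mu> (s + t)) \<le> ennreal ((\<alpha> + \<beta>) powr p) * A"
proof -
  have pw: "energy p (winv u \<otimes>\<^bsub>wreath_ZZ\<^esub> v) \<le> ennreal ((\<alpha> + \<beta>) powr (p - 1)) *
     (ennreal (\<alpha> powr (1 - p)) * energy p u + ennreal (\<beta> powr (1 - p)) * energy p v)" for u v
  proof -
    have "energy p (winv u \<otimes>\<^bsub>wreath_ZZ\<^esub> v) \<le>
      (\<integral>\<^sup>+c. ennreal ((\<alpha> + \<beta>) powr (p - 1)) *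
        (ennreal (\<alpha> powr (1 - p)) * ennreal (\<bar>real_of_int (coord u c)\<bar> powr p) 
        + ennreal (\<beta> powr (1 - p)) * ennreal (\<bar>real_of_int (coord v c)\<bar> powr p)) \<partial>count_space UNIV)"
      unfolding energy_mult
    proof (rule nn_integral_mono)
      fix c
      show "ennreal (\<bar>real_of_int (coord v c - coord u c)\<bar> powr p) \<le> ennreal ((\<alpha> + \<beta>) powr (p - 1)) *
        (ennreal (\<alpha> powr (1 - p)) * ennreal (\<bar>real_of_int (coord u c)\<bar> powr p) 
        + ennreal (\<beta> powr (1 - p)) * ennreal (\<bar>real_of_int (coord v c)\<bar> powr p))"
        using ennreal_leI[OF powr_abs_diff_le[OF pos, of p "real_of_int (coord v c)" "real_of_int (coord u c)"]] p
        by (simp add: ennreal_mult ennreal_plus)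
    qed
    then show ?thesis
      unfolding energy_def by (simp add: nn_integral_cmult nn_integral_add)
  qed
  have "(\<integral>\<^sup>+w. energy p w \<partial>walk \<mu> (s + t)) \<le>
     (\<integral>\<^sup>+u. \<integral>\<^sup>+v. ennreal ((\<alpha> + \<beta>) powr (p - 1)) *
     (ennreal (\<alpha> powr (1 - p)) * energy p u + ennreal (\<beta> powr (1 - p)) * energy p v) \<partial>walk \<mu> t \<partial>walk \<mu> s)"
    unfolding energy_winv_mult[OF sym] by (intro nn_integral_mono pw)
  also have "\<dots> = ennreal ((\<alpha> + \<beta>) powr (p - 1)) * (ennreal (\<alpha> powr (1 - p)) * (\<integral>\<^sup>+w. energy p w \<partial>walk \<mu> s)
     + ennreal (\<beta> powr (1 - p)) * (\<integral>\<^sup>+w. energy p w \<partial>walk \<mu> t))"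
    by (simp add: nn_integral_cmult nn_integral_add)
  also have "\<dots> \<le> ennreal ((\<alpha> + \<beta>) powr (p - 1)) * (ennreal (\<alpha> powr (1 - p)) * (ennreal (\<alpha> powr p) * A)
     + ennreal (\<beta> powr (1 - p)) * (ennreal (\<beta> powr p) * A))"
    by (intro mult_left_mono add_mono s t) auto
  also have "\<dots> = ennreal ((\<alpha> + \<beta>) powr (p - 1)) * (ennreal (\<alpha> powr (1 - p) * \<alpha> powr p) 
     + ennreal (\<beta> powr (1 - p) * \<beta> powr p)) * A"
    by (simp add: ennreal_mult distrib_right mult.assoc distrib_left)
  also have "\<dots> = ennreal ((\<alpha> + \<beta>) powr (p - 1) * (\<alpha> + \<beta>)) * A"
    using pos by (simp add: ennreal_mult ennreal_plus flip: powr_add)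
  also have "(\<alpha> + \<beta>) powr (p - 1) * (\<alpha> + \<beta>) = (\<alpha> + \<beta>) powr p"
    using pos powr_add[of "\<alpha> + \<beta>" "p - 1" 1] by simp
  finally show ?thesis .
qed

text \<open>Halving the time repeatedly: an even time costs a factor \<open>r = 2\<^bsup>1/p\<^esup>\<close> in norm, an odd time in
  addition one single step. These additive errors form a geometric series, so they do not spoil the
  linear growth. The correction \<open>-L\<close> in the induction hypothesis absorbs them, as \<open>r L = L + 1\<close>.\<close>
lemma energy_growth:
  assumes p: "1 < p" "p < 2"
  obtains C :: real where "C > 0"
    "\<And>\<mu> t. map_pmf winv \<mu> = \<mu> \<Longrightarrow> t \<ge> 1 \<Longrightarrow>
       (\<integral>\<^sup>+w. energy p w \<partial>walk \<mu> t) \<le> ennreal (C * real t) * (\<integral>\<^sup>+g. energy p g \<partial>\<mu>)"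
proof -
  define r where "r = 2 powr (1 / p)"
  have r: "r > 1" using p powr_less_mono[of 0 "1/p" 2] by (simp add: r_def)
  define L where "L = 1 / (r - 1)"
  define K where "K = L + 1"
  have L: "L > 0" "r * L = L + 1" using r by (auto simp: L_def field_simps)
  have K: "K > 0" using L by (simp add: K_def)
  define b where "b t = K * real t powr (1 / p) - L" for t
  have b: "b t \<ge> 1" if "t \<ge> 1" for t
  proof -
    have "real t powr (1 / p) \<ge> 1" using that p by (intro ge_one_powr_ge_zero) auto
    then have "K * real t powr (1 / p) \<ge> K * 1" using K by (intro mult_left_mono) auto
    then show ?thesis by (simp add: b_def K_def)
  qed
  have b2: "r * b s = K * real (s + s) powr (1 / p) - L - 1" for s
  proof -
    have "real (s + s) powr (1 / p) = r * real s powr (1 / p)"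
      unfolding r_def by (simp flip: powr_mult)
    then show ?thesis using L(2) by (simp add: b_def algebra_simps)
  qed
  have main: "(\<integral>\<^sup>+w. energy p w \<partial>walk \<mu> t) \<le> ennreal (b t powr p) * (\<integral>\<^sup>+g. energy p g \<partial>\<mu>)"
    if sym: "map_pmf winv \<mu> = \<mu>" and t: "t \<ge> 1" for \<mu> t
    using t
  proof (induction t rule: less_induct)
    case (less t)
    define A where "A = (\<integral>\<^sup>+g. energy p g \<partial>\<mu>)"
    show ?case unfolding A_def[symmetric]
    proof (cases "t = 1")
      case True
      then show "(\<integral>\<^sup>+w. energy p w \<partial>walk \<mu> t) \<le> ennreal (b t powr p) * A" by (simp add: walk_1 A_def b_def K_def)
    next
      case False
      define s where "s = t div 2"
      have s: "s < t" "s \<ge> 1" using less.prems False by (auto simp: s_def)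
      have "(\<integral>\<^sup>+w. energy p w \<partial>walk \<mu> (s + s)) \<le> 2 * (ennreal (b s powr p) * A)"
        using energy_double[OF sym p, of s] less.IH[OF s] unfolding A_def by (meson mult_left_mono order.trans zero_le)
      also have "\<dots> = ennreal ((r * b s) powr p) * A"
      proof -
        have "(r * b s) powr p = 2 * b s powr p" using p b[OF s(2)] by (simp add: powr_mult r_def powr_powr)
        then show ?thesis by (simp add: ennreal_mult mult.assoc)
      qed
      finally have d: "(\<integral>\<^sup>+w. energy p w \<partial>walk \<mu> (s + s)) \<le> ennreal ((r * b s) powr p) * A" .
      have pos: "r * b s > 0" using r b[OF s(2)] by simp
      consider "t = s + s" | "t = s + s + 1" unfolding s_def by linarith
      then show "(\<integral>\<^sup>+w. energy p w \<partial>walk \<mu> t) \<le> ennreal (b t powr p) * A"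
      proof cases
        case 1
        have "r * b s \<le> b t" unfolding b2 1 by (simp add: b_def)
        then have "ennreal ((r * b s) powr p) * A \<le> ennreal (b t powr p) * A"
          using pos p by (intro mult_right_mono ennreal_leI powr_mono2) auto
        with d show ?thesis unfolding 1 by (rule order.trans)
      next
        case 2
        have "(\<integral>\<^sup>+w. energy p w \<partial>walk \<mu> (s + s + 1)) \<le> ennreal ((r * b s + 1) powr p) * A"
          by (rule energy_step[OF sym p(1) pos zero_less_one d]) (simp add: walk_1 A_def)
        also have "r * b s + 1 \<le> b t"
        proof -
          have "K * real (s + s) powr (1 / p) \<le> K * real t powr (1 / p)"
            using K p by (intro mult_left_mono powr_mono2) (auto simp: 2)
          then show ?thesis unfolding b2 by (simp add: b_def)
        qed
        then have "ennreal ((r * b s + 1) powr p) * A \<le> ennreal (b t powr p) * A"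
          using pos p by (intro mult_right_mono ennreal_leI powr_mono2) auto
        finally show ?thesis unfolding 2 .
      qed
    qed
  qed
  show ?thesis
  proof
    show "K powr p > 0" using K by simp
    fix \<mu> :: "lamplighter pmf" and t :: nat
    assume sym: "map_pmf winv \<mu> = \<mu>" and t: "t \<ge> 1"
    have "b t powr p \<le> (K * real t powr (1 / p)) powr p"
      using b[OF t] L p by (intro powr_mono2) (auto simp: b_def)
    also have "\<dots> = K powr p * real t" using K p by (simp add: powr_mult powr_powr)
    finally have "ennreal (b t powr p) * (\<integral>\<^sup>+g. energy p g \<partial>\<mu>) \<le> ennreal (K powr p * real t) * (\<integral>\<^sup>+g. energy p g \<partial>\<mu>)"
      by (intro mult_right_mono ennreal_leI) auto
    with main[OF sym t] show "(\<integral>\<^sup>+w. energy p w \<partial>walk \<mu> t) \<le> ennreal (K powr p * real t) * (\<integral>\<^sup>+g. energy p g \<partial>\<mu>)"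
      by (rule order.trans)
  qed
qed

section \<open>The territory reached by the walk\<close>

text \<open>The running maximum of the position in the direction \<open>\<sigma>\<close>, in the form which splits off the first
  step.\<close>
primrec peak :: "int \<Rightarrow> lamplighter list \<Rightarrow> int" where
  "peak \<sigma> [] = 0"
| "peak \<sigma> (g # gs) = max 0 (\<sigma> * snd g + peak \<sigma> gs)"

lemma peak_nonneg: "0 \<le> peak \<sigma> gs"
  by (cases gs) auto

text \<open>For symmetric \<open>Y\<close> and \<open>c \<ge> 0\<close>: \<open>c + 2 E Y\<^sup>+ = c + E\<bar>Y\<bar>\<close>, while
  \<open>2 E (c + Y)\<^sup>+ = E ((c + Y)\<^sup>+ + (c - Y)\<^sup>+)\<close>, and the integrands compare pointwise. Values of
  \<^const>\<open>ennreal\<close> at negative reals are \<open>0\<close>, so the positive part is implicit.\<close>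
lemma positive_part_symmetric:
  assumes sym: "map_pmf winv \<mu> = \<mu>" and c: "c \<ge> 0"
  shows "ennreal (real_of_int c) + 2 * (\<integral>\<^sup>+w. ennreal (real_of_int (\<sigma> * snd w)) \<partial>walk \<mu> t)
    \<le> 2 * (\<integral>\<^sup>+w. ennreal (real_of_int (c + \<sigma> * snd w)) \<partial>walk \<mu> t)"
proof -
  have two: "2 * (\<integral>\<^sup>+w. ennreal (real_of_int (d + \<sigma> * snd w)) \<partial>walk \<mu> t) =
     (\<integral>\<^sup>+w. ennreal (real_of_int (d + \<sigma> * snd w)) + ennreal (real_of_int (d - \<sigma> * snd w)) \<partial>walk \<mu> t)" for d
    using nn_integral_walk_winv[OF sym, where f = "\<lambda>w. ennreal (real_of_int (d + \<sigma> * snd w))" and t = t]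
    by (simp add: nn_integral_add mult_2 winv_def)
  have pw: "ennreal (real_of_int c) + (ennreal (real_of_int y) + ennreal (real_of_int (- y)))
    \<le> ennreal (real_of_int (c + y)) + ennreal (real_of_int (c - y))" for y
  proof -
    have e: "ennreal (real_of_int z) = ennreal (real_of_int (max 0 z))" for z
      by (auto simp: max_def ennreal_neg)
    have "c + (max 0 y + max 0 (- y)) \<le> max 0 (c + y) + max 0 (c - y)" using c by linarith
    then have "real_of_int c + (real_of_int (max 0 y) + real_of_int (max 0 (- y)))
       \<le> real_of_int (max 0 (c + y)) + real_of_int (max 0 (c - y))"
      unfolding of_int_add[symmetric] of_int_le_iff .
    from ennreal_leI[OF this] show ?thesis
      unfolding e[of y] e[of "- y"] e[of "c + y"] e[of "c - y"] using c
      by (simp add: ennreal_plus[symmetric] del: ennreal_plus of_int_max)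
  qed
  have "ennreal (real_of_int c) + 2 * (\<integral>\<^sup>+w. ennreal (real_of_int (\<sigma> * snd w)) \<partial>walk \<mu> t)
    = (\<integral>\<^sup>+w. ennreal (real_of_int c) + (ennreal (real_of_int (\<sigma> * snd w)) + ennreal (real_of_int (- (\<sigma> * snd w)))) \<partial>walk \<mu> t)"
    using two[of 0] by (simp add: nn_integral_add)
  also have "\<dots> \<le> 2 * (\<integral>\<^sup>+w. ennreal (real_of_int (c + \<sigma> * snd w)) \<partial>walk \<mu> t)"
    unfolding two by (intro nn_integral_mono pw)
  finally show ?thesis .
qed

text \<open>Levy's maximal inequality in integrated form. The shift \<open>c\<close> measures how far the walk still is
  below the level to be exceeded. Conditioning on the first step, either the walk is still below the
  level and induction applies, or it has just exceeded it by \<open>c' > 0\<close> and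
  \<open>positive_part_symmetric\<close> compensates for the overshoot.\<close>
lemma levy_maximal:
  assumes sym: "map_pmf winv \<mu> = \<mu>" and "c \<le> 0"
  shows "(\<integral>\<^sup>+gs. ennreal (real_of_int (c + peak \<sigma> gs)) \<partial>replicate_pmf t \<mu>)
    \<le> 2 * (\<integral>\<^sup>+w. ennreal (real_of_int (c + \<sigma> * snd w)) \<partial>walk \<mu> t)"
  using assms(2)
proof (induction t arbitrary: c)
  case 0
  then show ?case by (simp add: ennreal_neg)
next
  case (Suc t)
  have step: "(\<integral>\<^sup>+gs. ennreal (real_of_int (c + peak \<sigma> (g # gs))) \<partial>replicate_pmf t \<mu>)
      \<le> 2 * (\<integral>\<^sup>+w. ennreal (real_of_int (c + \<sigma> * snd g + \<sigma> * snd w)) \<partial>walk \<mu> t)" for g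
  proof -
    define c' where "c' = c + \<sigma> * snd g"
    have "(\<integral>\<^sup>+gs. ennreal (real_of_int (c + peak \<sigma> (g # gs))) \<partial>replicate_pmf t \<mu>)
      = (\<integral>\<^sup>+gs. ennreal (real_of_int (c' + peak \<sigma> gs)) \<partial>replicate_pmf t \<mu>)"
    proof (rule nn_integral_cong)
      fix gs
      show "ennreal (real_of_int (c + peak \<sigma> (g # gs))) = ennreal (real_of_int (c' + peak \<sigma> gs))"
      proof (cases "\<sigma> * snd g + peak \<sigma> gs \<ge> 0")
        case False
        then have "c + peak \<sigma> (g # gs) \<le> 0" "c' + peak \<sigma> gs \<le> 0"
          using Suc.prems by (auto simp: c'_def)
        then show ?thesis by (simp only: ennreal_neg of_int_le_0_iff)
      qed (simp add: c'_def add.assoc)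
    qed
    also have "\<dots> \<le> 2 * (\<integral>\<^sup>+w. ennreal (real_of_int (c' + \<sigma> * snd w)) \<partial>walk \<mu> t)"
    proof (cases "c' \<le> 0")
      case True
      then show ?thesis by (rule Suc.IH)
    next
      case False
      have "(\<integral>\<^sup>+gs. ennreal (real_of_int (c' + peak \<sigma> gs)) \<partial>replicate_pmf t \<mu>)
         = ennreal (real_of_int c') + (\<integral>\<^sup>+gs. ennreal (real_of_int (0 + peak \<sigma> gs)) \<partial>replicate_pmf t \<mu>)"
        using False peak_nonneg[of \<sigma>] by (simp add: ennreal_plus nn_integral_add)
      also have "\<dots> \<le> ennreal (real_of_int c') + 2 * (\<integral>\<^sup>+w. ennreal (real_of_int (0 + \<sigma> * snd w)) \<partial>walk \<mu> t)"
        by (intro add_left_mono Suc.IH) simp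
      also have "\<dots> \<le> 2 * (\<integral>\<^sup>+w. ennreal (real_of_int (c' + \<sigma> * snd w)) \<partial>walk \<mu> t)"
        using positive_part_symmetric[OF sym, where c = c' and \<sigma> = \<sigma> and t = t] False by simp
      finally show ?thesis .
    qed
    finally show ?thesis by (simp add: c'_def)
  qed
  have "(\<integral>\<^sup>+gs. ennreal (real_of_int (c + peak \<sigma> gs)) \<partial>replicate_pmf (Suc t) \<mu>)
     = (\<integral>\<^sup>+g. \<integral>\<^sup>+gs. ennreal (real_of_int (c + peak \<sigma> (g # gs))) \<partial>replicate_pmf t \<mu> \<partial>\<mu>)"
    by (simp add: nn_integral_return_pmf del: peak.simps)
  also have "\<dots> \<le> (\<integral>\<^sup>+g. 2 * (\<integral>\<^sup>+w. ennreal (real_of_int (c + \<sigma> * snd g + \<sigma> * snd w)) \<partial>walk \<mu> t) \<partial>\<mu>)"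
    by (intro nn_integral_mono step)
  also have "\<dots> = 2 * (\<integral>\<^sup>+w. ennreal (real_of_int (c + \<sigma> * snd w)) \<partial>walk \<mu> (Suc t))"
    by (simp add: walk_Suc nn_integral_cmult mult_wreath_eq distrib_left add.assoc)
  finally show ?case .
qed

text \<open>A substitute for Hoelder's inequality, in linear form: optimising the threshold \<open>L\<close> after taking
  expectations gives the usual bounds up to a constant.\<close>
lemma le_threshold_powr:
  fixes a L p :: real
  assumes "a \<ge> 0" "L > 0" "p \<ge> 1"
  shows "a \<le> L + L powr (1 - p) * a powr p"
proof (cases "a \<le> L")
  case True
  then show ?thesis by (simp add: add_increasing2)
next
  case False
  have "a = L powr (1 - p) * (L powr (p - 1) * a)" using assms by (simp flip: powr_add mult.assoc)
  also have "\<dots> \<le> L powr (1 - p) * (a powr (p - 1) * a)"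
    using assms False by (intro mult_left_mono mult_right_mono powr_mono2) auto
  also have "a powr (p - 1) * a = a powr p" using assms False powr_add[of a "p - 1" 1] by simp
  finally show ?thesis using assms by linarith
qed

text \<open>The walk reaches at most as far as its positions, plus the largest single step; the latter is
  bounded through its \<open>p\<close>-th power, hence by a sum over all steps.\<close>
lemma reach_list_mult:
  assumes "set gs \<subseteq> carrier wreath_ZZ" "\<sigma> \<in> {1, -1}" "L > 0" "p \<ge> 1"
  shows "real_of_int (reach \<sigma> (list_mult wreath_ZZ gs)) \<le> 
     real_of_int (peak \<sigma> gs) + L + (\<Sum>g\<leftarrow>gs. L powr (1 - p) * real_of_int (size_ZZ g) powr p)"
  using assms(1)
proof (induction gs)
  case Nil
  then show ?case using assms by (simp add: reach_def one_wreath)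
next
  case (Cons g gs)
  define w where "w = list_mult wreath_ZZ gs"
  define S where "S gs = (\<Sum>g\<leftarrow>gs. L powr (1 - p) * real_of_int (size_ZZ g) powr p)" for gs
  have g: "g \<in> carrier wreath_ZZ" and w: "w \<in> carrier wreath_ZZ"
    using Cons.prems unfolding w_def by (auto intro: group.list_mult_closed[OF group_wreath_ZZ])
  have S: "S gs \<ge> 0" unfolding S_def by (induction gs) auto
  have "reach \<sigma> g \<le> size_ZZ g"
    using assms(2) reach_ge(1)[OF g] lamps_nonneg[of g] by (auto simp: size_ZZ_def)
  then have 1: "real_of_int (reach \<sigma> g) \<le> L + L powr (1 - p) * real_of_int (size_ZZ g) powr p"
    using le_threshold_powr[of "real_of_int (size_ZZ g)" L p] size_nonneg[OF g] assms by linarith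
  have 2: "real_of_int (reach \<sigma> w) \<le> real_of_int (peak \<sigma> gs) + L + S gs"
    using Cons unfolding w_def S_def by simp
  have "real_of_int (reach \<sigma> (g \<otimes>\<^bsub>wreath_ZZ\<^esub> w)) \<le> 
     max (real_of_int (reach \<sigma> g)) (real_of_int (\<sigma> * snd g) + real_of_int (reach \<sigma> w))"
    using reach_mult[OF g w, of \<sigma>] by linarith
  also have "\<dots> \<le> real_of_int (peak \<sigma> (g # gs)) + L + S (g # gs)"
  proof -
    have "real_of_int (\<sigma> * snd g) + real_of_int (peak \<sigma> gs) \<le> real_of_int (peak \<sigma> (g # gs))"
      by (simp only: of_int_add[symmetric] of_int_le_iff) simp
    moreover have "S (g # gs) = L powr (1 - p) * real_of_int (size_ZZ g) powr p + S gs"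
      "0 \<le> real_of_int (peak \<sigma> (g # gs))" "0 \<le> L powr (1 - p) * real_of_int (size_ZZ g) powr p"
      using peak_nonneg[of \<sigma> "g # gs"] by (simp_all add: S_def)
    ultimately show ?thesis using 1 2 S by linarith
  qed
  finally show ?case by (simp add: w_def S_def)
qed

lemma nn_integral_replicate_sum:
  "(\<integral>\<^sup>+gs. (\<Sum>g\<leftarrow>gs. f g) \<partial>replicate_pmf t \<mu>) = of_nat t * (\<integral>\<^sup>+g. f g \<partial>\<mu>)"
  by (induction t) (simp_all add: nn_integral_add nn_integral_return_pmf distrib_right)

section \<open>Size of the walk\<close>

lemma energy_ge_coord: "ennreal (\<bar>real_of_int (coord g c)\<bar> powr p) \<le> energy p g"
proof -
  have "ennreal (\<bar>real_of_int (coord g c)\<bar> powr p) =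
    (\<integral>\<^sup>+c'. ennreal (\<bar>real_of_int (coord g c')\<bar> powr p) * indicator {c} c' \<partial>count_space UNIV)"
    by (subst nn_integral_count_space'[of "{c}"]) (auto simp: indicator_def)
  also have "\<dots> \<le> energy p g"
    unfolding energy_def by (intro nn_integral_mono) (auto simp: indicator_def)
  finally show ?thesis .
qed

text \<open>Only lamps in the interval swept are on, and each of them is estimated with the threshold \<open>L\<close>.\<close>
lemma lamps_powr_le_energy:
  assumes g: "g \<in> carrier wreath_ZZ" and L: "L > 0" "p \<ge> 1"
  shows "ennreal (real_of_int (lamps g)) \<le> ennreal (L powr (1 - p)) * energy p g 
      + ennreal (L * real_of_int (reach 1 g + reach (-1) g + 1))"
proof -
  define A where "A = {- reach (-1) g .. reach 1 g}"
  have A: "{z. fst g z \<noteq> 0} \<subseteq> A"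
    using reach_ge(3)[OF g, where \<sigma> = 1] reach_ge(3)[OF g, where \<sigma> = "-1"] by (fastforce simp: A_def)
  have "real_of_int (lamps g) = (\<Sum>z\<in>A. \<bar>real_of_int (fst g z)\<bar>)"
    using A by (subst lamps_eq_sum[of A]) (auto simp: A_def)
  also have "\<dots> \<le> (\<Sum>z\<in>A. L + L powr (1 - p) * \<bar>real_of_int (fst g z)\<bar> powr p)"
    using L by (intro sum_mono le_threshold_powr) auto
  also have "\<dots> = L powr (1 - p) * (\<Sum>z\<in>A. \<bar>real_of_int (fst g z)\<bar> powr p) + L * real (card A)"
    by (simp add: sum.distrib sum_distrib_left)
  also have "real (card A) = real_of_int (reach 1 g + reach (-1) g + 1)"
    using reach_ge(1)[OF g, of 1] reach_ge(1)[OF g, of "-1"] by (simp add: A_def)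
  finally have "ennreal (real_of_int (lamps g)) \<le> ennreal (L powr (1 - p) * (\<Sum>z\<in>A. \<bar>real_of_int (fst g z)\<bar> powr p) 
      + L * real_of_int (reach 1 g + reach (-1) g + 1))" by (rule ennreal_leI)
  also have "\<dots> = ennreal (L powr (1 - p)) * (\<Sum>z\<in>A. ennreal (\<bar>real_of_int (fst g z)\<bar> powr p))
      + ennreal (L * real_of_int (reach 1 g + reach (-1) g + 1))"
    using L reach_ge(1)[OF g, of 1] reach_ge(1)[OF g, of "-1"]
    by (subst ennreal_plus) (auto simp: ennreal_mult sum_nonneg)
  also have "(\<Sum>z\<in>A. ennreal (\<bar>real_of_int (fst g z)\<bar> powr p)) = 
     (\<Sum>c\<in>Some ` A. ennreal (\<bar>real_of_int (coord g c)\<bar> powr p))"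
    by (subst sum.reindex) (auto simp: coord_def)
  also have "\<dots> = (\<integral>\<^sup>+c. ennreal (\<bar>real_of_int (coord g c)\<bar> powr p) * indicator (Some ` A) c \<partial>count_space UNIV)"
    by (subst nn_integral_count_space'[of "Some ` A"]) (auto simp: A_def indicator_def intro!: sum.cong)
  also have "\<dots> \<le> energy p g"
    unfolding energy_def by (intro nn_integral_mono) (auto simp: indicator_def)
  finally show ?thesis by (simp add: mult_left_mono add_right_mono)
qed

lemma energy_le_size:
  assumes g: "g \<in> carrier wreath_ZZ" and p: "p > 1"
  shows "energy p g \<le> ennreal (2 * real_of_int (size_ZZ g) powr p)"
proof -
  define A where "A = {z. fst g z \<noteq> 0}"
  define s where "s = real_of_int (size_ZZ g)"
  have fin: "finite A" using g by (simp add: A_def carrier_wreath)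
  note r = reach_ge[OF g, where \<sigma> = 1] reach_ge[OF g, where \<sigma> = "-1"]
  have ls: "real_of_int (lamps g) \<le> s" "\<bar>real_of_int (snd g)\<bar> \<le> s" "0 \<le> s"
    using r lamps_nonneg[of g] by (auto simp: s_def size_ZZ_def)
  have fz: "\<bar>real_of_int (fst g z)\<bar> \<le> s" for z
  proof (cases "z \<in> A")
    case True
    have "\<bar>fst g z\<bar> \<le> lamps g" unfolding lamps_def A_def[symmetric]
      using True fin by (intro member_le_sum) auto
    then show ?thesis using ls by linarith
  qed (use ls in \<open>simp add: A_def\<close>)
  have pw: "x powr p \<le> x * s powr (p - 1)" if "0 \<le> x" "x \<le> s" for x
  proof (cases "x = 0")
    case False
    then have "x powr p = x * x powr (p - 1)" using that powr_add[of x 1 "p - 1"] by simp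
    also have "\<dots> \<le> x * s powr (p - 1)" using that p by (intro mult_left_mono powr_mono2) auto
    finally show ?thesis .
  qed simp
  have "energy p g = (\<Sum>c\<in>insert None (Some ` A). ennreal (\<bar>real_of_int (coord g c)\<bar> powr p))"
    unfolding energy_def
  proof (rule nn_integral_count_space')
    fix c assume "c \<notin> insert None (Some ` A)"
    then show "ennreal (\<bar>real_of_int (coord g c)\<bar> powr p) = 0"
      by (cases c) (auto simp: coord_def A_def)
  qed (use fin in auto)
  also have "\<dots> = ennreal (\<bar>real_of_int (snd g)\<bar> powr p + (\<Sum>z\<in>A. \<bar>real_of_int (fst g z)\<bar> powr p))"
    using fin by (subst sum.insert) (auto simp: sum.reindex coord_def ennreal_plus sum_nonneg)
  also have "\<dots> \<le> ennreal (2 * s powr p)"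
  proof (rule ennreal_leI)
    have "(\<Sum>z\<in>A. \<bar>real_of_int (fst g z)\<bar> powr p) \<le> (\<Sum>z\<in>A. \<bar>real_of_int (fst g z)\<bar> * s powr (p - 1))"
      using fz by (intro sum_mono pw) auto
    also have "\<dots> = real_of_int (lamps g) * s powr (p - 1)"
      by (simp add: lamps_def A_def sum_distrib_right)
    also have "\<dots> \<le> s * s powr (p - 1)" using ls by (intro mult_right_mono) auto
    also have "\<dots> = s powr p" using ls powr_add[of s 1 "p - 1"] by (cases "s = 0") auto
    finally show "\<bar>real_of_int (snd g)\<bar> powr p + (\<Sum>z\<in>A. \<bar>real_of_int (fst g z)\<bar> powr p) \<le> 2 * s powr p"
      using powr_mono2[of p "\<bar>real_of_int (snd g)\<bar>" s] ls p by auto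
  qed
  finally show ?thesis by (simp add: s_def)
qed

lemma walk_energy_upper:
  assumes p: "1 < p" "p < 2"
  obtains C :: real where "C > 0"
    "\<And>\<mu> t M. map_pmf winv \<mu> = \<mu> \<Longrightarrow> set_pmf \<mu> \<subseteq> carrier wreath_ZZ \<Longrightarrow> t \<ge> 1 \<Longrightarrow> M \<ge> 0 \<Longrightarrow>
       of_nat t * (\<integral>\<^sup>+g. ennreal (real_of_int (size_ZZ g) powr p) \<partial>\<mu>) \<le> ennreal M \<Longrightarrow>
       (\<integral>\<^sup>+w. energy p w \<partial>walk \<mu> t) \<le> ennreal (C * M)"
proof -
  obtain C :: real where C: "C > 0" and growth: "\<And>\<mu> t. map_pmf winv \<mu> = \<mu> \<Longrightarrow> t \<ge> 1 \<Longrightarrow>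
       (\<integral>\<^sup>+w. energy p w \<partial>walk \<mu> t) \<le> ennreal (C * real t) * (\<integral>\<^sup>+g. energy p g \<partial>\<mu>)"
    using energy_growth[OF p] by blast
  have "(\<integral>\<^sup>+w. energy p w \<partial>walk \<mu> t) \<le> ennreal (2 * C * M)"
    if sym: "map_pmf winv \<mu> = \<mu>" and car: "set_pmf \<mu> \<subseteq> carrier wreath_ZZ" and t: "t \<ge> 1" and M: "M \<ge> 0"
     and m: "of_nat t * (\<integral>\<^sup>+g. ennreal (real_of_int (size_ZZ g) powr p) \<partial>\<mu>) \<le> ennreal M" for \<mu> t M
  proof -
    have "(\<integral>\<^sup>+g. energy p g \<partial>\<mu>) \<le> (\<integral>\<^sup>+g. ennreal (2 * real_of_int (size_ZZ g) powr p) \<partial>\<mu>)"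
      using car p by (intro nn_integral_mono_AE) (auto simp: AE_measure_pmf_iff intro!: energy_le_size)
    also have "\<dots> = 2 * (\<integral>\<^sup>+g. ennreal (real_of_int (size_ZZ g) powr p) \<partial>\<mu>)"
      by (simp add: ennreal_mult nn_integral_cmult)
    finally have "(\<integral>\<^sup>+w. energy p w \<partial>walk \<mu> t) \<le> ennreal (C * real t) * (2 * (\<integral>\<^sup>+g. ennreal (real_of_int (size_ZZ g) powr p) \<partial>\<mu>))"
      using growth[OF sym t] by (meson mult_left_mono order.trans zero_le)
    also have "\<dots> = ennreal (2 * C) * (of_nat t * (\<integral>\<^sup>+g. ennreal (real_of_int (size_ZZ g) powr p) \<partial>\<mu>))"
      using C by (simp add: ennreal_mult ennreal_of_nat_eq_real_of_nat mult_ac)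
    also have "\<dots> \<le> ennreal (2 * C) * ennreal M" by (intro mult_left_mono m) auto
    also have "\<dots> = ennreal (2 * C * M)" using C M by (simp add: ennreal_mult)
    finally show ?thesis .
  qed
  then show ?thesis using C by (intro that[of "2 * C"]) auto
qed

text \<open>The threshold \<open>L = M\<^bsup>1/p\<^esup>\<close> is the expected scale both of the final position and of the largest
  step; it satisfies \<open>L\<^bsup>1-p\<^esup> M = L\<close>.\<close>
lemma walk_reach_upper:
  assumes p: "1 < p" and C: "C \<ge> 0"
    and sym: "map_pmf winv \<mu> = \<mu>" and car: "set_pmf \<mu> \<subseteq> carrier wreath_ZZ" and M: "M > 0"
    and m: "of_nat t * (\<integral>\<^sup>+g. ennreal (real_of_int (size_ZZ g) powr p) \<partial>\<mu>) \<le> ennreal M"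
    and en: "(\<integral>\<^sup>+w. energy p w \<partial>walk \<mu> t) \<le> ennreal (C * M)" and \<sigma>: "\<sigma> \<in> {1, -1}"
  shows "(\<integral>\<^sup>+w. ennreal (real_of_int (reach \<sigma> w)) \<partial>walk \<mu> t) \<le> ennreal ((4 + 2 * C) * M powr (1 / p))"
proof -
  define L where "L = M powr (1 / p)"
  have L: "L > 0" using M by (simp add: L_def)
  have LM: "L powr (1 - p) * M = L"
  proof -
    have "L powr (1 - p) * M = M powr ((1 - p) / p) * M powr 1" using M by (simp add: L_def powr_powr)
    also have "\<dots> = L" unfolding L_def powr_add[symmetric] using p by (simp add: field_simps)
    finally show ?thesis .
  qed
  have "(\<integral>\<^sup>+w. ennreal (real_of_int (\<sigma> * snd w)) \<partial>walk \<mu> t)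
     \<le> (\<integral>\<^sup>+w. ennreal L + ennreal (L powr (1 - p)) * energy p w \<partial>walk \<mu> t)"
  proof (rule nn_integral_mono)
    fix w
    define c where "c = \<bar>real_of_int (coord w None)\<bar>"
    have "real_of_int (\<sigma> * snd w) \<le> c" using \<sigma> by (auto simp: c_def coord_def)
    also have "c \<le> L + L powr (1 - p) * c powr p"
      using L p by (intro le_threshold_powr) (auto simp: c_def)
    finally have "ennreal (real_of_int (\<sigma> * snd w)) \<le> ennreal (L + L powr (1 - p) * c powr p)" by (rule ennreal_leI)
    also have "\<dots> = ennreal L + ennreal (L powr (1 - p)) * ennreal (c powr p)"
      using L by (simp add: ennreal_plus ennreal_mult)
    also have "\<dots> \<le> ennreal L + ennreal (L powr (1 - p)) * energy p w"
      unfolding c_def by (intro add_left_mono mult_left_mono energy_ge_coord) auto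
    finally show "ennreal (real_of_int (\<sigma> * snd w)) \<le> ennreal L + ennreal (L powr (1 - p)) * energy p w" .
  qed
  also have "\<dots> = ennreal L + ennreal (L powr (1 - p)) * (\<integral>\<^sup>+w. energy p w \<partial>walk \<mu> t)"
    by (simp add: nn_integral_add nn_integral_cmult)
  also have "\<dots> \<le> ennreal L + ennreal (L powr (1 - p)) * ennreal (C * M)"
    by (intro add_left_mono mult_left_mono en) auto
  also have "\<dots> = ennreal (L + C * (L powr (1 - p) * M))"
    using L C M by (simp add: ennreal_mult[symmetric] ennreal_plus[symmetric] mult_ac del: ennreal_plus)
  also have "L + C * (L powr (1 - p) * M) = (1 + C) * L" unfolding LM by (simp add: algebra_simps)
  finally have end_pos: "(\<integral>\<^sup>+w. ennreal (real_of_int (0 + \<sigma> * snd w)) \<partial>walk \<mu> t) \<le> ennreal ((1 + C) * L)" by simp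
  define b where "b g = L powr (1 - p) * real_of_int (size_ZZ g) powr p" for g
  have b: "b g \<ge> 0" for g by (simp add: b_def)
  have "(\<integral>\<^sup>+w. ennreal (real_of_int (reach \<sigma> w)) \<partial>walk \<mu> t) =
     (\<integral>\<^sup>+gs. ennreal (real_of_int (reach \<sigma> (list_mult wreath_ZZ gs))) \<partial>replicate_pmf t \<mu>)"
    by (simp add: walk_pmf_def)
  also have "\<dots> \<le> (\<integral>\<^sup>+gs. ennreal (real_of_int (0 + peak \<sigma> gs)) + ennreal L + (\<Sum>g\<leftarrow>gs. ennreal (b g)) \<partial>replicate_pmf t \<mu>)"
  proof (rule nn_integral_mono_AE, unfold AE_measure_pmf_iff, rule ballI)
    fix gs assume "gs \<in> set_pmf (replicate_pmf t \<mu>)"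
    then have "set gs \<subseteq> carrier wreath_ZZ" using car by (auto simp: set_replicate_pmf in_lists_conv_set)
    from reach_list_mult[OF this \<sigma> L, of p] p
    have "ennreal (real_of_int (reach \<sigma> (list_mult wreath_ZZ gs))) \<le> ennreal (real_of_int (peak \<sigma> gs) + L + (\<Sum>g\<leftarrow>gs. b g))"
      by (intro ennreal_leI) (simp add: b_def)
    also have bs: "(\<Sum>g\<leftarrow>gs. b g) \<ge> 0" for gs by (induction gs) (simp_all add: b)
    then have "ennreal (real_of_int (peak \<sigma> gs) + L + (\<Sum>g\<leftarrow>gs. b g)) = ennreal (real_of_int (peak \<sigma> gs)) + ennreal L + ennreal (\<Sum>g\<leftarrow>gs. b g)"
      using L peak_nonneg[of \<sigma> gs] bs[of gs] by (simp add: ennreal_plus)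
    also have "ennreal (\<Sum>g\<leftarrow>gs. b g) = (\<Sum>g\<leftarrow>gs. ennreal (b g))"
      by (induction gs) (simp_all add: b bs ennreal_plus)
    finally show "ennreal (real_of_int (reach \<sigma> (list_mult wreath_ZZ gs))) \<le> ennreal (real_of_int (0 + peak \<sigma> gs)) + ennreal L + (\<Sum>g\<leftarrow>gs. ennreal (b g))" by simp
  qed
  also have "\<dots> = (\<integral>\<^sup>+gs. ennreal (real_of_int (0 + peak \<sigma> gs)) \<partial>replicate_pmf t \<mu>) + ennreal L + of_nat t * (\<integral>\<^sup>+g. ennreal (b g) \<partial>\<mu>)"
    by (simp add: nn_integral_add nn_integral_replicate_sum)
  also have "\<dots> \<le> 2 * ennreal ((1 + C) * L) + ennreal L + ennreal L"
  proof (intro add_mono order.refl)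
    show "(\<integral>\<^sup>+gs. ennreal (real_of_int (0 + peak \<sigma> gs)) \<partial>replicate_pmf t \<mu>) \<le> 2 * ennreal ((1 + C) * L)"
      using levy_maximal[OF sym order.refl, where \<sigma> = \<sigma> and t = t] end_pos by (meson mult_left_mono order.trans zero_le)
    have "of_nat t * (\<integral>\<^sup>+g. ennreal (b g) \<partial>\<mu>) = ennreal (L powr (1 - p)) * (of_nat t * (\<integral>\<^sup>+g. ennreal (real_of_int (size_ZZ g) powr p) \<partial>\<mu>))"
      unfolding b_def by (simp add: ennreal_mult nn_integral_cmult mult_ac)
    also have "\<dots> \<le> ennreal (L powr (1 - p)) * ennreal M" by (intro mult_left_mono m) auto
    also have "\<dots> = ennreal L" using M LM by (simp flip: ennreal_mult)
    finally show "of_nat t * (\<integral>\<^sup>+g. ennreal (b g) \<partial>\<mu>) \<le> ennreal L" .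
  qed
  also have "\<dots> = ennreal (2 * ((1 + C) * L) + L + L)"
  proof -
    have "2 * ennreal ((1 + C) * L) = ennreal (2 * ((1 + C) * L))"
      using L C ennreal_mult[of 2 "(1 + C) * L"] by simp
    then show ?thesis using L C by (simp add: ennreal_plus[symmetric] del: ennreal_plus)
  qed
  also have "2 * ((1 + C) * L) + L + L = (4 + 2 * C) * L" by (simp add: algebra_simps)
  finally show ?thesis by (simp add: L_def)
qed

text \<open>Here the threshold for a single lamp is \<open>L = M\<^bsup>(p-1)/p\<^sup>2\<^esup>\<close>, the average lamp when an energy \<open>M\<close> is
  spread evenly over \<open>R = M\<^bsup>1/p\<^esup>\<close> sites; then \<open>L\<^bsup>1-p\<^esup> M = L R = M\<^bsup>\<theta>\<^esup>\<close>.\<close>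
lemma walk_size_upper:
  assumes p: "1 < p" "p < 2"
  obtains C :: real where "C > 0"
    "\<And>\<mu> t M. map_pmf winv \<mu> = \<mu> \<Longrightarrow> set_pmf \<mu> \<subseteq> carrier wreath_ZZ \<Longrightarrow> t \<ge> 1 \<Longrightarrow> M \<ge> 1 \<Longrightarrow>
       of_nat t * (\<integral>\<^sup>+g. ennreal (real_of_int (size_ZZ g) powr p) \<partial>\<mu>) \<le> ennreal M \<Longrightarrow>
       (\<integral>\<^sup>+w. ennreal (real_of_int (size_ZZ w)) \<partial>walk \<mu> t) \<le> ennreal (C * M powr ((2 * p - 1) / p\<^sup>2))"
proof -
  obtain C :: real where C: "C > 0" and energy: "\<And>\<mu> t M. map_pmf winv \<mu> = \<mu> \<Longrightarrow> set_pmf \<mu> \<subseteq> carrier wreath_ZZ \<Longrightarrow> t \<ge> 1 \<Longrightarrow> M \<ge> 0 \<Longrightarrow>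
       of_nat t * (\<integral>\<^sup>+g. ennreal (real_of_int (size_ZZ g) powr p) \<partial>\<mu>) \<le> ennreal M \<Longrightarrow>
       (\<integral>\<^sup>+w. energy p w \<partial>walk \<mu> t) \<le> ennreal (C * M)"
    using walk_energy_upper[OF p] by blast
  define B where "B = 4 + 2 * C"
  have B: "B > 0" using C by (simp add: B_def)
  show ?thesis
  proof (rule that[of "C + 2 * B + 1 + 2 * B"])
    show "C + 2 * B + 1 + 2 * B > 0" using B C by simp
    fix \<mu> :: "lamplighter pmf" and t :: nat and M :: real
    assume sym: "map_pmf winv \<mu> = \<mu>" and car: "set_pmf \<mu> \<subseteq> carrier wreath_ZZ" and t: "t \<ge> 1" and M: "M \<ge> 1"
     and m: "of_nat t * (\<integral>\<^sup>+g. ennreal (real_of_int (size_ZZ g) powr p) \<partial>\<mu>) \<le> ennreal M"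
    define \<theta> where "\<theta> = (2 * p - 1) / p\<^sup>2"
    define R where "R = M powr (1 / p)"
    define L where "L = M powr ((p - 1) / p\<^sup>2)"
    have L: "L > 0" and R: "R > 0" using M by (auto simp: L_def R_def)
    have en: "(\<integral>\<^sup>+w. energy p w \<partial>walk \<mu> t) \<le> ennreal (C * M)"
      using energy[OF sym car t _ m] M by simp
    have re: "(\<integral>\<^sup>+w. ennreal (real_of_int (reach \<sigma> w)) \<partial>walk \<mu> t) \<le> ennreal (B * R)" if "\<sigma> \<in> {1, -1}" for \<sigma>
      unfolding B_def R_def using p C M that by (intro walk_reach_upper[OF _ _ sym car _ m en]) auto
    \<comment> \<open>\<open>L\<close> balances the two terms of the estimate for the lamps.\<close>
    have 1: "L powr (1 - p) * M = M powr \<theta>"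
    proof -
      have "L powr (1 - p) * M = M powr ((p - 1) / p\<^sup>2 * (1 - p)) * M powr 1" using M by (simp add: L_def powr_powr)
      also have "\<dots> = M powr ((p - 1) / p\<^sup>2 * (1 - p) + 1)" by (simp only: powr_add)
      also have "(p - 1) / p\<^sup>2 * (1 - p) + 1 = \<theta>" using p by (simp add: \<theta>_def field_simps power2_eq_square)
      finally show ?thesis .
    qed
    have 2: "L * R = M powr \<theta>"
    proof -
      have "(p - 1) / p\<^sup>2 + 1 / p = \<theta>" using p by (simp add: \<theta>_def field_simps power2_eq_square)
      then show ?thesis by (simp add: L_def R_def flip: powr_add)
    qed
    have "L \<ge> 1" "R \<ge> 1" using M p by (auto simp: L_def R_def intro!: ge_one_powr_ge_zero)
    then have 3: "L \<le> M powr \<theta>" "R \<le> M powr \<theta>"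
      unfolding 2[symmetric] by simp_all
    have pw: "ennreal (real_of_int (size_ZZ w)) \<le> ennreal (L powr (1 - p)) * energy p w 
         + ennreal L * (ennreal (real_of_int (reach 1 w)) + ennreal (real_of_int (reach (-1) w)) + 1)
         + ennreal (real_of_int (reach 1 w)) + ennreal (real_of_int (reach (-1) w))"
      if w: "w \<in> carrier wreath_ZZ" for w
    proof -
      note r = reach_ge(1)[OF w, of 1] reach_ge(1)[OF w, of "-1"]
      have "ennreal (real_of_int (size_ZZ w)) = ennreal (real_of_int (lamps w)) + ennreal (real_of_int (reach 1 w)) + ennreal (real_of_int (reach (-1) w))"
        using r lamps_nonneg[of w] by (simp add: size_ZZ_def ennreal_plus)
      also have "\<dots> \<le> (ennreal (L powr (1 - p)) * energy p w 
      + ennreal (L * real_of_int (reach 1 w + reach (-1) w + 1))) + ennreal (real_of_int (reach 1 w)) + ennreal (real_of_int (reach (-1) w))"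
        using L p w by (intro add_right_mono lamps_powr_le_energy) auto
      also have "ennreal (L * real_of_int (reach 1 w + reach (-1) w + 1)) = ennreal L * (ennreal (real_of_int (reach 1 w)) + ennreal (real_of_int (reach (-1) w)) + 1)"
        using L r by (simp add: ennreal_mult ennreal_plus)
      finally show ?thesis .
    qed
    have "(\<integral>\<^sup>+w. ennreal (real_of_int (size_ZZ w)) \<partial>walk \<mu> t) \<le> 
      (\<integral>\<^sup>+w. ennreal (L powr (1 - p)) * energy p w 
         + ennreal L * (ennreal (real_of_int (reach 1 w)) + ennreal (real_of_int (reach (-1) w)) + 1)
         + ennreal (real_of_int (reach 1 w)) + ennreal (real_of_int (reach (-1) w)) \<partial>walk \<mu> t)"
      using set_walk[OF car, of t] by (intro nn_integral_mono_AE) (auto simp: AE_measure_pmf_iff intro!: pw)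
    also have "\<dots> = ennreal (L powr (1 - p)) * (\<integral>\<^sup>+w. energy p w \<partial>walk \<mu> t)
         + ennreal L * ((\<integral>\<^sup>+w. ennreal (real_of_int (reach 1 w)) \<partial>walk \<mu> t) + (\<integral>\<^sup>+w. ennreal (real_of_int (reach (-1) w)) \<partial>walk \<mu> t) + 1)
         + (\<integral>\<^sup>+w. ennreal (real_of_int (reach 1 w)) \<partial>walk \<mu> t) + (\<integral>\<^sup>+w. ennreal (real_of_int (reach (-1) w)) \<partial>walk \<mu> t)"
      by (simp add: nn_integral_add nn_integral_cmult)
    also have "\<dots> \<le> ennreal (L powr (1 - p)) * ennreal (C * M) + ennreal L * (ennreal (B * R) + ennreal (B * R) + 1) + ennreal (B * R) + ennreal (B * R)"
      by (intro add_mono mult_left_mono en re order.refl) auto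
    also have "\<dots> = ennreal (L powr (1 - p) * (C * M) + L * (B * R + B * R + 1) + B * R + B * R)"
      using L B R C M
      by (simp add: ennreal_mult[symmetric] ennreal_plus[symmetric] ennreal_1[symmetric] del: ennreal_plus ennreal_1)
    also have "L powr (1 - p) * (C * M) + L * (B * R + B * R + 1) + B * R + B * R
       = C * (L powr (1 - p) * M) + 2 * B * (L * R) + L + 2 * B * R"
      by (simp add: algebra_simps)
    also have "ennreal (C * (L powr (1 - p) * M) + 2 * B * (L * R) + L + 2 * B * R) \<le> ennreal ((C + 2 * B + 1 + 2 * B) * M powr \<theta>)"
    proof (rule ennreal_leI)
      have "2 * B * R \<le> 2 * B * M powr \<theta>" using 3 B by (intro mult_left_mono) auto
      then show "C * (L powr (1 - p) * M) + 2 * B * (L * R) + L + 2 * B * R \<le> (C + 2 * B + 1 + 2 * B) * M powr \<theta>"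
        unfolding 1 2 using 3 by (simp add: algebra_simps)
    qed
    finally show "(\<integral>\<^sup>+w. ennreal (real_of_int (size_ZZ w)) \<partial>walk \<mu> t) \<le> ennreal ((C + 2 * B + 1 + 2 * B) * M powr ((2 * p - 1) / p\<^sup>2))"
      unfolding \<theta>_def .
  qed
qed

section \<open>The upper bound for the exponent\<close>

lemma word_metric_one:
  assumes "finite_symmetric_generating_set wreath_ZZ S" "g \<in> carrier wreath_ZZ"
  shows "word_metric wreath_ZZ S g \<one>\<^bsub>wreath_ZZ\<^esub> = real (wl S g)"
  using group.word_length_inv[OF group_wreath_ZZ assms] by (simp add: word_metric_def)

lemma walk_word_length_upper:
  assumes p: "1 < p" "p < 2" and S: "finite_symmetric_generating_set wreath_ZZ S"
  obtains C :: real where "C \<ge> 1"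
    "\<And>\<mu> t. symmetric_pmf_on wreath_ZZ \<mu> \<Longrightarrow> t \<ge> 1 \<Longrightarrow> integrable \<mu> (\<lambda>g. real (wl S g) powr p) \<Longrightarrow> 
       real t * measure_pmf.expectation \<mu> (\<lambda>g. real (wl S g) powr p) \<ge> 1 \<Longrightarrow>
       (\<integral>\<^sup>+w. ennreal (real (wl S w)) \<partial>walk \<mu> t) \<le>
         ennreal (C * (real t * measure_pmf.expectation \<mu> (\<lambda>g. real (wl S g) powr p)) powr ((2 * p - 1) / p\<^sup>2))"
proof -
  obtain C :: real where C: "C > 0" and up:
    "\<And>\<mu> t M. map_pmf winv \<mu> = \<mu> \<Longrightarrow> set_pmf \<mu> \<subseteq> carrier wreath_ZZ \<Longrightarrow> t \<ge> 1 \<Longrightarrow> M \<ge> 1 \<Longrightarrow>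
       of_nat t * (\<integral>\<^sup>+g. ennreal (real_of_int (size_ZZ g) powr p) \<partial>\<mu>) \<le> ennreal M \<Longrightarrow>
       (\<integral>\<^sup>+w. ennreal (real_of_int (size_ZZ w)) \<partial>walk \<mu> t) \<le> ennreal (C * M powr ((2 * p - 1) / p\<^sup>2))"
    using walk_size_upper[OF p] by blast
  obtain K where K: "K > 0" "\<And>g. g \<in> carrier wreath_ZZ \<Longrightarrow> size_ZZ g \<le> K * int (wl S g)"
    using size_le_word_length[OF S] by blast
  obtain K' where K': "K' > 0" "\<And>g. g \<in> carrier wreath_ZZ \<Longrightarrow> int (wl S g) \<le> K' * size_ZZ g"
    using word_length_le_size[OF S] by blast
  define \<theta> where "\<theta> = (2 * p - 1) / p\<^sup>2"
  define k where "k = real_of_int K powr p"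
  have k: "k \<ge> 1" unfolding k_def using K p by (intro ge_one_powr_ge_zero) auto
  define D where "D = real_of_int K' * C * k powr \<theta>"
  have D: "D > 0" using K' C k by (simp add: D_def)
  have "(\<integral>\<^sup>+w. ennreal (real (wl S w)) \<partial>walk \<mu> t) \<le> ennreal (max 1 D * (real t * A) powr \<theta>)"
    if sym: "symmetric_pmf_on wreath_ZZ \<mu>" and t: "t \<ge> 1" and int: "integrable \<mu> (\<lambda>g. real (wl S g) powr p)"
    and A: "A = measure_pmf.expectation \<mu> (\<lambda>g. real (wl S g) powr p)" and tA: "real t * A \<ge> 1" for \<mu> t A
  proof -
    have car: "set_pmf \<mu> \<subseteq> carrier wreath_ZZ" using sym by (simp add: symmetric_pmf_on_def)
    have "(\<integral>\<^sup>+g. ennreal (real_of_int (size_ZZ g) powr p) \<partial>\<mu>) \<le> (\<integral>\<^sup>+g. ennreal k * ennreal (real (wl S g) powr p) \<partial>\<mu>)"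
    proof (rule nn_integral_mono_AE, unfold AE_measure_pmf_iff, rule ballI)
      fix g assume "g \<in> set_pmf \<mu>"
      then have g: "g \<in> carrier wreath_ZZ" using car by auto
      have "real_of_int (size_ZZ g) \<le> real_of_int (K * int (wl S g))"
        using K(2)[OF g] by (simp only: of_int_le_iff)
      then have "real_of_int (size_ZZ g) powr p \<le> (real_of_int K * real (wl S g)) powr p"
        using size_nonneg[OF g] p by (intro powr_mono2) auto
      then show "ennreal (real_of_int (size_ZZ g) powr p) \<le> ennreal k * ennreal (real (wl S g) powr p)"
        using K by (auto simp: k_def powr_mult ennreal_mult[symmetric] intro!: ennreal_leI)
    qed
    also have "\<dots> = ennreal k * ennreal A"
      unfolding A using int by (simp add: nn_integral_cmult nn_integral_eq_integral)
    finally have "of_nat t * (\<integral>\<^sup>+g. ennreal (real_of_int (size_ZZ g) powr p) \<partial>\<mu>) \<le> of_nat t * (ennreal k * ennreal A)"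
      by (intro mult_left_mono) auto
    also have "\<dots> = ennreal (k * (real t * A))"
      using k A by (simp add: ennreal_of_nat_eq_real_of_nat ennreal_mult[symmetric] mult_ac)
    finally have m: "of_nat t * (\<integral>\<^sup>+g. ennreal (real_of_int (size_ZZ g) powr p) \<partial>\<mu>) \<le> ennreal (k * (real t * A))" .
    have M1: "k * (real t * A) \<ge> 1" using mult_mono[of 1 k 1 "real t * A"] k tA by simp
    have "(\<integral>\<^sup>+w. ennreal (real (wl S w)) \<partial>walk \<mu> t) \<le> (\<integral>\<^sup>+w. ennreal (real_of_int K') * ennreal (real_of_int (size_ZZ w)) \<partial>walk \<mu> t)"
    proof (rule nn_integral_mono_AE, unfold AE_measure_pmf_iff, rule ballI)
      fix g assume "g \<in> set_pmf (walk \<mu> t)"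
      then have g: "g \<in> carrier wreath_ZZ" using set_walk[OF car] by auto
      have "real_of_int (int (wl S g)) \<le> real_of_int (K' * size_ZZ g)"
        using K'(2)[OF g] by (simp only: of_int_le_iff)
      then show "ennreal (real (wl S g)) \<le> ennreal (real_of_int K') * ennreal (real_of_int (size_ZZ g))"
        using K' size_nonneg[OF g] by (auto simp: ennreal_mult[symmetric] intro!: ennreal_leI)
    qed
    also have "\<dots> = ennreal (real_of_int K') * (\<integral>\<^sup>+w. ennreal (real_of_int (size_ZZ w)) \<partial>walk \<mu> t)"
      by (simp add: nn_integral_cmult)
    also have "\<dots> \<le> ennreal (real_of_int K') * ennreal (C * (k * (real t * A)) powr \<theta>)"
      unfolding \<theta>_def by (intro mult_left_mono up[OF symmetric_winv[OF sym] car t M1 m]) auto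
    also have "\<dots> = ennreal (D * (real t * A) powr \<theta>)"
      using K' C k tA by (simp add: D_def ennreal_mult[symmetric] powr_mult mult_ac)
    also have "\<dots> \<le> ennreal (max 1 D * (real t * A) powr \<theta>)"
      by (intro ennreal_leI mult_right_mono) auto
    finally show ?thesis .
  qed
  then show ?thesis unfolding \<theta>_def by (intro that[of "max 1 D"]) auto
qed

context
  fixes p :: real and S :: "lamplighter set" and \<mu> :: "nat \<Rightarrow> lamplighter pmf"
  assumes p: "1 < p" "p < 2" and S: "finite_symmetric_generating_set wreath_ZZ S"
    and adm: "\<mu> \<in> admissible_seqs wreath_ZZ (word_metric wreath_ZZ S) p"
begin

lemma admissible_carrier: "t \<ge> 1 \<Longrightarrow> set_pmf (\<mu> t) \<subseteq> carrier wreath_ZZ"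
  using adm by (auto simp: admissible_seqs_def symmetric_pmf_on_def)

lemma admissible_symmetric: "t \<ge> 1 \<Longrightarrow> symmetric_pmf_on wreath_ZZ (\<mu> t)"
  using adm by (auto simp: admissible_seqs_def)

lemma admissible_integrable:
  assumes t: "t \<ge> 1"
  shows "integrable (\<mu> t) (\<lambda>g. real (wl S g) powr p)"
proof -
  have "integrable (\<mu> t) (\<lambda>x. word_metric wreath_ZZ S x \<one>\<^bsub>wreath_ZZ\<^esub> powr p)"
    using adm t by (simp add: admissible_seqs_def)
  then show ?thesis
    using admissible_carrier[OF t] word_metric_one[OF S]
    by (subst (asm) integrable_cong_AE[where g = "\<lambda>g. real (wl S g) powr p"]) (auto simp: AE_measure_pmf_iff)
qed

definition cost :: "nat \<Rightarrow> real" where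
  "cost t = real t * measure_pmf.expectation (\<mu> t) (\<lambda>g. real (wl S g) powr p)"

text \<open>Nontrivial elements have length at least \<open>1\<close>, so the cost dominates the quantity which tends to
  infinity by admissibility. Constants therefore do not affect the exponent.\<close>
lemma cost_tendsto: "filterlim cost at_top sequentially"
proof (rule filterlim_at_top_mono)
  show "filterlim (\<lambda>t. real t * measure_pmf.prob (\<mu> t) (carrier wreath_ZZ - {\<one>\<^bsub>wreath_ZZ\<^esub>})) at_top sequentially"
    using adm by (simp add: admissible_seqs_def)
  show "\<forall>\<^sub>F t in sequentially. real t * measure_pmf.prob (\<mu> t) (carrier wreath_ZZ - {\<one>\<^bsub>wreath_ZZ\<^esub>}) \<le> cost t"
  proof (intro eventually_sequentiallyI[of 1])
    fix t :: nat assume t: "t \<ge> 1"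
    let ?N = "carrier wreath_ZZ - {\<one>\<^bsub>wreath_ZZ\<^esub>}"
    have "measure_pmf.prob (\<mu> t) ?N = measure_pmf.expectation (\<mu> t) (indicator ?N)" by simp
    also have "\<dots> \<le> measure_pmf.expectation (\<mu> t) (\<lambda>g. real (wl S g) powr p)"
    proof (rule integral_mono)
      show "integrable (\<mu> t) (indicator ?N :: _ \<Rightarrow> real)"
        by (rule measure_pmf.integrable_const_bound[where B = 1]) (auto simp: indicator_def)
      fix g
      show "indicator ?N g \<le> real (wl S g) powr p"
      proof (cases "g \<in> ?N")
        case True
        then have "wl S g \<ge> 1"
          using group.word_length_eq_0[OF group_wreath_ZZ S, of g] by (cases "wl S g") auto
        then show ?thesis using True p by (simp add: ge_one_powr_ge_zero)
      qed simp
    qed (rule admissible_integrable[OF t])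
    finally show "real t * measure_pmf.prob (\<mu> t) ?N \<le> cost t"
      unfolding cost_def by (intro mult_left_mono) auto
  qed
qed

lemma beta_star_seq_eq:
  "beta_star_seq wreath_ZZ (word_metric wreath_ZZ S) p \<mu> =
    limsup (\<lambda>t. ereal (ln (measure_pmf.expectation (walk (\<mu> t) t) (\<lambda>w. real (wl S w))) / ln (cost t)))"
  unfolding beta_star_seq_def
proof (rule Limsup_eq, rule eventually_sequentiallyI[of 1])
  fix t :: nat assume t: "t \<ge> 1"
  note car = admissible_carrier[OF t]
  have "measure_pmf.expectation (walk (\<mu> t) t) (\<lambda>w. word_metric wreath_ZZ S w \<one>\<^bsub>wreath_ZZ\<^esub>)
    = measure_pmf.expectation (walk (\<mu> t) t) (\<lambda>w. real (wl S w))"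
    using set_walk[OF car] word_metric_one[OF S] by (intro integral_cong_AE) (auto simp: AE_measure_pmf_iff)
  moreover have "measure_pmf.expectation (walk (\<mu> t) 1) (\<lambda>w. word_metric wreath_ZZ S w \<one>\<^bsub>wreath_ZZ\<^esub> powr p)
    = measure_pmf.expectation (\<mu> t) (\<lambda>w. real (wl S w) powr p)"
    unfolding One_nat_def walk_1
    using car word_metric_one[OF S] by (intro integral_cong_AE) (auto simp: AE_measure_pmf_iff)
  ultimately show "ereal (ln (measure_pmf.expectation (walk (\<mu> t) t) (\<lambda>w. word_metric wreath_ZZ S w \<one>\<^bsub>wreath_ZZ\<^esub>)) /
       ln (real t * measure_pmf.expectation (walk (\<mu> t) 1) (\<lambda>w. word_metric wreath_ZZ S w \<one>\<^bsub>wreath_ZZ\<^esub> powr p)))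
     = ereal (ln (measure_pmf.expectation (walk (\<mu> t) t) (\<lambda>w. real (wl S w))) / ln (cost t))"
    by (simp only: cost_def)
qed

lemma walk_length_integrable:
  assumes t: "t \<ge> 1" and c: "cost t \<ge> 1"
  shows "integrable (walk (\<mu> t) t) (\<lambda>w. real (wl S w))"
proof -
  obtain C where "\<And>\<mu> t. symmetric_pmf_on wreath_ZZ \<mu> \<Longrightarrow> t \<ge> 1 \<Longrightarrow> integrable \<mu> (\<lambda>g. real (wl S g) powr p) \<Longrightarrow> 
       real t * measure_pmf.expectation \<mu> (\<lambda>g. real (wl S g) powr p) \<ge> 1 \<Longrightarrow>
       (\<integral>\<^sup>+w. ennreal (real (wl S w)) \<partial>walk \<mu> t) \<le>
         ennreal (C * (real t * measure_pmf.expectation \<mu> (\<lambda>g. real (wl S g) powr p)) powr ((2 * p - 1) / p\<^sup>2))"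
    using walk_word_length_upper[OF p S] by blast
  from this[OF admissible_symmetric[OF t] t admissible_integrable[OF t] c[unfolded cost_def]]
  show ?thesis by (intro integrableI_nonneg) (auto simp: le_less_trans)
qed

lemma beta_star_seq_le:
  "beta_star_seq wreath_ZZ (word_metric wreath_ZZ S) p \<mu> \<le> ereal ((2 * p - 1) / p\<^sup>2)"
proof -
  define \<theta> where "\<theta> = (2 * p - 1) / p\<^sup>2"
  obtain C where C: "C \<ge> 1" and up: "\<And>\<mu> t. symmetric_pmf_on wreath_ZZ \<mu> \<Longrightarrow> t \<ge> 1 \<Longrightarrow> integrable \<mu> (\<lambda>g. real (wl S g) powr p) \<Longrightarrow> 
       real t * measure_pmf.expectation \<mu> (\<lambda>g. real (wl S g) powr p) \<ge> 1 \<Longrightarrow>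
       (\<integral>\<^sup>+w. ennreal (real (wl S w)) \<partial>walk \<mu> t) \<le>
         ennreal (C * (real t * measure_pmf.expectation \<mu> (\<lambda>g. real (wl S g) powr p)) powr \<theta>)"
    unfolding \<theta>_def using walk_word_length_upper[OF p S] by blast
  have \<theta>: "\<theta> \<ge> 0" using p by (simp add: \<theta>_def)
  have bound: "ln (measure_pmf.expectation (walk (\<mu> t) t) (\<lambda>w. real (wl S w))) / ln (cost t) \<le> \<theta> + ln C / ln (cost t)"
    if t: "t \<ge> 1" and c: "cost t \<ge> 2" for t
  proof -
    let ?E = "measure_pmf.expectation (walk (\<mu> t) t) (\<lambda>w. real (wl S w))"
    have "ennreal ?E = (\<integral>\<^sup>+w. ennreal (real (wl S w)) \<partial>walk (\<mu> t) t)"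
      using walk_length_integrable[OF t] c by (subst nn_integral_eq_integral) auto
    also have "\<dots> \<le> ennreal (C * cost t powr \<theta>)"
      unfolding cost_def using c
      by (intro up admissible_symmetric admissible_integrable t) (simp add: cost_def)
    finally have E: "?E \<le> C * cost t powr \<theta>"
      using C by (subst (asm) ennreal_le_iff) auto
    have lc: "ln (cost t) > 0" using c by simp
    have "ln ?E \<le> ln C + \<theta> * ln (cost t)"
    proof (cases "?E > 0")
      case True
      then have "ln ?E \<le> ln (C * cost t powr \<theta>)" using E C c by simp
      then show ?thesis using C c by (simp add: ln_mult ln_powr)
    next
      case False
      have "?E \<ge> 0" by (rule Bochner_Integration.integral_nonneg) simp
      with False have "?E = 0" by simp
      then show ?thesis using C lc \<theta> by simp
    qed
    then show ?thesis using lc by (simp add: field_simps)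
  qed
  have "filterlim (\<lambda>t. ln (cost t)) at_top sequentially"
    by (rule filterlim_compose[OF ln_at_top cost_tendsto])
  then have "((\<lambda>t. \<theta> + ln C / ln (cost t)) \<longlongrightarrow> \<theta> + 0) sequentially"
    by (intro tendsto_add tendsto_const real_tendsto_divide_at_top[OF tendsto_const])
  then have lim: "((\<lambda>t. ereal (\<theta> + ln C / ln (cost t))) \<longlongrightarrow> ereal \<theta>) sequentially" by simp
  have "beta_star_seq wreath_ZZ (word_metric wreath_ZZ S) p \<mu> \<le> limsup (\<lambda>t. ereal (\<theta> + ln C / ln (cost t)))"
    unfolding beta_star_seq_eq
  proof (rule Limsup_mono)
    have "\<forall>\<^sub>F t in sequentially. cost t \<ge> 2" using cost_tendsto by (simp add: filterlim_at_top)
    then show "\<forall>\<^sub>F t in sequentially. ereal (ln (measure_pmf.expectation (walk (\<mu> t) t) (\<lambda>w. real (wl S w))) / ln (cost t)) \<le> ereal (\<theta> + ln C / ln (cost t))"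
      using eventually_ge_at_top[of 1] by eventually_elim (use bound in auto)
  qed
  also have "\<dots> = ereal \<theta>" using lim by (intro lim_imp_Limsup) auto
  finally show ?thesis by (simp add: \<theta>_def)
qed

end

section \<open>Switch-or-walk measures\<close>

text \<open>Separating switches from moves, instead of combining them in one step, makes the measure symmetric
  as soon as both ingredients are.\<close>
definition switch_or_walk :: "int pmf \<Rightarrow> int pmf \<Rightarrow> lamplighter pmf" where
  "switch_or_walk L J = bind_pmf (bernoulli_pmf (1/2)) (\<lambda>b. if b then map_pmf lamp L else map_pmf move J)"

lemma nn_integral_switch_or_walk:
  "(\<integral>\<^sup>+g. f g \<partial>switch_or_walk L J) =
     ennreal (1/2) * (\<integral>\<^sup>+h. f (lamp h) \<partial>L) + ennreal (1/2) * (\<integral>\<^sup>+x. f (move x) \<partial>J)"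
  unfolding switch_or_walk_def by (simp add: mult.commute)

lemma switch_or_walk_symmetric:
  assumes "map_pmf uminus L = L" "map_pmf uminus J = J"
  shows "symmetric_pmf_on wreath_ZZ (switch_or_walk L J)"
proof -
  define \<mu> where "\<mu> = switch_or_walk L J"
  have l: "winv (lamp h) = lamp (- h)" and m: "winv (move x) = move (- x)" for h x
    by (auto simp: winv_def fun_eq_iff)
  have "map_pmf winv \<mu> = bind_pmf (bernoulli_pmf (1/2)) (\<lambda>b. if b then map_pmf lamp (map_pmf uminus L) else map_pmf move (map_pmf uminus J))"
    unfolding \<mu>_def switch_or_walk_def map_bind_pmf
    by (intro bind_pmf_cong refl) (auto simp: map_pmf_comp l m)
  then have sym: "map_pmf winv \<mu> = \<mu>" unfolding assms \<mu>_def switch_or_walk_def .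
  have "inj winv" by (metis injI winv_winv)
  then have "pmf \<mu> g = pmf \<mu> (winv g)" for g
    using pmf_map_inj'[of winv \<mu> g] unfolding sym by simp
  moreover have "set_pmf \<mu> \<subseteq> carrier wreath_ZZ"
    by (auto simp: \<mu>_def switch_or_walk_def carrier_wreath split: if_splits)
  ultimately show ?thesis
    by (simp add: symmetric_pmf_on_def \<mu>_def[symmetric] inv_eq_winv)
qed

definition at_prob :: "lamplighter pmf \<Rightarrow> nat \<Rightarrow> int \<Rightarrow> ennreal" where
  "at_prob \<mu> t y = (\<integral>\<^sup>+w. of_bool (snd w = y) \<partial>walk \<mu> t)"

definition lit_prob :: "lamplighter pmf \<Rightarrow> nat \<Rightarrow> int \<Rightarrow> ennreal" where
  "lit_prob \<mu> t y = (\<integral>\<^sup>+w. of_bool (fst w y \<noteq> 0) \<partial>walk \<mu> t)"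

lemma nn_integral_walk_Suc:
  "(\<integral>\<^sup>+w. f w \<partial>walk (switch_or_walk L J) (Suc t)) =
     ennreal (1/2) * (\<integral>\<^sup>+h. \<integral>\<^sup>+w. f (lamp h \<otimes>\<^bsub>wreath_ZZ\<^esub> w) \<partial>walk (switch_or_walk L J) t \<partial>L)
   + ennreal (1/2) * (\<integral>\<^sup>+x. \<integral>\<^sup>+w. f (move x \<otimes>\<^bsub>wreath_ZZ\<^esub> w) \<partial>walk (switch_or_walk L J) t \<partial>J)"
  by (simp add: walk_Suc nn_integral_switch_or_walk)

lemma at_prob_0: "at_prob \<mu> 0 y = of_bool (y = 0)"
  by (auto simp: at_prob_def walk_0 one_wreath nn_integral_return_pmf)

lemma at_prob_Suc:
  "at_prob (switch_or_walk L J) (Suc t) y = ennreal (1/2) * at_prob (switch_or_walk L J) t y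
     + ennreal (1/2) * (\<integral>\<^sup>+x. at_prob (switch_or_walk L J) t (y - x) \<partial>J)"
proof -
  have "(x + snd w = y) = (snd w = y - x)" for x and w :: lamplighter by auto
  then show ?thesis
    unfolding at_prob_def nn_integral_walk_Suc by (simp add: mult_wreath_eq)
qed

lemma half_add_half: "ennreal (1/2) * a + ennreal (1/2) * a = a"
proof -
  have "ennreal (1/2) * a + ennreal (1/2) * a = (ennreal (1/2) + ennreal (1/2)) * a"
    by (simp only: distrib_right)
  also have "ennreal (1/2) + ennreal (1/2) = 1" by (subst ennreal_plus[symmetric]) auto
  finally show ?thesis by simp
qed

text \<open>A union bound: a lit lamp has been switched at some time when the walker stood at it. The factor
  \<open>q/2\<close> is the probability of a switch at a given step.\<close>
lemma lit_prob_le: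
  fixes L J :: "int pmf"
  assumes q: "(\<integral>\<^sup>+h. of_bool (h \<noteq> 0) \<partial>L) \<le> q"
  defines "\<mu> \<equiv> switch_or_walk L J"
  shows "lit_prob \<mu> t y \<le> ennreal (1/2) * q * (\<Sum>i<t. at_prob \<mu> i y)"
proof (induction t arbitrary: y)
  case 0
  show ?case by (simp add: lit_prob_def walk_0 one_wreath nn_integral_return_pmf)
next
  case (Suc t)
  have a: "(\<integral>\<^sup>+h. \<integral>\<^sup>+w. of_bool (fst (lamp h \<otimes>\<^bsub>wreath_ZZ\<^esub> w) y \<noteq> 0) \<partial>walk \<mu> t \<partial>L) \<le> q * of_bool (y = 0) + lit_prob \<mu> t y"
  proof -
    have "(\<integral>\<^sup>+h. \<integral>\<^sup>+w. of_bool (fst (lamp h \<otimes>\<^bsub>wreath_ZZ\<^esub> w) y \<noteq> 0) \<partial>walk \<mu> t \<partial>L)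
       \<le> (\<integral>\<^sup>+h. \<integral>\<^sup>+w. of_bool (h \<noteq> 0) * of_bool (y = 0) + of_bool (fst w y \<noteq> 0) \<partial>walk \<mu> t \<partial>L)"
      by (intro nn_integral_mono) (auto simp: mult_wreath_eq)
    also have "\<dots> = (\<integral>\<^sup>+h. of_bool (h \<noteq> 0) \<partial>L) * of_bool (y = 0) + lit_prob \<mu> t y"
      by (simp add: nn_integral_add lit_prob_def nn_integral_multc)
    also have "\<dots> \<le> q * of_bool (y = 0) + lit_prob \<mu> t y"
      by (intro add_right_mono mult_right_mono q) auto
    finally show ?thesis .
  qed
  have b: "(\<integral>\<^sup>+x. \<integral>\<^sup>+w. of_bool (fst (move x \<otimes>\<^bsub>wreath_ZZ\<^esub> w) y \<noteq> 0) \<partial>walk \<mu> t \<partial>J) = (\<integral>\<^sup>+x. lit_prob \<mu> t (y - x) \<partial>J)"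
    by (simp add: mult_wreath_eq lit_prob_def)
  have "lit_prob \<mu> (Suc t) y \<le> ennreal (1/2) * (q * of_bool (y = 0) + lit_prob \<mu> t y) + ennreal (1/2) * (\<integral>\<^sup>+x. lit_prob \<mu> t (y - x) \<partial>J)"
    unfolding lit_prob_def[of \<mu> "Suc t"] nn_integral_walk_Suc[where L = L and J = J, folded \<mu>_def] b
    by (intro add_right_mono mult_left_mono a) auto
  also have "\<dots> \<le> ennreal (1/2) * (q * of_bool (y = 0) + ennreal (1/2) * q * (\<Sum>i<t. at_prob \<mu> i y))
      + ennreal (1/2) * (\<integral>\<^sup>+x. ennreal (1/2) * q * (\<Sum>i<t. at_prob \<mu> i (y - x)) \<partial>J)"
    by (intro add_mono mult_left_mono nn_integral_mono Suc.IH) auto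
  also have "\<dots> = ennreal (1/2) * q * (of_bool (y = 0) + 
       (ennreal (1/2) * (\<Sum>i<t. at_prob \<mu> i y) + ennreal (1/2) * (\<Sum>i<t. (\<integral>\<^sup>+x. at_prob \<mu> i (y - x) \<partial>J))))"
  proof -
    have alg: "h * (q * d + h * q * S) + h * (h * q * T) = h * q * (d + (h * S + h * T))" for h d S T :: ennreal
      by (simp add: algebra_simps)
    have "(\<integral>\<^sup>+x. ennreal (1/2) * q * (\<Sum>i<t. at_prob \<mu> i (y - x)) \<partial>J)
        = ennreal (1/2) * q * (\<Sum>i<t. (\<integral>\<^sup>+x. at_prob \<mu> i (y - x) \<partial>J))"
      by (subst nn_integral_cmult, simp, subst nn_integral_sum, simp_all)
    then show ?thesis by (simp only: alg)
  qed
  also have "\<dots> = ennreal (1/2) * q * (\<Sum>i<Suc t. at_prob \<mu> i y)"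
    unfolding sum.lessThan_Suc_shift
    by (simp add: at_prob_0 at_prob_Suc[where L = L and J = J, folded \<mu>_def] sum.distrib sum_distrib_left del: sum.lessThan_Suc)
  finally show ?case .
qed

lemma at_prob_total: "(\<integral>\<^sup>+y. at_prob \<mu> t y \<partial>count_space UNIV) = 1"
proof -
  have "(\<integral>\<^sup>+y. at_prob \<mu> t y \<partial>count_space UNIV) = (\<integral>\<^sup>+w. \<integral>\<^sup>+y. of_bool (snd w = y) \<partial>count_space UNIV \<partial>walk \<mu> t)"
    unfolding at_prob_def by (rule nn_integral_pmf_count_space_swap[symmetric])
  also have "\<dots> = (\<integral>\<^sup>+w. 1 \<partial>walk \<mu> t)"
    by (intro nn_integral_cong) (subst nn_integral_count_space'[where A = "{snd _}"], auto)
  finally show ?thesis by simp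
qed

section \<open>Heavy-tailed jumps\<close>

text \<open>A jump uniform on scale \<open>2\<^sup>j\<close>, where scale \<open>j\<close> or larger is chosen with probability \<open>2\<^bsup>-aj\<^esup>\<close>.\<close>
definition heavy_jump :: "real \<Rightarrow> int pmf" where
  "heavy_jump a = bind_pmf (geometric_pmf (1 - 2 powr (- a))) (\<lambda>j. pmf_of_set {- (2 ^ j)..2 ^ j})"

lemma heavy_jump_symmetric: "map_pmf uminus (heavy_jump a) = heavy_jump a"
proof -
  have "map_pmf uminus (pmf_of_set {- (2 ^ j)..2 ^ j :: int}) = pmf_of_set {- (2 ^ j)..2 ^ j}" for j :: nat
    by (subst map_pmf_of_set_inj) (auto simp: image_uminus_atLeastAtMost)
  then show ?thesis by (simp add: heavy_jump_def map_bind_pmf)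
qed

lemma geometric_less:
  assumes "a > 0"
  shows "(\<integral>\<^sup>+j. of_bool (j < n) \<partial>geometric_pmf (1 - 2 powr (- a))) = ennreal (1 - (2 powr (- a)) ^ n)"
proof -
  define s where "s = 2 powr (- a)"
  have s: "0 < s" "s < 1" using assms powr_less_mono[of "-a" 0 2] by (auto simp: s_def)
  have "(\<integral>\<^sup>+j. of_bool (j < n) \<partial>geometric_pmf (1 - s)) = (\<integral>\<^sup>+j. ennreal (s ^ j * (1 - s)) * of_bool (j < n) \<partial>count_space UNIV)"
    using s by (simp add: nn_integral_measure_pmf)
  also have "\<dots> = (\<Sum>j<n. ennreal (s ^ j * (1 - s)))"
    by (subst nn_integral_count_space'[of "{..<n}"]) auto
  also have "\<dots> = ennreal (\<Sum>j<n. s ^ j * (1 - s))" using s by (intro sum_ennreal) auto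
  also have "(\<Sum>j<n. s ^ j * (1 - s)) = 1 - s ^ n"
    using s one_diff_power_eq[of s n] by (simp add: sum_distrib_left mult.commute)
  finally show ?thesis by (simp add: s_def)
qed

text \<open>Here \<open>w/2\<close> is the probability that a step is a jump of scale at least \<open>n\<close>. After one such jump every
  point has probability at most \<open>2\<^bsup>-n\<^esup>\<close>, and \<open>(1 - w/2)\<^sup>t\<close> is the probability that none has occurred.\<close>
lemma at_prob_bound:
  fixes n :: nat and a :: real
  assumes a: "a > 0"
  defines "w \<equiv> (2 powr (- a)) ^ n"
  shows "at_prob (switch_or_walk L (heavy_jump a)) t y \<le> ennreal ((1 - w / 2) ^ t) + ennreal (1 / 2 ^ n)"
proof (induction t arbitrary: y)
  case 0
  show ?case by (simp add: at_prob_0 add_increasing2)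
next
  case (Suc t)
  define P where "P = at_prob (switch_or_walk L (heavy_jump a)) t"
  define b where "b = (1 - w / 2) ^ t"
  define e where "e = (1 / 2 ^ n :: real)"
  have s: "0 < 2 powr (- a)" "2 powr (- a) < 1" using a powr_less_mono[of "-a" 0 2] by auto
  have w: "0 \<le> w" "w \<le> 1" unfolding w_def using s by (auto intro: power_le_one)
  have b0: "b \<ge> 0" using w by (simp add: b_def)
  have e0: "e \<ge> 0" by (simp add: e_def)
  have IH: "P z \<le> ennreal b + ennreal e" for z using Suc.IH by (simp add: P_def b_def e_def)
  have j: "(\<integral>\<^sup>+x. P (y - x) \<partial>pmf_of_set {- (2 ^ j)..2 ^ j}) \<le> ennreal e + ennreal b * of_bool (j < n)" for j
  proof (cases "j < n")
    case True
    have "(\<integral>\<^sup>+x. P (y - x) \<partial>pmf_of_set {- (2 ^ j)..2 ^ j}) \<le> (\<integral>\<^sup>+x. ennreal b + ennreal e \<partial>pmf_of_set {- (2 ^ j)..2 ^ j :: int})"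
      by (intro nn_integral_mono IH)
    then show ?thesis using True by (simp add: add.commute)
  next
    case False
    define A where "A = {- (2 ^ j)..2 ^ j :: int}"
    have A: "finite A" "A \<noteq> {}" by (auto simp: A_def)
    have cA: "real (card A) \<ge> 2 ^ n"
    proof -
      have "2 ^ n \<le> (2::nat) ^ j" using False by (intro power_increasing) auto
      also have "2 ^ j \<le> card A" by (simp add: A_def nat_add_distrib nat_mult_distrib nat_power_eq flip: of_nat_le_iff[where ?'a = int])
      finally show ?thesis by (metis of_nat_le_iff of_nat_numeral of_nat_power)
    qed
    have "(\<integral>\<^sup>+x. P (y - x) \<partial>pmf_of_set A) = (\<Sum>x\<in>A. P (y - x)) / of_nat (card A)"
      using A by (intro nn_integral_pmf_of_set) auto
    also have "(\<Sum>x\<in>A. P (y - x)) = (\<Sum>z\<in>(\<lambda>x. y - x) ` A. P z)"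
      by (subst sum.reindex) (auto simp: inj_on_def)
    also have "\<dots> \<le> (\<integral>\<^sup>+z. P z \<partial>count_space UNIV)"
    proof -
      have "(\<Sum>z\<in>(\<lambda>x. y - x) ` A. P z) = (\<integral>\<^sup>+z. P z * indicator ((\<lambda>x. y - x) ` A) z \<partial>count_space UNIV)"
        using A by (subst nn_integral_count_space'[of "(\<lambda>x. y - x) ` A"]) (auto simp: indicator_def intro!: sum.cong)
      also have "\<dots> \<le> (\<integral>\<^sup>+z. P z \<partial>count_space UNIV)"
        by (intro nn_integral_mono) (auto simp: indicator_def)
      finally show ?thesis .
    qed
    also have "\<dots> = 1" unfolding P_def by (rule at_prob_total)
    finally have "(\<integral>\<^sup>+x. P (y - x) \<partial>pmf_of_set A) \<le> 1 / of_nat (card A)"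
      by (simp add: divide_right_mono_ennreal)
    also have "\<dots> = ennreal (1 / real (card A))"
      using A by (simp add: ennreal_of_nat_eq_real_of_nat divide_ennreal[symmetric] card_gt_0_iff)
    also have "\<dots> \<le> ennreal e"
      unfolding e_def using cA A by (intro ennreal_leI divide_left_mono) (auto simp: card_gt_0_iff)
    finally show ?thesis using False by (simp add: A_def)
  qed
  have "(\<integral>\<^sup>+x. P (y - x) \<partial>heavy_jump a) \<le> (\<integral>\<^sup>+j. ennreal e + ennreal b * of_bool (j < n) \<partial>geometric_pmf (1 - 2 powr (- a)))"
    unfolding heavy_jump_def by (simp, intro nn_integral_mono j)
  also have "\<dots> = ennreal e + ennreal b * ennreal (1 - w)"
    using geometric_less[OF a] by (simp add: nn_integral_add nn_integral_cmult w_def)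
  finally have J: "(\<integral>\<^sup>+x. P (y - x) \<partial>heavy_jump a) \<le> ennreal e + ennreal b * ennreal (1 - w)" .
  have "at_prob (switch_or_walk L (heavy_jump a)) (Suc t) y \<le> ennreal (1/2) * (ennreal b + ennreal e) + ennreal (1/2) * (ennreal e + ennreal b * ennreal (1 - w))"
    unfolding at_prob_Suc P_def[symmetric] by (intro add_mono mult_left_mono IH J) auto
  also have "\<dots> = ennreal (1/2 * (b + e) + 1/2 * (e + b * (1 - w)))"
  proof -
    have "ennreal (1/2) * (ennreal b + ennreal e) + ennreal (1/2) * (ennreal e + ennreal b * ennreal (1 - w))
       = ennreal (1/2) * ennreal (b + e) + ennreal (1/2) * ennreal (e + b * (1 - w))"
      using b0 e0 w by (simp add: ennreal_plus ennreal_mult)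
    also have "\<dots> = ennreal (1/2 * (b + e)) + ennreal (1/2 * (e + b * (1 - w)))"
      using b0 e0 w by (subst (1 2) ennreal_mult) auto
    also have "\<dots> = ennreal (1/2 * (b + e) + 1/2 * (e + b * (1 - w)))"
      using b0 e0 w by (intro ennreal_plus[symmetric]) auto
    finally show ?thesis .
  qed
  also have "1/2 * (b + e) + 1/2 * (e + b * (1 - w)) = (1 - w / 2) ^ Suc t + 1 / 2 ^ n"
  proof -
    have "1/2 * (b + e) + 1/2 * (e + b * (1 - w)) = (1 - w / 2) * b + e" by (simp add: algebra_simps)
    then show ?thesis by (simp add: b_def e_def)
  qed
  also have "ennreal \<dots> = ennreal ((1 - w / 2) ^ Suc t) + ennreal (1 / 2 ^ n)"
    using w by (intro ennreal_plus) auto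
  finally show ?case .
qed

lemma exp_minus_le_powr:
  fixes x s :: real
  assumes "x > 0" "s > 0"
  shows "exp (- x) \<le> (s / x) powr s"
proof -
  have "x / s \<le> exp (x / s)" using exp_ge_add_one_self[of "x / s"] by linarith
  then have "(x / s) powr s \<le> exp (x / s) powr s" using assms by (intro powr_mono2) auto
  also have "\<dots> = exp x" using assms by (simp add: powr_def)
  finally have "exp (- x) \<le> inverse ((x / s) powr s)"
    using assms by (simp add: exp_minus le_imp_inverse_le)
  also have "\<dots> = (s / x) powr s" using assms by (simp add: powr_divide)
  finally show ?thesis .
qed

text \<open>The scale is chosen with \<open>2\<^sup>n\<close> of order \<open>t\<^bsup>\<eta>\<^esup>\<close>. Then jumps of that scale have probability of order
  \<open>t\<^bsup>-a \<eta>\<^esup>\<close>, so by \<open>a \<eta> < 1\<close> about \<open>t\<^bsup>\<epsilon>\<^esup>\<close> of them are expected, and the probability of having none is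
  smaller than any power of \<open>t\<close>.\<close>
lemma at_prob_decay:
  assumes \<eta>: "0 < \<eta>" and a: "a > 0" "a * \<eta> < 1"
  obtains C :: real where "C > 0"
    "\<And>L t y. at_prob (switch_or_walk L (heavy_jump a)) t y \<le> ennreal (C * real (Suc t) powr (- \<eta>))"
proof -
  define \<epsilon> where "\<epsilon> = 1 - a * \<eta>"
  define c where "c = 2 powr (- a) / 4"
  define s where "s = \<eta> / \<epsilon>"
  have pos: "\<epsilon> > 0" "c > 0" "s > 0" using \<eta> a by (auto simp: \<epsilon>_def c_def s_def)
  define D where "D = max 1 ((s / c) powr s)"
  have "at_prob (switch_or_walk L (heavy_jump a)) t y \<le> ennreal ((D + 1) * real (Suc t) powr (- \<eta>))" for L t y
  proof -
    define x where "x = real (Suc t)"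
    have x: "x \<ge> 1" by (simp add: x_def)
    define n where "n = nat \<lceil>\<eta> * log 2 x\<rceil>"
    have lx: "\<eta> * log 2 x \<ge> 0" using x \<eta> by simp
    \<comment> \<open>Thus \<open>2\<^sup>n\<close> lies between \<open>x\<^bsup>\<eta>\<^esup>\<close> and \<open>2 x\<^bsup>\<eta>\<^esup>\<close>.\<close>
    have n: "real n \<ge> \<eta> * log 2 x" "real n \<le> \<eta> * log 2 x + 1" using lx unfolding n_def by linarith+
    have x2: "2 powr (\<eta> * log 2 x) = x powr \<eta>" using x by (simp add: powr_powr[symmetric] mult.commute[of \<eta>])
    have "x powr \<eta> \<le> 2 powr real n" unfolding x2[symmetric] using n by simp
    then have e: "1 / 2 ^ n \<le> x powr (- \<eta>)"
      using x by (simp add: powr_realpow powr_minus divide_simps)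
    define w where "w = (2 powr (- a)) ^ n"
    have w_eq: "w = 2 powr (- a * real n)" unfolding w_def by (simp add: powr_realpow[symmetric] powr_powr)
    have "w \<ge> 2 powr (- a * (\<eta> * log 2 x + 1))"
      unfolding w_eq using n a by (intro powr_mono) (auto simp: mult_left_mono)
    also have "2 powr (- a * (\<eta> * log 2 x + 1)) = 2 powr (- a) * x powr (- (a * \<eta>))"
    proof -
      have "2 powr (- a * (\<eta> * log 2 x + 1)) = (2 powr log 2 x) powr (- (a * \<eta>)) * 2 powr (- a)"
        unfolding powr_powr powr_add[symmetric] by (simp add: algebra_simps)
      then show ?thesis using x by simp
    qed
    finally have w: "w \<ge> 4 * c * x powr (- (a * \<eta>))" by (simp add: c_def)
    have "2 powr (- a) \<le> 1" using a powr_mono[of "- a" 0 2] by simp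
    then have w1: "0 \<le> w" "w \<le> 1" unfolding w_def by (auto intro: power_le_one)
    have "(1 - w / 2) ^ t \<le> D * x powr (- \<eta>)"
    proof (cases "t = 0")
      case True
      then show ?thesis by (simp add: x_def D_def)
    next
      case False
      have "(1 - w / 2) ^ t \<le> exp (- (w / 2)) ^ t"
        using w1 exp_ge_add_one_self[of "- (w / 2)"] by (intro power_mono) auto
      also have "\<dots> = exp (- (real t * w / 2))" by (simp add: exp_of_nat_mult[symmetric])
      also have "\<dots> \<le> exp (- (c * x powr \<epsilon>))"
      proof -
        have "c * x powr \<epsilon> = (x / 2) * (4 * c * x powr (- (a * \<eta>))) / 2"
          using x powr_add[of x 1 "- (a * \<eta>)"] by (simp add: \<epsilon>_def)
        also have "\<dots> \<le> real t * w / 2"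
          \<comment> \<open>as \<open>t \<ge> (t + 1)/2\<close> for \<open>t \<ge> 1\<close>\<close>
          using False w pos by (intro divide_right_mono mult_mono) (auto simp: x_def)
        finally show ?thesis by simp
      qed
      also have "\<dots> \<le> (s / (c * x powr \<epsilon>)) powr s"
        using pos x by (intro exp_minus_le_powr) auto
      also have "\<dots> = (s / c) powr s * x powr (- \<eta>)"
      proof -
        have "\<epsilon> * s = \<eta>" using pos by (simp add: s_def)
        then have "(x powr \<epsilon>) powr s = x powr \<eta>" by (simp add: powr_powr)
        then show ?thesis
          using powr_mult[of "s / c" "1 / x powr \<epsilon>" s] powr_divide[of 1 "x powr \<epsilon>" s] pos x
          by (simp add: powr_minus_divide)
      qed
      also have "\<dots> \<le> D * x powr (- \<eta>)" by (intro mult_right_mono) (auto simp: D_def)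
      finally show ?thesis .
    qed
    then have "(1 - w / 2) ^ t + 1 / 2 ^ n \<le> (D + 1) * x powr (- \<eta>)" using e by (simp add: distrib_right)
    moreover have "ennreal ((1 - w / 2) ^ t) + ennreal (1 / 2 ^ n) = ennreal ((1 - w / 2) ^ t + 1 / 2 ^ n)"
      using w1 by (intro ennreal_plus[symmetric]) auto
    ultimately have "ennreal ((1 - w / 2) ^ t) + ennreal (1 / 2 ^ n) \<le> ennreal ((D + 1) * x powr (- \<eta>))"
      by (simp only: ennreal_leI)
    with at_prob_bound[OF a(1), of L t y n, folded w_def] show ?thesis
      unfolding x_def by (rule order.trans)
  qed
  then show ?thesis by (intro that[of "D + 1"]) (auto simp: D_def)
qed

lemma sum_powr_le:
  assumes "0 < \<eta>" "\<eta> < 1"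
  shows "(\<Sum>k<t. real (Suc k) powr (- \<eta>)) \<le> real t powr (1 - \<eta>) / (1 - \<eta>)"
proof (induction t)
  case (Suc t)
  have "(1 - \<eta>) * real (Suc t) powr (- \<eta>) \<le> real (Suc t) powr (1 - \<eta>) - real t powr (1 - \<eta>)"
  proof (cases "t = 0")
    case False
    have "\<exists>z. real t < z \<and> z < real (Suc t) \<and> real (Suc t) powr (1 - \<eta>) - real t powr (1 - \<eta>) = (real (Suc t) - real t) * ((1 - \<eta>) * z powr (1 - \<eta> - 1))"
      using False by (intro MVT2) (auto intro!: derivative_eq_intros)
    then obtain z where z: "real t < z" "z < real (Suc t)" and eq: "real (Suc t) powr (1 - \<eta>) - real t powr (1 - \<eta>) = (1 - \<eta>) * z powr (- \<eta>)"
      by auto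
    show ?thesis unfolding eq using z False assms by (intro mult_left_mono powr_mono2') auto
  qed (use assms in simp)
  then have "real (Suc t) powr (- \<eta>) \<le> real (Suc t) powr (1 - \<eta>) / (1 - \<eta>) - real t powr (1 - \<eta>) / (1 - \<eta>)"
    using divide_right_mono[of _ _ "1 - \<eta>"] assms by (fastforce simp: diff_divide_distrib)
  with Suc show ?case by simp
qed simp

section \<open>Rare switches of large amplitude\<close>

text \<open>The probability \<open>H\<^bsup>-p\<^esup>\<close> of a switch normalises the \<open>p\<close>-th moment to \<open>1\<close>.\<close>
definition rare_switch :: "real \<Rightarrow> nat \<Rightarrow> int pmf" where
  "rare_switch p H = bind_pmf (bernoulli_pmf (real H powr (- p)))
     (\<lambda>b. if b then pmf_of_set {int H, - int H} else return_pmf 0)"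

lemma rare_switch_symmetric: "map_pmf uminus (rare_switch p H) = rare_switch p H"
proof -
  have "map_pmf uminus (pmf_of_set {int H, - int H}) = pmf_of_set {int H, - int H}"
    by (subst map_pmf_of_set_inj) (auto simp: insert_commute)
  then show ?thesis
    unfolding rare_switch_def map_bind_pmf by (intro bind_pmf_cong refl) auto
qed

lemma set_rare_switch: "set_pmf (rare_switch p H) \<subseteq> {0, int H, - int H}"
  by (auto simp: rare_switch_def split: if_splits)

lemma nn_integral_rare_switch:
  assumes H: "H \<ge> 1" and p: "p > 0" and f: "\<And>h. \<bar>h\<bar> = int H \<Longrightarrow> f h = c" "f 0 = 0"
  shows "(\<integral>\<^sup>+h. f h \<partial>rare_switch p H) = ennreal (real H powr (- p)) * c"
proof -
  have q: "0 \<le> real H powr (- p)" "real H powr (- p) \<le> 1"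
    using H p powr_mono[of "- p" 0 "real H"] by auto
  have "(\<integral>\<^sup>+h. f h \<partial>pmf_of_set {int H, - int H}) = (\<integral>\<^sup>+h. c \<partial>pmf_of_set {int H, - int H})"
    by (intro nn_integral_cong_AE) (auto simp: AE_measure_pmf_iff f)
  then show ?thesis
    unfolding rare_switch_def using q f by (simp add: nn_integral_return_pmf mult.commute)
qed

text \<open>A switch of an unlit lamp adds \<open>H\<close> to the total intensity; a switch of a lit lamp loses at most \<open>H\<close>,
  which the last summand, twice \<open>H\<close>, makes up for.\<close>
lemma lamps_switch:
  assumes w: "w \<in> carrier wreath_ZZ" and h: "h \<in> {0, int H, - int H}"
  shows "lamps w + int H * of_bool (h \<noteq> 0) \<le>
     lamps (lamp h \<otimes>\<^bsub>wreath_ZZ\<^esub> w) + 2 * int H * (of_bool (h \<noteq> 0) * of_bool (fst w 0 \<noteq> 0))"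
proof -
  define A where "A = {z. fst w z \<noteq> 0} - {0}"
  have fin: "finite A" using w by (simp add: A_def carrier_wreath)
  have 1: "lamps w = \<bar>fst w 0\<bar> + (\<Sum>z\<in>A. \<bar>fst w z\<bar>)"
  proof -
    have "lamps w = (\<Sum>z\<in>insert 0 A. \<bar>fst w z\<bar>)"
      using fin by (intro lamps_eq_sum) (auto simp: A_def)
    also have "\<dots> = \<bar>fst w 0\<bar> + (\<Sum>z\<in>A. \<bar>fst w z\<bar>)"
      using fin by (intro sum.insert) (auto simp: A_def)
    finally show ?thesis .
  qed
  have "lamps (lamp h \<otimes>\<^bsub>wreath_ZZ\<^esub> w) = (\<Sum>z\<in>insert 0 A. \<bar>fst (lamp h \<otimes>\<^bsub>wreath_ZZ\<^esub> w) z\<bar>)"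
    using fin by (intro lamps_eq_sum) (auto simp: A_def mult_wreath_eq)
  also have "\<dots> = \<bar>h + fst w 0\<bar> + (\<Sum>z\<in>A. \<bar>fst (lamp h \<otimes>\<^bsub>wreath_ZZ\<^esub> w) z\<bar>)"
    using fin by (subst sum.insert) (auto simp: A_def mult_wreath_eq)
  also have "(\<Sum>z\<in>A. \<bar>fst (lamp h \<otimes>\<^bsub>wreath_ZZ\<^esub> w) z\<bar>) = (\<Sum>z\<in>A. \<bar>fst w z\<bar>)"
    by (intro sum.cong) (auto simp: A_def mult_wreath_eq)
  finally show ?thesis using h 1 by (auto simp: of_bool_def)
qed

lemma lamps_move: "lamps (move x \<otimes>\<^bsub>wreath_ZZ\<^esub> w) = lamps w"
  unfolding mult_wreath_eq by (rule lamps_shift[where a = x]) simp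

text \<open>The new step is put in front of the walk, so it acts on the lamp which the remaining walk has left
  at \<open>0\<close>. The loss due to lit lamps stands on the right-hand side, which avoids subtraction of
  extended reals.\<close>
lemma walk_lamps_lower:
  fixes L J :: "int pmf"
  assumes L: "set_pmf L \<subseteq> {0, int H, - int H}" and q: "(\<integral>\<^sup>+h. of_bool (h \<noteq> 0) \<partial>L) = q"
    and car: "set_pmf (switch_or_walk L J) \<subseteq> carrier wreath_ZZ"
  defines "\<mu> \<equiv> switch_or_walk L J"
  shows "of_nat t * (ennreal (1/2) * (of_nat H * q)) \<le>
     (\<integral>\<^sup>+w. ennreal (real_of_int (lamps w)) \<partial>walk \<mu> t) + of_nat H * q * (\<Sum>i<t. lit_prob \<mu> i 0)"
proof (induction t)
  case (Suc t)
  define E where "E t = (\<integral>\<^sup>+w. ennreal (real_of_int (lamps w)) \<partial>walk \<mu> t)" for t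
  define A where "A = (\<integral>\<^sup>+h. \<integral>\<^sup>+w. ennreal (real_of_int (lamps (lamp h \<otimes>\<^bsub>wreath_ZZ\<^esub> w))) \<partial>walk \<mu> t \<partial>L)"
  define l where "l = lit_prob \<mu> t 0"
  have ES: "E (Suc t) = ennreal (1/2) * A + ennreal (1/2) * E t"
    unfolding E_def nn_integral_walk_Suc[where L = L and J = J, folded \<mu>_def] A_def lamps_move by simp
  have pw: "ennreal (real_of_int (lamps w)) + of_nat H * of_bool (h \<noteq> 0) \<le>
      ennreal (real_of_int (lamps (lamp h \<otimes>\<^bsub>wreath_ZZ\<^esub> w))) + 2 * of_nat H * (of_bool (h \<noteq> 0) * of_bool (fst w 0 \<noteq> 0))"
    if h: "h \<in> set_pmf L" and w: "w \<in> set_pmf (walk \<mu> t)" for h w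
  proof -
    have "w \<in> carrier wreath_ZZ" using w set_walk[OF car] unfolding \<mu>_def by auto
    from lamps_switch[OF this, of h H] h L
    have "real_of_int (lamps w + int H * of_bool (h \<noteq> 0)) \<le>
     real_of_int (lamps (lamp h \<otimes>\<^bsub>wreath_ZZ\<^esub> w) + 2 * int H * (of_bool (h \<noteq> 0) * of_bool (fst w 0 \<noteq> 0)))"
      by (subst of_int_le_iff) auto
    from ennreal_leI[OF this] have "ennreal (real_of_int (lamps w + int H * of_bool (h \<noteq> 0))) \<le>
      ennreal (real_of_int (lamps (lamp h \<otimes>\<^bsub>wreath_ZZ\<^esub> w) + 2 * int H * (of_bool (h \<noteq> 0) * of_bool (fst w 0 \<noteq> 0))))" .
    moreover have "ennreal (real_of_int (lamps v + int H * of_bool P)) = ennreal (real_of_int (lamps v)) + of_nat H * of_bool P" for v P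
      using lamps_nonneg[of v] by (simp add: of_bool_def ennreal_plus ennreal_of_nat_eq_real_of_nat)
    moreover have "ennreal (real_of_int (lamps v + 2 * int H * (of_bool P * of_bool Q))) =
        ennreal (real_of_int (lamps v)) + 2 * of_nat H * (of_bool P * of_bool Q)" for v P Q
      using lamps_nonneg[of v] by (simp add: of_bool_def ennreal_plus ennreal_mult ennreal_of_nat_eq_real_of_nat)
    ultimately show ?thesis by (simp only:)
  qed
  have "E t + of_nat H * q = (\<integral>\<^sup>+h. \<integral>\<^sup>+w. ennreal (real_of_int (lamps w)) + of_nat H * of_bool (h \<noteq> 0) \<partial>walk \<mu> t \<partial>L)"
    by (simp add: nn_integral_add nn_integral_cmult E_def q)
  also have "\<dots> \<le> (\<integral>\<^sup>+h. \<integral>\<^sup>+w. ennreal (real_of_int (lamps (lamp h \<otimes>\<^bsub>wreath_ZZ\<^esub> w))) + 2 * of_nat H * (of_bool (h \<noteq> 0) * of_bool (fst w 0 \<noteq> 0)) \<partial>walk \<mu> t \<partial>L)"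
    by (intro nn_integral_mono_AE AE_pmfI pw)
  also have "\<dots> = A + 2 * of_nat H * (q * l)"
    by (simp add: nn_integral_add nn_integral_cmult nn_integral_multc A_def l_def lit_prob_def q)
  finally have step: "E t + of_nat H * q \<le> A + 2 * of_nat H * (q * l)" .
  have half: "ennreal (1/2) * a + ennreal (1/2) * a = a" for a by (rule half_add_half)
  have "of_nat (Suc t) * (ennreal (1/2) * (of_nat H * q)) 
     = ennreal (1/2) * (of_nat H * q) + of_nat t * (ennreal (1/2) * (of_nat H * q))"
    by (simp add: distrib_right)
  also have "\<dots> \<le> ennreal (1/2) * (of_nat H * q) + (E t + of_nat H * q * (\<Sum>i<t. lit_prob \<mu> i 0))"
    using Suc.IH unfolding E_def by (rule add_left_mono)
  also have "\<dots> = ennreal (1/2) * (E t + of_nat H * q) + ennreal (1/2) * E t + of_nat H * q * (\<Sum>i<t. lit_prob \<mu> i 0)"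
  proof -
    have alg: "h * x + (e + y) = h * (e + x) + h * e + y" if "h * e + h * e = e" for h x e y :: ennreal
    proof -
      have "h * (e + x) + h * e + y = (h * e + h * e) + (h * x + y)" by (simp only: distrib_left ac_simps)
      then show ?thesis unfolding that by (simp only: ac_simps)
    qed
    show ?thesis by (rule alg[OF half])
  qed
  also have "\<dots> \<le> ennreal (1/2) * (A + 2 * of_nat H * (q * l)) + ennreal (1/2) * E t + of_nat H * q * (\<Sum>i<t. lit_prob \<mu> i 0)"
    by (intro add_right_mono mult_left_mono step) auto
  also have "ennreal (1/2) * (A + 2 * of_nat H * (q * l)) = ennreal (1/2) * A + of_nat H * (q * l)"
    using half[of "of_nat H * (q * l)"] by (simp add: distrib_left mult_2 mult_2_right distrib_right mult.assoc)
  also have "ennreal (1/2) * A + of_nat H * (q * l) + ennreal (1/2) * E t + of_nat H * q * (\<Sum>i<t. lit_prob \<mu> i 0)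
     = E (Suc t) + of_nat H * q * (\<Sum>i<Suc t. lit_prob \<mu> i 0)"
    unfolding ES l_def by (simp add: distrib_left ac_simps)
  finally show ?case unfolding E_def .
qed simp

lemma size_lamp: "size_ZZ (lamp h) \<le> \<bar>h\<bar>"
proof -
  have "lamps (lamp h) = \<bar>h\<bar>" by (subst lamps_eq_sum[of "{0}"]) auto
  moreover have "reach \<sigma> (lamp h) \<le> 0" for \<sigma> by (intro reach_le) (auto split: if_splits)
  ultimately show ?thesis unfolding size_ZZ_def by (smt (verit))
qed

lemma size_move: "size_ZZ (move x) \<le> \<bar>x\<bar>"
proof -
  have "lamps (move x) = 0" by (simp add: lamps_def)
  moreover have "reach \<sigma> (move x) \<le> max 0 (\<sigma> * x)" for \<sigma> by (intro reach_le) auto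
  from this[of 1] this[of "-1"] have "reach 1 (move x) + reach (-1) (move x) \<le> \<bar>x\<bar>" by auto
  ultimately show ?thesis unfolding size_ZZ_def by linarith
qed

lemma heavy_jump_moment:
  assumes "0 < p" "p < a"
  obtains m :: real where "m > 0" "(\<integral>\<^sup>+x. ennreal (\<bar>real_of_int x\<bar> powr p) \<partial>heavy_jump a) \<le> ennreal m"
proof -
  define s where "s = 2 powr (- a)"
  define r where "r = 2 powr (p - a)"
  have s: "0 < s" "s < 1" using assms powr_less_mono[of "-a" 0 2] by (auto simp: s_def)
  have r: "0 < r" "r < 1" using assms powr_less_mono[of "p-a" 0 2] by (auto simp: r_def)
  have "(\<integral>\<^sup>+x. ennreal (\<bar>real_of_int x\<bar> powr p) \<partial>heavy_jump a) 
     \<le> (\<integral>\<^sup>+j. ennreal ((2 powr p) ^ j) \<partial>geometric_pmf (1 - s))"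
    unfolding heavy_jump_def s_def[symmetric] nn_integral_bind_pmf
  proof (rule nn_integral_mono)
    fix j
    have "(\<integral>\<^sup>+x. ennreal (\<bar>real_of_int x\<bar> powr p) \<partial>pmf_of_set {- (2 ^ j)..2 ^ j :: int}) 
       \<le> (\<integral>\<^sup>+x. ennreal ((2 powr p) ^ j) \<partial>pmf_of_set {- (2 ^ j)..2 ^ j :: int})"
    proof (rule nn_integral_mono_AE, unfold AE_measure_pmf_iff, rule ballI)
      fix x assume "x \<in> set_pmf (pmf_of_set {- (2 ^ j)..2 ^ j :: int})"
      then have "\<bar>x\<bar> \<le> 2 ^ j" by (subst (asm) set_pmf_of_set) auto
      then have "real_of_int \<bar>x\<bar> \<le> real_of_int (2 ^ j)" by (simp only: of_int_le_iff)
      then have "\<bar>real_of_int x\<bar> powr p \<le> (2 ^ j) powr p" using assms by (intro powr_mono2) auto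
      also have "\<dots> = (2 powr p) ^ j" by (simp add: powr_realpow[symmetric] powr_powr mult.commute)
      finally show "ennreal (\<bar>real_of_int x\<bar> powr p) \<le> ennreal ((2 powr p) ^ j)" by (rule ennreal_leI)
    qed
    then show "(\<integral>\<^sup>+x. ennreal (\<bar>real_of_int x\<bar> powr p) \<partial>pmf_of_set {- (2 ^ j)..2 ^ j :: int}) \<le> ennreal ((2 powr p) ^ j)"
      by simp
  qed
  also have "\<dots> = (\<Sum>j. ennreal ((1 - s) * r ^ j))"
  proof -
    have "2 powr p * s = r" by (simp add: s_def r_def flip: powr_add)
    then have *: "s ^ j * (1 - s) * (2 powr p) ^ j = (1 - s) * r ^ j" for j
      by (simp add: power_mult_distrib[symmetric] mult.commute mult.left_commute)
    have "ennreal (pmf (geometric_pmf (1 - s)) j) * ennreal ((2 powr p) ^ j) = ennreal ((1 - s) * r ^ j)" for j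
      using s unfolding *[symmetric] by (subst ennreal_mult[symmetric]) auto
    then show ?thesis
      unfolding nn_integral_measure_pmf nn_integral_count_space_nat by simp
  qed
  also have "\<dots> = ennreal ((1 - s) * (1 / (1 - r)))"
    using r s by (intro suminf_ennreal_eq sums_mult geometric_sums) auto
  finally show ?thesis using r s by (intro that[of "(1 - s) * (1 / (1 - r))"]) auto
qed

section \<open>The exponent\<close>

text \<open>The index \<open>a\<close> is any number strictly between \<open>p\<close>, which keeps the \<open>p\<close>-th moment of the jumps
  finite, and \<open>1/\<eta>\<close>, which gives the return probabilities \<open>O(k\<^bsup>-\<eta>\<^esup>)\<close>. The amplitude \<open>H\<close> is chosen so
  that \<open>q = H\<^bsup>-p\<^esup>\<close> is at most \<open>t\<^bsup>-(1-\<eta>)\<^esup>/D\<close>, with \<open>D\<close> so large that lamps are lit with probability at most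
  \<open>1/4\<close>; then at least half of the expected gain from the switches survives.\<close>
lemma lower_sequence:
  fixes p \<eta> :: real
  assumes p: "1 < p" "p < 2" and S: "finite_symmetric_generating_set wreath_ZZ S"
    and \<eta>: "0 < \<eta>" "\<eta> < 1 / p"
  shows "\<exists>\<mu>\<in>admissible_seqs wreath_ZZ (word_metric wreath_ZZ S) p.
    ereal (1 - (1 - \<eta>) * (1 - 1 / p)) \<le> beta_star_seq wreath_ZZ (word_metric wreath_ZZ S) p \<mu>"
proof -
  have \<eta>1: "\<eta> < 1" using \<eta> p by (smt (verit) divide_le_eq_1)
  define a where "a = (p + 1 / \<eta>) / 2"
  have "p < 1 / \<eta>" using \<eta> p by (simp add: field_simps)
  then have a: "p < a" "a * \<eta> < 1" using \<eta> p by (simp_all add: a_def field_simps)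
  have a0: "a > 0" using a p by simp
  define J where "J = heavy_jump a"
  obtain m where m: "m > 0" "(\<integral>\<^sup>+x. ennreal (\<bar>real_of_int x\<bar> powr p) \<partial>J) \<le> ennreal m"
    unfolding J_def using heavy_jump_moment[of p a] a p by auto
  obtain C where C: "C > 0" and decay: "\<And>L t y. at_prob (switch_or_walk L J) t y \<le> ennreal (C * real (Suc t) powr (- \<eta>))"
    unfolding J_def using at_prob_decay[OF \<eta>(1) a0 a(2)] by metis
  define D where "D = max 1 (2 * C / (1 - \<eta>))"
  have D: "D \<ge> 1" "2 * C / (1 - \<eta>) \<le> D" by (auto simp: D_def)
  define H where "H t = nat \<lceil>(D * real t powr (1 - \<eta>)) powr (1 / p)\<rceil>" for t
  define q where "q t = real (H t) powr (- p)" for t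
  \<comment> \<open>Rounding up costs at most a factor \<open>2\<close>, as the number to be rounded is at least \<open>1\<close>.\<close>
  have H: "H t \<ge> 1" "(D * real t powr (1 - \<eta>)) powr (1 / p) \<le> real (H t)"
    "real (H t) \<le> 2 * (D * real t powr (1 - \<eta>)) powr (1 / p)" if "t \<ge> 1" for t
  proof -
    have "real t powr (1 - \<eta>) \<ge> 1" using that \<eta>1 by (intro ge_one_powr_ge_zero) auto
    then have "D * real t powr (1 - \<eta>) \<ge> 1" using D mult_mono[of 1 D 1 "real t powr (1 - \<eta>)"] by simp
    then have "(D * real t powr (1 - \<eta>)) powr (1 / p) \<ge> 1" using p by (intro ge_one_powr_ge_zero) auto
    then show "H t \<ge> 1" "(D * real t powr (1 - \<eta>)) powr (1 / p) \<le> real (H t)"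
      "real (H t) \<le> 2 * (D * real t powr (1 - \<eta>)) powr (1 / p)"
      unfolding H_def by linarith+
  qed
  define \<mu> where "\<mu> t = switch_or_walk (rare_switch p (H t)) J" for t
  have sym: "symmetric_pmf_on wreath_ZZ (\<mu> t)" for t
    unfolding \<mu>_def J_def by (intro switch_or_walk_symmetric rare_switch_symmetric heavy_jump_symmetric)
  have car: "set_pmf (\<mu> t) \<subseteq> carrier wreath_ZZ" for t using sym[of t] by (simp add: symmetric_pmf_on_def)

  obtain K where K: "K > 0" "\<And>g. g \<in> carrier wreath_ZZ \<Longrightarrow> size_ZZ g \<le> K * int (wl S g)"
    using size_le_word_length[OF S] by blast
  obtain K' where K': "K' > 0" "\<And>g. g \<in> carrier wreath_ZZ \<Longrightarrow> int (wl S g) \<le> K' * size_ZZ g"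
    using word_length_le_size[OF S] by blast

  \<comment> \<open>Both kinds of step have \<open>p\<close>-th moment bounded uniformly in \<open>t\<close>.\<close>
  define B where "B = real_of_int K' powr p * (1 + m)"
  have "real_of_int K' powr p \<ge> 1" using K' p by (intro ge_one_powr_ge_zero) auto
  then have B: "B \<ge> 1" using m mult_mono[of 1 "real_of_int K' powr p" 1 "1 + m"] by (simp add: B_def)
  have wl_powr: "ennreal (real (wl S g) powr p) \<le> ennreal (real_of_int K' powr p) * ennreal (\<bar>real_of_int n\<bar> powr p)"
    if "g \<in> carrier wreath_ZZ" "size_ZZ g \<le> \<bar>n\<bar>" for g n
  proof -
    have "int (wl S g) \<le> K' * \<bar>n\<bar>" using K'(2)[OF that(1)] mult_left_mono[OF that(2), of K'] K'(1) by linarith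
    then have "real_of_int (int (wl S g)) \<le> real_of_int (K' * \<bar>n\<bar>)" by (simp only: of_int_le_iff)
    then have "real (wl S g) powr p \<le> (real_of_int K' * \<bar>real_of_int n\<bar>) powr p" using p by (intro powr_mono2) auto
    then show ?thesis using K' by (auto simp: powr_mult ennreal_mult[symmetric] intro!: ennreal_leI)
  qed
  have moment: "(\<integral>\<^sup>+g. ennreal (real (wl S g) powr p) \<partial>\<mu> t) \<le> ennreal B" if t: "t \<ge> 1" for t
  proof -
    have half1: "ennreal (1/2) \<le> 1" unfolding ennreal_1[symmetric] by (rule ennreal_leI) simp
    let ?k = "ennreal (real_of_int K' powr p)"
    have "(\<integral>\<^sup>+h. ennreal (real (wl S (lamp h)) powr p) \<partial>rare_switch p (H t)) \<le> (\<integral>\<^sup>+h. ?k * ennreal (\<bar>real_of_int h\<bar> powr p) \<partial>rare_switch p (H t))"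
      by (intro nn_integral_mono wl_powr size_lamp) simp
    also have "\<dots> = ?k * (\<integral>\<^sup>+h. ennreal (\<bar>real_of_int h\<bar> powr p) \<partial>rare_switch p (H t))"
      by (simp add: nn_integral_cmult)
    also have "(\<integral>\<^sup>+h. ennreal (\<bar>real_of_int h\<bar> powr p) \<partial>rare_switch p (H t)) = ennreal (real (H t) powr (- p)) * ennreal (real (H t) powr p)"
    proof (rule nn_integral_rare_switch)
      fix h :: int assume "\<bar>h\<bar> = int (H t)"
      then have "\<bar>real_of_int h\<bar> = real (H t)" by (metis of_int_abs of_int_of_nat_eq)
      then show "ennreal (\<bar>real_of_int h\<bar> powr p) = ennreal (real (H t) powr p)" by simp
    qed (use H(1)[OF t] p in auto)
    also have "\<dots> = 1" using H(1)[OF t] by (simp add: ennreal_mult[symmetric] flip: powr_add)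
    finally have L: "(\<integral>\<^sup>+h. ennreal (real (wl S (lamp h)) powr p) \<partial>rare_switch p (H t)) \<le> ?k" by simp
    have "(\<integral>\<^sup>+x. ennreal (real (wl S (move x)) powr p) \<partial>J) \<le> (\<integral>\<^sup>+x. ?k * ennreal (\<bar>real_of_int x\<bar> powr p) \<partial>J)"
      by (intro nn_integral_mono wl_powr size_move) simp
    also have "\<dots> = ?k * (\<integral>\<^sup>+x. ennreal (\<bar>real_of_int x\<bar> powr p) \<partial>J)"
      by (simp add: nn_integral_cmult)
    also have "\<dots> \<le> ?k * ennreal m" by (intro mult_left_mono m) auto
    finally have X: "(\<integral>\<^sup>+x. ennreal (real (wl S (move x)) powr p) \<partial>J) \<le> ?k * ennreal m" .
    have "(\<integral>\<^sup>+g. ennreal (real (wl S g) powr p) \<partial>\<mu> t) \<le> 1 * ?k + 1 * (?k * ennreal m)"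
      unfolding \<mu>_def nn_integral_switch_or_walk by (intro add_mono mult_mono L X half1) auto
    also have "\<dots> = ennreal B" using m by (simp add: B_def ennreal_mult ennreal_plus distrib_left)
    finally show ?thesis .
  qed

  \<comment> \<open>The jump law does not depend on \<open>t\<close>, so a step is nontrivial with probability bounded below.\<close>
  define \<kappa> where "\<kappa> = pmf J 1 / 2"
  have "1 \<in> set_pmf J"
  proof -
    have "2 powr (- a) < 1" "0 < 2 powr (- a)" using a0 powr_less_mono[of "-a" 0 2] by auto
    then have "(0::nat) \<in> set_pmf (geometric_pmf (1 - 2 powr (- a)))" by (subst set_pmf_geometric) auto
    then show ?thesis unfolding J_def heavy_jump_def set_bind_pmf by (intro UN_I[of 0]) auto
  qed
  then have \<kappa>: "\<kappa> > 0" by (simp add: \<kappa>_def pmf_positive)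
  have nontriv: "measure_pmf.prob (\<mu> t) (carrier wreath_ZZ - {\<one>\<^bsub>wreath_ZZ\<^esub>}) \<ge> \<kappa>" for t
  proof -
    have "ennreal \<kappa> = ennreal (1/2) * ennreal (pmf J 1)"
      unfolding \<kappa>_def by (subst ennreal_mult[symmetric]) auto
    also have "ennreal (pmf J 1) = (\<integral>\<^sup>+x. indicator {1} x \<partial>J)" by (simp add: emeasure_pmf_single)
    also have "\<dots> \<le> (\<integral>\<^sup>+x. indicator (carrier wreath_ZZ - {\<one>\<^bsub>wreath_ZZ\<^esub>}) (move x) \<partial>J)"
      by (intro nn_integral_mono) (auto simp: indicator_def one_wreath)
    finally have "ennreal \<kappa> \<le> (\<integral>\<^sup>+g. indicator (carrier wreath_ZZ - {\<one>\<^bsub>wreath_ZZ\<^esub>}) g \<partial>\<mu> t)"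
      unfolding \<mu>_def nn_integral_switch_or_walk by (simp add: add_increasing mult_left_mono)
    also have "\<dots> = ennreal (measure_pmf.prob (\<mu> t) (carrier wreath_ZZ - {\<one>\<^bsub>wreath_ZZ\<^esub>}))"
      by (simp add: measure_pmf.emeasure_eq_measure)
    finally show ?thesis by simp
  qed

  have wm: "word_metric wreath_ZZ S g \<one>\<^bsub>wreath_ZZ\<^esub> = real (wl S g)" if "g \<in> set_pmf (\<mu> t)" for g t
    using word_metric_one[OF S] that car by blast
  have adm: "\<mu> \<in> admissible_seqs wreath_ZZ (word_metric wreath_ZZ S) p"
    unfolding admissible_seqs_def mem_Collect_eq
  proof (intro conjI allI impI)
    fix t :: nat assume t: "1 \<le> t"
    show "symmetric_pmf_on wreath_ZZ (\<mu> t)" by (rule sym)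
    have "(\<integral>\<^sup>+g. ennreal (word_metric wreath_ZZ S g \<one>\<^bsub>wreath_ZZ\<^esub> powr p) \<partial>\<mu> t) = (\<integral>\<^sup>+g. ennreal (real (wl S g) powr p) \<partial>\<mu> t)"
      by (intro nn_integral_cong_AE AE_pmfI) (simp only: wm)
    also have "\<dots> < \<infinity>" using moment[OF t] by (rule le_less_trans) simp
    finally show "integrable (measure_pmf (\<mu> t)) (\<lambda>x. word_metric wreath_ZZ S x \<one>\<^bsub>wreath_ZZ\<^esub> powr p)"
      by (intro integrableI_nonneg) auto
  next
    have "filterlim (\<lambda>t. real t * \<kappa>) at_top sequentially"
      using \<kappa> by (intro filterlim_at_top_mult_tendsto_pos[OF tendsto_const \<kappa> filterlim_real_sequentially])
    then show "filterlim (\<lambda>t. real t * measure_pmf.prob (\<mu> t) (carrier wreath_ZZ - {\<one>\<^bsub>wreath_ZZ\<^esub>})) at_top sequentially"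
      by (rule filterlim_at_top_mono) (auto intro!: always_eventually mult_left_mono nontriv)
  qed

  define cst where "cst = cost p S \<mu>"
  have cost_le: "cst t \<le> B * real t" if t: "t \<ge> 1" for t
  proof -
    have "ennreal (measure_pmf.expectation (\<mu> t) (\<lambda>g. real (wl S g) powr p)) = (\<integral>\<^sup>+g. ennreal (real (wl S g) powr p) \<partial>\<mu> t)"
      using admissible_integrable[OF p S adm t] by (intro nn_integral_eq_integral[symmetric]) auto
    also have "\<dots> \<le> ennreal B" by (rule moment[OF t])
    finally have "measure_pmf.expectation (\<mu> t) (\<lambda>g. real (wl S g) powr p) \<le> B" using B by simp
    from mult_left_mono[OF this, of "real t"] show ?thesis
      unfolding cst_def cost_def[OF p S adm] by (simp add: mult.commute[of B])
  qed
  have cost_top: "filterlim cst at_top sequentially" unfolding cst_def by (rule cost_tendsto[OF p S adm])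

  define \<beta> where "\<beta> = 1 - (1 - \<eta>) * (1 - 1 / p)"
  \<comment> \<open>Up to the comparison constant \<open>K\<close>, each step gains \<open>H q/2\<close> and loses at most \<open>H q/4\<close> on average, and
     \<open>H q = H\<^bsup>1-p\<^esup>\<close>; the power of \<open>t\<close> in the latter goes into \<open>\<beta>\<close>.\<close>
  define c where "c = (2 * D powr (1 / p)) powr (1 - p) / (4 * real_of_int K)"
  have c: "c > 0" using D K by (simp add: c_def)
  have lower: "measure_pmf.expectation (walk (\<mu> t) t) (\<lambda>w. real (wl S w)) \<ge> c * real t powr \<beta>"
    if t: "t \<ge> 1" and c1: "cst t \<ge> 1" for t
  proof -
    have q: "(\<integral>\<^sup>+h. of_bool (h \<noteq> 0) \<partial>rare_switch p (H t)) = ennreal (q t)"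
      using nn_integral_rare_switch[of "H t" p "\<lambda>h. of_bool (h \<noteq> 0)" 1] H(1)[OF t] p by (auto simp: q_def)
    \<comment> \<open>The expected number of visits to a site is at most \<open>D t\<^bsup>1-\<eta>\<^esup>/2\<close>, and \<open>q\<close> is at most the inverse of
       \<open>D t\<^bsup>1-\<eta>\<^esup>\<close>.\<close>
    have lit: "lit_prob (\<mu> t) i 0 \<le> ennreal (1/4)" if i: "i < t" for i
    proof -
      have "(\<Sum>k<i. C * real (Suc k) powr (- \<eta>)) \<le> C * (real i powr (1 - \<eta>) / (1 - \<eta>))"
        unfolding sum_distrib_left[symmetric] using C \<eta>(1) \<eta>1 by (intro mult_left_mono sum_powr_le) auto
      also have "\<dots> \<le> C * (real t powr (1 - \<eta>) / (1 - \<eta>))"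
        using C \<eta>1 i by (intro mult_left_mono divide_right_mono powr_mono2) auto
      also have "\<dots> = (2 * C / (1 - \<eta>)) * real t powr (1 - \<eta>) / 2"
        using \<eta>1 by (simp add: field_simps)
      also have "\<dots> \<le> D * real t powr (1 - \<eta>) / 2"
        using D by (intro divide_right_mono mult_right_mono) auto
      finally have s: "(\<Sum>k<i. C * real (Suc k) powr (- \<eta>)) \<le> D * real t powr (1 - \<eta>) / 2" .
      define y where "y = D * real t powr (1 - \<eta>)"
      have y: "y > 0" using D t by (simp add: y_def)
      have "q t * y \<le> 1"
      proof -
        have "y = (y powr (1 / p)) powr p" using y p by (simp add: powr_powr)
        also have "\<dots> \<le> real (H t) powr p" using H(2)[OF t] p unfolding y_def by (intro powr_mono2) auto
        finally have "q t * y \<le> q t * real (H t) powr p" by (intro mult_left_mono) (auto simp: q_def)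
        also have "\<dots> = 1" using H(1)[OF t] by (simp add: q_def flip: powr_add)
        finally show ?thesis .
      qed
      have "lit_prob (\<mu> t) i 0 \<le> ennreal (1/2) * ennreal (q t) * (\<Sum>k<i. at_prob (\<mu> t) k 0)"
        unfolding \<mu>_def by (rule lit_prob_le) (simp add: q)
      also have "\<dots> \<le> ennreal (1/2) * ennreal (q t) * (\<Sum>k<i. ennreal (C * real (Suc k) powr (- \<eta>)))"
        unfolding \<mu>_def by (intro mult_left_mono sum_mono decay) auto
      also have "(\<Sum>k<i. ennreal (C * real (Suc k) powr (- \<eta>))) = ennreal (\<Sum>k<i. C * real (Suc k) powr (- \<eta>))"
        using C by (intro sum_ennreal) auto
      also have "ennreal (1/2) * ennreal (q t) * \<dots> \<le> ennreal (1/2) * ennreal (q t) * ennreal (y / 2)"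
        unfolding y_def by (intro mult_left_mono ennreal_leI s) auto
      also have "\<dots> = ennreal (1/2 * q t * (y / 2))"
      proof -
        have "ennreal (1/2 * q t) = ennreal (1/2) * ennreal (q t)" by (rule ennreal_mult) (auto simp: q_def)
        moreover have "ennreal (1/2 * q t * (y / 2)) = ennreal (1/2 * q t) * ennreal (y / 2)"
          using y by (intro ennreal_mult) (auto simp: q_def)
        ultimately show ?thesis by simp
      qed
      also have "\<dots> \<le> ennreal (1/4)" using \<open>q t * y \<le> 1\<close> by (intro ennreal_leI) simp
      finally show ?thesis .
    qed
    define E where "E = measure_pmf.expectation (walk (\<mu> t) t) (\<lambda>w. real (wl S w))"
    have E: "ennreal E = (\<integral>\<^sup>+w. ennreal (real (wl S w)) \<partial>walk (\<mu> t) t)"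
      unfolding E_def using walk_length_integrable[OF p S adm t] c1
      by (intro nn_integral_eq_integral[symmetric]) (auto simp: cst_def)
    have E0: "E \<ge> 0" unfolding E_def by (rule Bochner_Integration.integral_nonneg) simp
    have "(\<integral>\<^sup>+w. ennreal (real_of_int (lamps w)) \<partial>walk (\<mu> t) t) \<le> (\<integral>\<^sup>+w. ennreal (real_of_int K) * ennreal (real (wl S w)) \<partial>walk (\<mu> t) t)"
    proof (rule nn_integral_mono_AE, rule AE_pmfI)
      fix w assume "w \<in> set_pmf (walk (\<mu> t) t)"
      then have w: "w \<in> carrier wreath_ZZ" using set_walk[OF car] by blast
      have "lamps w \<le> K * int (wl S w)"
        using K(2)[OF w] reach_ge(1)[OF w, of 1] reach_ge(1)[OF w, of "-1"] by (simp add: size_ZZ_def)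
      then have "real_of_int (lamps w) \<le> real_of_int (K * int (wl S w))" by (simp only: of_int_le_iff)
      then show "ennreal (real_of_int (lamps w)) \<le> ennreal (real_of_int K) * ennreal (real (wl S w))"
        using K by (auto simp: ennreal_mult[symmetric] intro!: ennreal_leI)
    qed
    also have "\<dots> = ennreal (real_of_int K * E)" using K E0 by (simp add: nn_integral_cmult E[symmetric] ennreal_mult)
    finally have lE: "(\<integral>\<^sup>+w. ennreal (real_of_int (lamps w)) \<partial>walk (\<mu> t) t) \<le> ennreal (real_of_int K * E)" .
    define z where "z = real (H t) * q t"
    have z0: "z \<ge> 0" by (simp add: z_def q_def)
    have z: "of_nat (H t) * ennreal (q t) = ennreal z"
      unfolding z_def by (simp add: ennreal_mult ennreal_of_nat_eq_real_of_nat q_def)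
    have "of_nat t * (ennreal (1/2) * (of_nat (H t) * ennreal (q t))) \<le> 
      (\<integral>\<^sup>+w. ennreal (real_of_int (lamps w)) \<partial>walk (\<mu> t) t) + of_nat (H t) * ennreal (q t) * (\<Sum>i<t. lit_prob (\<mu> t) i 0)"
      unfolding \<mu>_def by (rule walk_lamps_lower[OF set_rare_switch q car[unfolded \<mu>_def]])
    also have "\<dots> \<le> ennreal (real_of_int K * E) + of_nat (H t) * ennreal (q t) * (\<Sum>i<t. ennreal (1/4))"
      by (intro add_mono lE mult_left_mono sum_mono lit) auto
    finally have "ennreal (real t * (1/2 * z)) \<le> ennreal (real_of_int K * E + z * (real t * (1/4)))"
    proof -
      have "of_nat t * (ennreal (1/2) * ennreal z) = ennreal (real t * (1/2 * z))"
        using z0 ennreal_mult[of "1/2" z] ennreal_mult[of "real t" "1/2 * z"]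
        by (simp only: ennreal_of_nat_eq_real_of_nat)
      moreover have "(\<Sum>i<t. ennreal (1/4)) = ennreal (real t * (1/4))"
        using ennreal_mult[of "real t" "1/4"]
        by (simp add: ennreal_of_nat_eq_real_of_nat)
      moreover have "ennreal (real_of_int K * E) + ennreal z * ennreal (real t * (1/4))
         = ennreal (real_of_int K * E + z * (real t * (1/4)))"
        using z0 E0 K(1) ennreal_mult[of z "real t * (1/4)"] ennreal_plus[of "real_of_int K * E" "z * (real t * (1/4))"]
        by simp
      ultimately show "of_nat t * (ennreal (1/2) * (of_nat (H t) * ennreal (q t))) \<le>
          ennreal (real_of_int K * E) + of_nat (H t) * ennreal (q t) * (\<Sum>i<t. ennreal (1/4)) \<Longrightarrow>
          ennreal (real t * (1/2 * z)) \<le> ennreal (real_of_int K * E + z * (real t * (1/4)))"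
        unfolding z by (simp only:)
    qed
    then have "real t * (1/2 * z) \<le> real_of_int K * E + z * (real t * (1/4))"
      using z0 E0 K by (subst (asm) ennreal_le_iff) auto
    then have 1: "real t * z / (4 * real_of_int K) \<le> E" using K by (simp add: field_simps)
    have "(2 * (D * real t powr (1 - \<eta>)) powr (1 / p)) powr (1 - p) \<le> real (H t) powr (1 - p)"
      using H[OF t] p by (intro powr_mono2') auto
    also have "\<dots> = z" using H(1)[OF t] powr_add[of "real (H t)" 1 "- p"] by (simp add: z_def q_def)
    also have "(2 * (D * real t powr (1 - \<eta>)) powr (1 / p)) powr (1 - p) = 
       (2 * D powr (1 / p)) powr (1 - p) * real t powr ((1 - \<eta>) / p * (1 - p))"
      using D by (simp add: powr_mult powr_powr)
    finally have gain: "real t * ((2 * D powr (1 / p)) powr (1 - p) * real t powr ((1 - \<eta>) / p * (1 - p))) / (4 * real_of_int K)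
      \<le> real t * z / (4 * real_of_int K)"
      using K by (intro divide_right_mono mult_left_mono) auto
    have exponent: "real t * real t powr ((1 - \<eta>) / p * (1 - p)) = real t powr \<beta>"
    proof -
      have "real t * real t powr ((1 - \<eta>) / p * (1 - p)) = real t powr (1 + (1 - \<eta>) / p * (1 - p))"
        using t by (simp add: powr_add)
      also have "1 + (1 - \<eta>) / p * (1 - p) = \<beta>" using p by (simp add: \<beta>_def field_simps)
      finally show ?thesis .
    qed
    have "c * real t powr \<beta> = real t * ((2 * D powr (1 / p)) powr (1 - p) * real t powr ((1 - \<eta>) / p * (1 - p))) / (4 * real_of_int K)"
      unfolding exponent[symmetric] c_def by simp
    with gain 1 show ?thesis unfolding E_def by linarith
  qed

  have \<beta>: "\<beta> > 0"
  proof -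
    have "(1 - \<eta>) * (1 - 1 / p) < 1 * 1" using \<eta> \<eta>1 p by (intro mult_strict_mono') auto
    then show ?thesis by (simp add: \<beta>_def)
  qed
  define f where "f t = (ln c + \<beta> * ln (real t)) / (ln B + ln (real t))" for t :: nat
  have "(f \<longlonglongrightarrow> \<beta>)" unfolding f_def by real_asymp
  then have lim: "((\<lambda>t. ereal (f t)) \<longlongrightarrow> ereal \<beta>) sequentially" by simp
  have "ereal \<beta> = limsup (\<lambda>t. ereal (f t))" using lim by (intro lim_imp_Limsup[symmetric]) auto
  also have "\<dots> \<le> beta_star_seq wreath_ZZ (word_metric wreath_ZZ S) p \<mu>"
    unfolding beta_star_seq_eq[OF p S adm] cst_def[symmetric]
  proof (rule Limsup_mono)
    have "filterlim (\<lambda>t. ln c + \<beta> * ln (real t)) at_top sequentially" using \<beta> by real_asymp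
    then have "\<forall>\<^sub>F t in sequentially. ln c + \<beta> * ln (real t) \<ge> 0" by (simp add: filterlim_at_top)
    moreover have "\<forall>\<^sub>F t in sequentially. cst t \<ge> 2" using cost_top by (simp add: filterlim_at_top)
    ultimately show "\<forall>\<^sub>F t in sequentially. ereal (f t) \<le> ereal (ln (measure_pmf.expectation (walk (\<mu> t) t) (\<lambda>w. real (wl S w))) / ln (cst t))"
      using eventually_ge_at_top[of 1]
    proof eventually_elim
      case (elim t)
      define E where "E = measure_pmf.expectation (walk (\<mu> t) t) (\<lambda>w. real (wl S w))"
      have t: "real t > 0" using elim by simp
      have "ln c + \<beta> * ln (real t) = ln (c * real t powr \<beta>)"
        using c t by (simp add: ln_mult ln_powr)
      also have "\<dots> \<le> ln E" using lower[of t] elim c t unfolding E_def by (intro ln_mono) auto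
      finally have 1: "ln c + \<beta> * ln (real t) \<le> ln E" .
      have 2: "ln (cst t) \<le> ln B + ln (real t)"
        using cost_le[of t] elim B t ln_mono[of "cst t" "B * real t"] by (simp add: ln_mult)
      have "f t \<le> ln E / ln (cst t)"
        unfolding f_def using 1 2 elim by (intro frac_le) auto
      then show ?case unfolding E_def by simp
    qed
  qed
  finally show ?thesis using adm unfolding \<beta>_def by blast
qed

theorem theorem6p1:
  fixes p :: real and S :: "((int \<Rightarrow> int) \<times> int) set"
  assumes "1 < p" and "p < 2"
    and "finite_symmetric_generating_set wreath_ZZ S"
  shows "beta_star wreath_ZZ (word_metric wreath_ZZ S) p = ereal ((2 * p - 1) / p\<^sup>2)"
proof (rule antisym)
  show "beta_star wreath_ZZ (word_metric wreath_ZZ S) p \<le> ereal ((2 * p - 1) / p\<^sup>2)"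
    unfolding beta_star_def by (intro SUP_least beta_star_seq_le assms)
  have "((\<lambda>\<eta>. ereal (1 - (1 - \<eta>) * (1 - 1 / p))) \<longlongrightarrow> ereal (1 - (1 - 1 / p) * (1 - 1 / p))) (at_left (1 / p))"
    by (intro tendsto_intros)
  moreover have "\<forall>\<^sub>F \<eta> in at_left (1 / p). ereal (1 - (1 - \<eta>) * (1 - 1 / p)) \<le> beta_star wreath_ZZ (word_metric wreath_ZZ S) p"
  proof -
    have "\<forall>\<^sub>F \<eta> in at_left (1 / p). \<eta> \<in> {0<..<1 / p}" using assms by (intro eventually_at_left_real) simp
    then show ?thesis
    proof eventually_elim
      case (elim \<eta>)
      then obtain \<mu> where "\<mu> \<in> admissible_seqs wreath_ZZ (word_metric wreath_ZZ S) p"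
        "ereal (1 - (1 - \<eta>) * (1 - 1 / p)) \<le> beta_star_seq wreath_ZZ (word_metric wreath_ZZ S) p \<mu>"
        using lower_sequence[OF assms, of \<eta>] by auto
      then show ?case unfolding beta_star_def by (intro SUP_upper2[of \<mu>])
    qed
  qed
  ultimately have "ereal (1 - (1 - 1 / p) * (1 - 1 / p)) \<le> beta_star wreath_ZZ (word_metric wreath_ZZ S) p"
    by (rule tendsto_upperbound) simp
  also have "1 - (1 - 1 / p) * (1 - 1 / p) = (2 * p - 1) / p\<^sup>2"
    using assms by (simp add: field_simps power2_eq_square)
  finally show "ereal ((2 * p - 1) / p\<^sup>2) \<le> beta_star wreath_ZZ (word_metric wreath_ZZ S) p" .
qed

end
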